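(* Let $W\in C^2(\mathbb{R}^n;\mathbb{R})$ with $W\ge 0$, and let $u\in W^{1,2}_{\mathrm{loc}}(\mathbb{R}^n;\mathbb{R}^n)\cap L^\infty_{\mathrm{loc}}(\mathbb{R}^n;\mathbb{R}^n)$ be a solution of the system $$\Delta u-W_u(u)=0\quad\text{in }\mathbb{R}^n.$$ Let $x_0\in\mathbb{R}^n$ be arbitrary and, for $R>0$, let $B_R=B(x_0;R)$ be the ball in $\mathbb{R}^n$ of center $x_0$ and radius $R$, and $$E_{B_R}(u)=\int_{B_R}\left(\frac12|\nabla u|^2+W(u)\right)dx.$$ Then $$\frac{d}{dR}\left(R^{-(n-2)}E_{B_R}(u)\right)\ge 0\quad\text{for all } R>0.$$
   Context: $W_u=(\partial W/\partial u_1,\dots,\partial W/\partial u_n)^\top$ is the gradient of $W$; $\nabla u$ is the $n\times n$ matrix $(\partial u_i/\partial x_j)$ and $|\nabla u|$ is its Euclidean norm, $|\nabla u|^2=\sum_{i,j}(\partial u_i/\partial x_j)^2$. Solutions are understood in the weak (distributional) sense. *)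

theory Defs
  imports "HOL-Analysis.Analysis"
begin

definition partial :: "'n::finite \<Rightarrow> (real^'n \<Rightarrow> real) \<Rightarrow> real^'n \<Rightarrow> real" where
  "partial j f x = frechet_derivative f (at x) (axis j 1)"

definition gradient :: "(real^'n::finite \<Rightarrow> real) \<Rightarrow> real^'n \<Rightarrow> real^'n" where
  "gradient f x = (\<chi> j. partial j f x)"

definition laplacian :: "(real^'n::finite \<Rightarrow> real) \<Rightarrow> real^'n \<Rightarrow> real" where
  "laplacian f x = (\<Sum>j\<in>UNIV. partial j (partial j f) x)"

text \<open>The requirement of differentiability makes the values of \<open>partial\<close> meaningful;
  \<open>frechet_derivative\<close> is unspecified at points of non-differentiability.\<close>

primrec C_k :: "nat \<Rightarrow> (real^'n::finite \<Rightarrow> real) \<Rightarrow> bool" where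
  "C_k 0 f \<longleftrightarrow> continuous_on UNIV f"
| "C_k (Suc k) f \<longleftrightarrow> f differentiable_on UNIV \<and> (\<forall>j. C_k k (partial j f))"

definition test_function :: "(real^'n::finite \<Rightarrow> real) \<Rightarrow> bool" where
  "test_function \<phi> \<longleftrightarrow> (\<forall>k. C_k k \<phi>) \<and> compact (closure {x. \<phi> x \<noteq> 0})"

definition L1_loc :: "('a::euclidean_space \<Rightarrow> 'b::euclidean_space) \<Rightarrow> bool" where
  "L1_loc f \<longleftrightarrow> f \<in> borel_measurable lebesgue \<and>
     (\<forall>K. compact K \<longrightarrow> set_integrable lebesgue K f)"

definition L2_loc :: "('a::euclidean_space \<Rightarrow> 'b::euclidean_space) \<Rightarrow> bool" where
  "L2_loc f \<longleftrightarrow> f \<in> borel_measurable lebesgue \<and>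
     (\<forall>K. compact K \<longrightarrow> set_integrable lebesgue K (\<lambda>x. (norm (f x))\<^sup>2))"

definition Linf_loc :: "('a::euclidean_space \<Rightarrow> 'b::euclidean_space) \<Rightarrow> bool" where
  "Linf_loc f \<longleftrightarrow> f \<in> borel_measurable lebesgue \<and>
     (\<forall>K. compact K \<longrightarrow> (\<exists>M. AE x in lebesgue. x \<in> K \<longrightarrow> norm (f x) \<le> M))"

text \<open>The entry \<open>G x $ i $ j\<close> is the distributional derivative of the component \<open>u\<^sub>i\<close> with
  respect to \<open>x\<^sub>j\<close>.\<close>

definition has_weak_gradient ::
    "(real^'n::finite \<Rightarrow> real^'m::finite) \<Rightarrow> (real^'n \<Rightarrow> real^'n^'m) \<Rightarrow> bool" where
  "has_weak_gradient u G \<longleftrightarrow> L1_loc u \<and> L1_loc G \<and>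
     (\<forall>\<phi> i j. test_function \<phi> \<longrightarrow>
        (LINT x|lebesgue. u x $ i * partial j \<phi> x) = - (LINT x|lebesgue. G x $ i $ j * \<phi> x))"

text \<open>Weak gradients are unique up to null sets, so integrals of \<open>weak_gradient u\<close> do not
  depend on the chosen representative.\<close>

definition weak_gradient ::
    "(real^'n::finite \<Rightarrow> real^'m::finite) \<Rightarrow> real^'n \<Rightarrow> real^'n^'m" where
  "weak_gradient u = (SOME G. has_weak_gradient u G)"

definition W12_loc :: "(real^'n::finite \<Rightarrow> real^'m::finite) \<Rightarrow> bool" where
  "W12_loc u \<longleftrightarrow> L2_loc u \<and> (\<exists>G. has_weak_gradient u G \<and> L2_loc G)"

text \<open>The system \<open>\<Delta>u - W\<^sub>u(u) = 0\<close> on the whole space in the sense of distributions, componentwise.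
  For \<open>u\<close> locally bounded and \<open>W\<close> continuously differentiable all integrands are integrable.\<close>

definition weak_solution ::
    "(real^'m::finite \<Rightarrow> real) \<Rightarrow> (real^'n::finite \<Rightarrow> real^'m) \<Rightarrow> bool" where
  "weak_solution W u \<longleftrightarrow> (\<forall>\<phi> i. test_function \<phi> \<longrightarrow>
     (LINT x|lebesgue. u x $ i * laplacian \<phi> x)
       - (LINT x|lebesgue. gradient W (u x) $ i * \<phi> x) = 0)"

text \<open>The norm of type \<open>real^'n^'m\<close> is the Euclidean (Frobenius) norm of the matrix.\<close>

definition energy ::
    "(real^'m::finite \<Rightarrow> real) \<Rightarrow> (real^'n::finite \<Rightarrow> real^'m) \<Rightarrow> (real^'n) set \<Rightarrow> real" where
  "energy W u B = (LINT x:B|lebesgue. 1/2 * (norm (weak_gradient u x))\<^sup>2 + W (u x))"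

end

(*
  Mollify u with the radial kernel rho_t = -2 Phi 1 t. The derivative of rho_t in t is a Laplacian,
  d/dt rho_t = Laplace (t Phi 0 t), and likewise for the first partial derivatives of rho_t. Tested
  against the equation Laplace u = f with f = W_u(u) locally bounded, this shows that rho_t * u and its
  gradient are Lipschitz in t, locally uniformly. Hence u and its weak gradient have continuous
  representatives, without any potential theory, the energy density e is continuous, and the energy
  E(R) of a ball is differentiable in the radius.
  Passing to the limit t -> 0 in the Pohozaev identity of the mollified functions, obtained from the
  vector field phi(|y|^2) y with y = x - x0, gives
    int phi ((n - 2) e + 2 W(u)) + 2 phi' (|y|^2 e - |y . grad u|^2) = 0.
  For phi decreasing from 1 to 0 between R^2 and r^2 with slope at most 1 / (r^2 - R^2), up to an
  arbitrarily small error, this yields (n - 2) E(R) (r^2 - R^2) <= 2 r^2 (E(r) - E(R)). Dividing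
  by r - R and letting r -> R gives (n - 2) E(R) <= R E'(R).
*)
theory Submission
  imports Defs
begin

section \<open>Smooth bump functions\<close>

text \<open>The solution has no classical second derivatives, so the divergence of the stress-energy
  tensor is computed for mollified fields only. They solve the system up to the error
  \<open>mol t f - W_u(mol t u)\<close>, which is paired with the radial derivative; locally bounded
  convergence to continuous limits is enough to make this pairing vanish. Continuity of the limits
  is also what makes the energy differentiable at every R instead of almost every R. The Lipschitz
  bounds are a count of scales. \<open>Phi k t\<close> has height of order t^-n on a ball of radius
  t, so its pairing with a bounded f is of order 1. For the values a factor t remains; for the
  gradient a factor 2/t appears, compensated by |z_j| <= t on the support. The inequality comes from
  discarding 2 phi W(u) and -2 phi' |y . grad u|^2, both nonnegative. On the shell between the two
  spheres (n - 2) phi e is discarded as well, which is why n >= 2 is required there. For n = 1 the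
  weight is R itself, and it suffices that the energy is nonnegative and nondecreasing in the
  radius.\<close>

lemma poly_exp_tendsto_0: "((\<lambda>x::real. poly p x * exp (- x)) \<longlongrightarrow> 0) at_top"
proof -
  have "((\<lambda>x::real. \<Sum>i\<le>degree p. coeff p i * (x ^ i / exp x)) \<longlongrightarrow> (\<Sum>i\<le>degree p. coeff p i * 0)) at_top"
    by (intro tendsto_sum tendsto_mult tendsto_const tendsto_power_div_exp_0)
  moreover have "(\<Sum>i\<le>degree p. coeff p i * (x ^ i / exp x)) = poly p x * exp (- x)" for x
    by (simp add: poly_altdef sum_distrib_right exp_minus divide_inverse mult.assoc)
  ultimately show ?thesis by simp
qed

text \<open>Polynomials in 1/t times exp (-1/t), glued to 0: a class closed under differentiation,
  so that smoothness at the gluing point follows by iterating one first-order computation.\<close>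

definition flat :: "real poly \<Rightarrow> real \<Rightarrow> real" where
  "flat p t = (if t \<le> 0 then 0 else poly p (1/t) * exp (- (1/t)))"

text \<open>With s = 1/t one has d/dt = -s^2 d/ds, which sends p(s) exp (-s) to s^2 (p - p')(s) exp
  (-s). At t = 0 the right difference quotient is s p(s) exp (-s), which tends to 0 as s
  grows.\<close>

lemma DERIV_flat: "(flat p has_real_derivative flat (monom 1 2 * (p - pderiv p)) t) (at t)"
proof -
  consider "t < 0" | "t = 0" | "t > 0" by linarith
  then show ?thesis
  proof cases
    case 1
    have "((\<lambda>_. 0) has_real_derivative 0) (at t)" by simp
    then have "(flat p has_real_derivative 0) (at t)"
      by (rule has_field_derivative_transform_within_open[where S="{..<0}"])
         (use 1 in \<open>auto simp: flat_def\<close>)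
    then show ?thesis using 1 by (simp add: flat_def)
  next
    case 3
    have "((\<lambda>t. poly p (1/t) * exp (- (1/t))) has_real_derivative
        poly (monom 1 2 * (p - pderiv p)) (1/t) * exp (- (1/t))) (at t)"
      using 3 by (auto intro!: derivative_eq_intros DERIV_chain2[OF poly_DERIV] simp: poly_monom field_simps power2_eq_square)
    then have "(flat p has_real_derivative poly (monom 1 2 * (p - pderiv p)) (1/t) * exp (- (1/t))) (at t)"
      by (rule has_field_derivative_transform_within_open[where S="{0<..}"])
         (use 3 in \<open>auto simp: flat_def\<close>)
    then show ?thesis using 3 by (simp add: flat_def)
  next
    case 2
    have "((\<lambda>h. flat p h / h) \<longlongrightarrow> 0) (at_right 0)"
    proof -
      have "((\<lambda>h. poly (pCons 0 p) (inverse h) * exp (- inverse h)) \<longlongrightarrow> 0) (at_right (0::real))"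
        by (rule filterlim_compose[OF poly_exp_tendsto_0 filterlim_inverse_at_top_right])
      then show ?thesis
        by (rule Lim_transform_eventually)
           (auto simp: eventually_at_right_field flat_def field_simps intro!: exI[of _ 1])
    qed
    moreover have "((\<lambda>h. flat p h / h) \<longlongrightarrow> 0) (at_left 0)"
      by (rule Lim_transform_eventually[OF tendsto_const])
         (auto simp: eventually_at_left_field flat_def intro!: exI[of _ "-1"])
    ultimately have "((\<lambda>h. flat p h / h) \<longlongrightarrow> 0) (at 0)"
      by (simp add: filterlim_split_at)
    then show ?thesis using 2 by (simp add: DERIV_def flat_def)
  qed
qed

primrec bump_poly :: "nat \<Rightarrow> real poly" where
  "bump_poly 0 = 1"
| "bump_poly (Suc k) = monom 1 2 * (bump_poly k - pderiv (bump_poly k))"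

text \<open>\<open>bump k\<close> is the \<open>k\<close>-th derivative of \<open>bump 0 s = exp (- 1 / (1 - s))\<close>, extended by \<open>0\<close> to \<open>s \<ge> 1\<close>.\<close>

definition bump :: "nat \<Rightarrow> real \<Rightarrow> real" where
  "bump k s = (- 1) ^ k * flat (bump_poly k) (1 - s)"

lemma DERIV_bump: "(bump k has_real_derivative bump (Suc k) s) (at s)"
proof -
  have "((\<lambda>s. (- 1) ^ k * flat (bump_poly k) (1 - s)) has_real_derivative
     (- 1) ^ k * (flat (bump_poly (Suc k)) (1 - s) * (- 1))) (at s)"
    unfolding bump_poly.simps
    by (intro DERIV_cmult DERIV_chain2[OF DERIV_flat]) (auto intro!: derivative_eq_intros)
  then show ?thesis by (simp add: bump_def[abs_def])
qed

lemma DERIV_bump_chain [derivative_intros]: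
  "(g has_real_derivative D) (at x within S) \<Longrightarrow>
   ((\<lambda>x. bump k (g x)) has_real_derivative bump (Suc k) (g x) * D) (at x within S)"
  by (rule DERIV_chain2[OF DERIV_bump])

lemma continuous_on_bump: "continuous_on S (bump k)"
  by (meson DERIV_bump DERIV_isCont continuous_at_imp_continuous_on)

lemma continuous_on_bump_compose [continuous_intros]:
  "continuous_on S g \<Longrightarrow> continuous_on S (\<lambda>x. bump k (g x))"
  using continuous_on_compose2[OF continuous_on_bump] by blast

lemma bump_eq_0: "s \<ge> 1 \<Longrightarrow> bump k s = 0"
  by (simp add: bump_def flat_def)

text \<open>\<open>bump 0\<close> decreases, and its negated derivative is what serves as a
  nonnegative mollifier profile.\<close>

lemma bump_1_nonpos: "bump 1 s \<le> 0"
  by (simp add: bump_def flat_def poly_monom)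

lemma bump_1_neg: "s < 1 \<Longrightarrow> bump 1 s < 0"
  by (simp add: bump_def flat_def poly_monom)

lemma bump_bounded: "\<exists>M. \<forall>s\<ge>0. \<bar>bump k s\<bar> \<le> M"
proof -
  have "compact (bump k ` {0..1})"
    by (intro compact_continuous_image continuous_on_bump) auto
  then have "bounded (bump k ` {0..1})" by (rule compact_imp_bounded)
  then obtain M where M: "\<forall>s\<in>{0..1}. \<bar>bump k s\<bar> \<le> M"
    by (auto simp: bounded_iff)
  have "\<bar>bump k s\<bar> \<le> \<bar>M\<bar>" if "s \<ge> 0" for s
    using M[rule_format, of s] that bump_eq_0[of s k] by (cases "s \<le> 1") auto
  then show ?thesis by blast
qed

section \<open>Classical partial derivatives and test functions\<close>

lemma has_partial:
  fixes f :: "real^'n::finite \<Rightarrow> real"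
  assumes "(f has_derivative f') (at x)"
  shows "partial j f x = f' (axis j 1)"
  using frechet_derivative_at[OF assms] by (simp add: partial_def)

lemma C_k_continuous: "C_k k f \<Longrightarrow> continuous_on UNIV f"
  by (cases k) (auto intro: differentiable_imp_continuous_on)

lemma C_k_SucI:
  assumes "\<And>x. (f has_derivative f' x) (at x)" "\<And>j. C_k k (\<lambda>x. f' x (axis j 1))"
  shows "C_k (Suc k) f"
proof -
  have "partial j f = (\<lambda>x. f' x (axis j 1))" for j
    using has_partial[OF assms(1)] by auto
  moreover have "f differentiable_on UNIV"
    using assms(1) by (auto simp: differentiable_on_def differentiable_def)
  ultimately show ?thesis using assms(2) by simp
qed

lemma C_k_const: "C_k k (\<lambda>x. c)"
proof (induction k arbitrary: c)
  case (Suc k)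
  show ?case by (rule C_k_SucI[where f'="\<lambda>x h. 0"]) (auto simp: Suc)
qed simp

lemma C_k_SucD: "C_k (Suc k) f \<Longrightarrow> C_k k f"
proof (induction k arbitrary: f)
  case 0
  then show ?case by (simp add: differentiable_imp_continuous_on)
next
  case (Suc k)
  then show ?case by (metis C_k.simps(2))
qed

lemma C_k_deriv: "C_k (Suc k) f \<Longrightarrow> (f has_derivative frechet_derivative f (at x)) (at x)"
  by (simp add: differentiable_on_def frechet_derivative_works)

lemma C_k_add: "C_k k f \<Longrightarrow> C_k k g \<Longrightarrow> C_k k (\<lambda>x. f x + g x)"
proof (induction k arbitrary: f g)
  case 0
  then show ?case by (auto intro: continuous_on_add)
next
  case (Suc k)
  show ?case
  proof (rule C_k_SucI)
    show "((\<lambda>x. f x + g x) has_derivative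
        (\<lambda>h. frechet_derivative f (at x) h + frechet_derivative g (at x) h)) (at x)" for x
      using Suc.prems C_k_deriv by (intro has_derivative_add) blast+
    show "C_k k (\<lambda>x. frechet_derivative f (at x) (axis j 1) + frechet_derivative g (at x) (axis j 1))" for j
      using Suc.IH[of "partial j f" "partial j g"] Suc.prems by (simp add: partial_def[abs_def])
  qed
qed

lemma C_k_mult: "C_k k f \<Longrightarrow> C_k k g \<Longrightarrow> C_k k (\<lambda>x. f x * g x)"
proof (induction k arbitrary: f g)
  case 0
  then show ?case by (auto intro: continuous_on_mult)
next
  case (Suc k)
  show ?case
  proof (rule C_k_SucI)
    show "((\<lambda>x. f x * g x) has_derivative
        (\<lambda>h. f x * frechet_derivative g (at x) h + frechet_derivative f (at x) h * g x)) (at x)" for x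
      using Suc.prems C_k_deriv by (intro has_derivative_mult) blast+
    show "C_k k (\<lambda>x. f x * frechet_derivative g (at x) (axis j 1) + frechet_derivative f (at x) (axis j 1) * g x)" for j
      using C_k_add[OF Suc.IH[of f "partial j g"] Suc.IH[of "partial j f" g]] Suc.prems C_k_SucD[of k f] C_k_SucD[of k g]
      by (simp add: partial_def[abs_def])
  qed
qed

lemma C_k_coord: "C_k k (\<lambda>y::real^'n::finite. (y - x) $ j)"
proof (cases k)
  case (Suc k')
  show ?thesis unfolding Suc
  proof (rule C_k_SucI)
    show "((\<lambda>y. (y - x) $ j) has_derivative (\<lambda>h. h $ j)) (at z)" for z
      by (auto intro!: derivative_eq_intros bounded_linear.has_derivative[OF bounded_linear_vec_nth])
  qed (rule C_k_const)
qed (auto intro!: continuous_intros)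

section \<open>Radial bumps and compactly supported test functions\<close>

lemma has_derivative_bump_radial:
  fixes x :: "real^'n::finite"
  shows "((\<lambda>y. bump k ((norm (y - x))\<^sup>2 * a)) has_derivative
     (\<lambda>h. bump (Suc k) ((norm (y - x))\<^sup>2 * a) * (2 * a * ((y - x) \<bullet> h)))) (at y)"
proof -
  have "((\<lambda>y. ((y - x) \<bullet> (y - x)) * a) has_derivative (\<lambda>h. 2 * a * ((y - x) \<bullet> h))) (at y)"
    by (auto intro!: derivative_eq_intros simp: inner_commute algebra_simps)
  then have "((\<lambda>y. (norm (y - x))\<^sup>2 * a) has_derivative (\<lambda>h. 2 * a * ((y - x) \<bullet> h))) (at y)"
    by (simp add: power2_norm_eq_inner)
  from has_derivative_compose[OF this DERIV_bump[unfolded has_field_derivative_def]]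
  show ?thesis .
qed

lemma partial_bump_radial:
  fixes x :: "real^'n::finite"
  shows "partial j (\<lambda>y. bump k ((norm (y - x))\<^sup>2 * a)) =
     (\<lambda>y. 2 * a * (y - x) $ j * bump (Suc k) ((norm (y - x))\<^sup>2 * a))"
  by (auto simp: has_partial[OF has_derivative_bump_radial] inner_axis)

text \<open>Each partial derivative trades \<open>bump k\<close> for \<open>bump (Suc k)\<close>
  times a coordinate, so the induction on the order of smoothness has to cover all indices
  \<open>k\<close> at once.\<close>

lemma C_k_bump_radial: "C_k m (\<lambda>y. bump k ((norm (y - x))\<^sup>2 * a))"
proof (induction m arbitrary: k)
  case 0
  then show ?case by (auto intro!: continuous_intros)
next
  case (Suc m)
  have "C_k m (\<lambda>y. (2 * a * (y - x) $ j) * bump (Suc k) ((norm (y - x))\<^sup>2 * a))" for j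
    by (intro C_k_mult C_k_const C_k_coord Suc)
  then show ?case
    using has_derivative_bump_radial[of k x a]
    by (simp add: partial_bump_radial differentiable_on_def differentiable_def) blast
qed

lemma test_functionI:
  assumes "\<And>k. C_k k f" "\<And>y. f y \<noteq> 0 \<Longrightarrow> y \<in> cball x r"
  shows "test_function f"
proof -
  have "closure {y. f y \<noteq> 0} \<subseteq> cball x r"
    using assms(2) by (intro closure_minimal) auto
  then have "compact (closure {y. f y \<noteq> 0})"
    by (metis closed_closure compact_cball compact_Int_closed inf.absorb_iff2)
  then show ?thesis using assms(1) by (simp add: test_function_def)
qed

section \<open>Integrals against compactly supported kernels\<close>

lemma continuous_measurable_lebesgue:
  fixes f :: "'a::euclidean_space \<Rightarrow> 'b::euclidean_space"
  shows "continuous_on UNIV f \<Longrightarrow> f \<in> borel_measurable lebesgue"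
  by (intro measurable_completion) (auto intro: borel_measurable_continuous_onI)

lemma lebesgue_integral_affine:
  fixes f :: "'a::euclidean_space \<Rightarrow> real"
  assumes "f \<in> borel_measurable lebesgue" "c \<noteq> 0"
  shows "(LINT x|lebesgue. f x) = \<bar>c\<bar> ^ DIM('a) * (LINT x|lebesgue. f (t + c *\<^sub>R x))"
proof -
  have T: "(\<lambda>x::'a. t + (\<Sum>j\<in>Basis. (c * (x \<bullet> j)) *\<^sub>R j)) = (\<lambda>x. t + c *\<^sub>R x)"
    by (auto simp: scaleR_scaleR[symmetric] scaleR_sum_right[symmetric] euclidean_representation
             simp del: scaleR_scaleR)
  have leb: "lebesgue = density (distr lebesgue lebesgue (\<lambda>x::'a. t + c *\<^sub>R x)) (\<lambda>_. ennreal (\<bar>c\<bar> ^ DIM('a)))"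
    using lebesgue_affine_euclidean[of "\<lambda>_. c" t] assms(2) unfolding T by simp
  have mT: "(\<lambda>x::'a. t + c *\<^sub>R x) \<in> lebesgue \<rightarrow>\<^sub>M lebesgue"
    using lebesgue_affine_measurable[of "\<lambda>_. c" t] assms(2) unfolding T by simp
  have "(LINT x|lebesgue. f x) = (LINT x|density (distr lebesgue lebesgue (\<lambda>x::'a. t + c *\<^sub>R x)) (\<lambda>_. ennreal (\<bar>c\<bar> ^ DIM('a))). f x)"
    using leb by simp
  also have "\<dots> = (LINT x|distr lebesgue lebesgue (\<lambda>x::'a. t + c *\<^sub>R x). \<bar>c\<bar> ^ DIM('a) *\<^sub>R f x)"
    using assms(1) by (intro integral_density) auto
  also have "\<dots> = (LINT x|lebesgue. \<bar>c\<bar> ^ DIM('a) *\<^sub>R f (t + c *\<^sub>R x))"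
    using assms(1) mT by (intro integral_distr) auto
  finally show ?thesis by simp
qed

lemma L1_loc_measurable: "L1_loc q \<Longrightarrow> q \<in> borel_measurable lebesgue"
  by (simp add: L1_loc_def)

lemma L1_loc_integrable_mult:
  fixes q k :: "'a::euclidean_space \<Rightarrow> real"
  assumes "L1_loc q" "k \<in> borel_measurable lebesgue" "compact K"
    and "\<And>y. \<bar>k y\<bar> \<le> M" "\<And>y. y \<notin> K \<Longrightarrow> k y = 0"
  shows "integrable lebesgue (\<lambda>y. q y * k y)"
proof (rule Bochner_Integration.integrable_bound)
  have "set_integrable lebesgue K q" using assms by (simp add: L1_loc_def)
  then show "integrable lebesgue (\<lambda>y. M * (indicator K y * q y))"
    by (auto simp: set_integrable_def)
  show "(\<lambda>y. q y * k y) \<in> borel_measurable lebesgue"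
    using assms(2) L1_loc_measurable[OF assms(1)] by (rule borel_measurable_times[rotated])
  have "\<bar>q y * k y\<bar> \<le> \<bar>M * (indicator K y * q y)\<bar>" for y
  proof (cases "y \<in> K")
    case True
    have "\<bar>k y\<bar> \<le> \<bar>M\<bar>" using assms(4)[of y] by linarith
    then show ?thesis using True by (simp add: abs_mult mult.commute mult_right_mono)
  qed (simp add: assms)
  then show "AE y in lebesgue. norm (q y * k y) \<le> norm (M * (indicator K y * q y))"
    by simp
qed

lemma continuous_compact_support_bounded:
  fixes k :: "'a::euclidean_space \<Rightarrow> real"
  assumes "continuous_on UNIV k" "compact K" "\<And>y. y \<notin> K \<Longrightarrow> k y = 0"
  obtains M where "M \<ge> 0" "\<And>y. \<bar>k y\<bar> \<le> M"
proof -
  have "bounded (k ` K)"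
    using assms(1,2) by (metis compact_continuous_image compact_imp_bounded continuous_on_subset subset_UNIV)
  then obtain M where M: "\<forall>y\<in>K. \<bar>k y\<bar> \<le> M"
    by (auto simp: bounded_iff)
  have "\<bar>k y\<bar> \<le> \<bar>M\<bar>" for y
    using M[rule_format, of y] assms(3)[of y] by (cases "y \<in> K") auto
  then show ?thesis using that[of "\<bar>M\<bar>"] by simp
qed

lemma integrable_continuous_compact_support:
  fixes q k :: "'a::euclidean_space \<Rightarrow> real"
  assumes "L1_loc q" "continuous_on UNIV k" "compact K" "\<And>y. y \<notin> K \<Longrightarrow> k y = 0"
  shows "integrable lebesgue (\<lambda>y. q y * k y)"
  using continuous_compact_support_bounded[OF assms(2-4)] assms
  by (metis L1_loc_integrable_mult continuous_measurable_lebesgue)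

lemma L1_loc_continuous:
  fixes q :: "'a::euclidean_space \<Rightarrow> 'b::euclidean_space"
  assumes "continuous_on UNIV q"
  shows "L1_loc q"
  unfolding L1_loc_def
proof (intro conjI allI impI)
  fix K :: "'a set" assume K: "compact K"
  then have "integrable lborel (\<lambda>x. indicator K x *\<^sub>R q x)"
    using assms by (intro borel_integrable_compact) (auto intro: continuous_on_subset)
  then show "set_integrable lebesgue K q"
    unfolding set_integrable_def by (subst integrable_completion) auto
qed (rule continuous_measurable_lebesgue[OF assms])

text \<open>All regularity in the parameter comes from the kernel, as \<open>q\<close> is only
  locally integrable. The mean value inequality bounds the difference quotients by a constant times
  the indicator of \<open>K\<close>, so |q| on \<open>K\<close> is, up to that constant, a
  dominating function.\<close>

lemma DERIV_integral_kernel: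
  fixes k k' :: "real \<Rightarrow> 'a::euclidean_space \<Rightarrow> real"
  assumes q: "L1_loc q" and K: "compact K" and \<theta>: "\<theta> \<in> {a<..<b}"
    and der: "\<And>t y. t \<in> {a..b} \<Longrightarrow> ((\<lambda>t. k t y) has_real_derivative k' t y) (at t)"
    and cont: "continuous_on ({a..b} \<times> UNIV) (\<lambda>(t, y). k t y)" 
              "continuous_on ({a..b} \<times> UNIV) (\<lambda>(t, y). k' t y)"
    and supp: "\<And>t y. t \<in> {a..b} \<Longrightarrow> y \<notin> K \<Longrightarrow> k t y = 0"
  shows "((\<lambda>t. LINT y|lebesgue. q y * k t y) has_real_derivative
          (LINT y|lebesgue. q y * k' \<theta> y)) (at \<theta>)"
proof -
  have kc: "continuous_on UNIV (k t)" and k'c: "continuous_on UNIV (k' t)" if "t \<in> {a..b}" for t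
    using continuous_on_compose2[OF cont(1), of UNIV "\<lambda>y. (t, y)"]
      continuous_on_compose2[OF cont(2), of UNIV "\<lambda>y. (t, y)"] that
    by (auto simp: image_subset_iff continuous_on_Pair continuous_on_const continuous_on_id)
  have "bounded ((\<lambda>(t, y). k' t y) ` ({a..b} \<times> K))"
    using K by (intro compact_imp_bounded compact_continuous_image continuous_on_subset[OF cont(2)] compact_Times) auto
  then obtain M0 where M0: "\<forall>t\<in>{a..b}. \<forall>y\<in>K. \<bar>k' t y\<bar> \<le> M0"
    unfolding bounded_iff by auto
  define M where "M = \<bar>M0\<bar>"
  \<comment> \<open>On \<open>K\<close> this is the mean value inequality; off \<open>K\<close> both
    kernel values are 0.\<close>
  have lip: "\<bar>k t y - k \<theta> y\<bar> \<le> (M * indicator K y) * \<bar>t - \<theta>\<bar>" if "t \<in> {a..b}" for t y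
  proof (cases "y \<in> K")
    case True
    have "norm (k t y - k \<theta> y) \<le> M * norm (t - \<theta>)"
    proof (rule field_differentiable_bound[where S="{a..b}" and f'="\<lambda>t. k' t y"])
      show "((\<lambda>t. k t y) has_real_derivative k' z y) (at z within {a..b})" if "z \<in> {a..b}" for z
        using der[OF that] by (rule has_field_derivative_at_within)
      show "norm (k' z y) \<le> M" if "z \<in> {a..b}" for z
        using M0[rule_format, OF that True] by (simp add: M_def)
    qed (use that \<theta> in auto)
    then show ?thesis using True by simp
  next
    case False
    then show ?thesis using supp[of t y] supp[of \<theta> y] that \<theta> by simp
  qed
  have int: "integrable lebesgue (\<lambda>y. q y * k t y)" if "t \<in> {a..b}" for t
    using integrable_continuous_compact_support[OF q kc[OF that] K] supp[OF that] by blast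
  define d where "d = min (\<theta> - a) (b - \<theta>)"
  have d: "d > 0" "\<And>h. \<bar>h\<bar> < d \<Longrightarrow> \<theta> + h \<in> {a..b}" using \<theta> by (auto simp: d_def)
  show ?thesis
    unfolding DERIV_def tendsto_at_iff_sequentially
  proof (intro allI impI)
    fix X :: "nat \<Rightarrow> real"
    assume X: "\<forall>i. X i \<in> UNIV - {0}" "X \<longlonglongrightarrow> 0"
    obtain N where N: "\<And>i. i \<ge> N \<Longrightarrow> \<bar>X i\<bar> < d"
      using LIMSEQ_D[OF X(2) d(1)] by auto
    \<comment> \<open>Finitely many terms are dropped so that the shifted parameters stay in the
      interval on which the kernel is controlled.\<close>
    define Y where "Y i = X (i + N)" for i
    have Y: "Y i \<noteq> 0" "\<theta> + Y i \<in> {a..b}" for i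
      using X N d by (auto simp: Y_def)
    have Y0: "Y \<longlonglongrightarrow> 0" using X(2) unfolding Y_def by (rule LIMSEQ_ignore_initial_segment)
    have "(\<lambda>i. LINT y|lebesgue. q y * ((k (\<theta> + Y i) y - k \<theta> y) / Y i)) \<longlonglongrightarrow> (LINT y|lebesgue. q y * k' \<theta> y)"
    proof (rule integral_dominated_convergence)
      show "(\<lambda>y. q y * k' \<theta> y) \<in> borel_measurable lebesgue"
        using \<theta> by (intro borel_measurable_times L1_loc_measurable[OF q] continuous_measurable_lebesgue k'c) auto
      show "(\<lambda>y. q y * ((k (\<theta> + Y i) y - k \<theta> y) / Y i)) \<in> borel_measurable lebesgue" for i
        using \<theta> Y by (intro borel_measurable_times L1_loc_measurable[OF q] continuous_measurable_lebesgue
            continuous_on_divide continuous_on_diff kc continuous_on_const) auto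
      have "set_integrable lebesgue K q" using q K by (simp add: L1_loc_def)
      then show "integrable lebesgue (\<lambda>y. M * \<bar>indicator K y * q y\<bar>)"
        by (auto simp: set_integrable_def)
      show "AE y in lebesgue. norm (q y * ((k (\<theta> + Y i) y - k \<theta> y) / Y i)) \<le> M * \<bar>indicator K y * q y\<bar>" for i
      proof (rule AE_I2)
        fix y
        have "\<bar>(k (\<theta> + Y i) y - k \<theta> y) / Y i\<bar> \<le> M * indicator K y"
          using lip[OF Y(2), of i y] Y(1)[of i] by (simp add: divide_le_eq)
        then have "\<bar>q y\<bar> * \<bar>(k (\<theta> + Y i) y - k \<theta> y) / Y i\<bar> \<le> \<bar>q y\<bar> * (M * indicator K y)"
          by (intro mult_left_mono) auto
        then show "norm (q y * ((k (\<theta> + Y i) y - k \<theta> y) / Y i)) \<le> M * \<bar>indicator K y * q y\<bar>"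
          by (simp add: abs_mult mult_ac)
      qed
      show "AE y in lebesgue. (\<lambda>i. q y * ((k (\<theta> + Y i) y - k \<theta> y) / Y i)) \<longlonglongrightarrow> q y * k' \<theta> y"
      proof (rule AE_I2)
        fix y
        have "((\<lambda>h. (k (\<theta> + h) y - k \<theta> y) / h) \<longlongrightarrow> k' \<theta> y) (at 0)"
          using der[of \<theta> y] \<theta> by (simp add: DERIV_def)
        then have "(\<lambda>i. (k (\<theta> + Y i) y - k \<theta> y) / Y i) \<longlonglongrightarrow> k' \<theta> y"
          using Y Y0 unfolding tendsto_at_iff_sequentially by (auto simp: o_def)
        then show "(\<lambda>i. q y * ((k (\<theta> + Y i) y - k \<theta> y) / Y i)) \<longlonglongrightarrow> q y * k' \<theta> y"
          by (rule tendsto_mult_left)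
      qed
    qed
    moreover have "(LINT y|lebesgue. q y * ((k (\<theta> + Y i) y - k \<theta> y) / Y i)) =
        ((LINT y|lebesgue. q y * k (\<theta> + Y i) y) - (LINT y|lebesgue. q y * k \<theta> y)) / Y i" for i
    proof -
      have "(LINT y|lebesgue. q y * ((k (\<theta> + Y i) y - k \<theta> y) / Y i)) = (LINT y|lebesgue. (q y * k (\<theta> + Y i) y - q y * k \<theta> y) / Y i)"
        by (simp add: right_diff_distrib)
      also have "\<dots> = (LINT y|lebesgue. q y * k (\<theta> + Y i) y - q y * k \<theta> y) / Y i"
        by simp
      finally show ?thesis using int Y \<theta> by (simp add: Bochner_Integration.integral_diff)
    qed
    ultimately have "(\<lambda>i. ((LINT y|lebesgue. q y * k (\<theta> + Y i) y) - (LINT y|lebesgue. q y * k \<theta> y)) / Y i)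
       \<longlonglongrightarrow> (LINT y|lebesgue. q y * k' \<theta> y)"
      by (simp only:)
    then show "((\<lambda>h. ((LINT y|lebesgue. q y * k (\<theta> + h) y) - (LINT y|lebesgue. q y * k \<theta> y)) / h) \<circ> X)
       \<longlonglongrightarrow> (LINT y|lebesgue. q y * k' \<theta> y)"
      by - (rule LIMSEQ_offset[where k=N], simp only: o_def Y_def)
  qed
qed

text \<open>The integral of \<open>F\<close> is invariant under translation along \<open>e\<close>.
  Differentiating this constant function of the shift under the integral sign gives the
  claim.\<close>

lemma integral_partial_eq_0:
  fixes F F' :: "'a::euclidean_space \<Rightarrow> real"
  assumes der: "\<And>x. ((\<lambda>t. F (x + t *\<^sub>R e)) has_real_derivative F' x) (at 0)"
    and cont: "continuous_on UNIV F" "continuous_on UNIV F'"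
    and supp: "\<And>x. norm (x - x0) \<ge> r \<Longrightarrow> F x = 0"
  shows "(LINT x|lebesgue. F' x) = 0"
proof -
  \<comment> \<open>The hypothesis at base point x + t e, transported from parameter 0 to t.\<close>
  have der': "((\<lambda>t. F (x + t *\<^sub>R e)) has_real_derivative F' (x + t *\<^sub>R e)) (at t)" for x t
    using der[of "x + t *\<^sub>R e"] DERIV_shift[of "\<lambda>s. F (x + s *\<^sub>R e)" "F' (x + t *\<^sub>R e)" 0 t]
    by (simp add: algebra_simps scaleR_add_left)
  have "((\<lambda>t. LINT y|lebesgue. 1 * F (y + t *\<^sub>R e)) has_real_derivative
          (LINT y|lebesgue. 1 * F' (y + 0 *\<^sub>R e))) (at 0)"
  proof (rule DERIV_integral_kernel[where a="-1" and b=1 and K="cball x0 (r + norm e)"])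
    show "L1_loc (\<lambda>y::'a. 1::real)" by (intro L1_loc_continuous continuous_intros)
    show "continuous_on ({-1..1} \<times> UNIV) (\<lambda>(t, y). F (y + t *\<^sub>R e))"
      by (auto simp: split_beta intro!: continuous_intros continuous_on_compose2[OF cont(1)])
    show "continuous_on ({-1..1} \<times> UNIV) (\<lambda>(t, y). F' (y + t *\<^sub>R e))"
      by (auto simp: split_beta intro!: continuous_intros continuous_on_compose2[OF cont(2)])
    show "F (y + t *\<^sub>R e) = 0" if "t \<in> {-1..1}" "y \<notin> cball x0 (r + norm e)" for t y
    proof (rule supp)
      have "norm (t *\<^sub>R e) \<le> norm e" using that by (auto intro!: mult_left_le_one_le)
      moreover have "norm (y - x0) \<le> norm (y + t *\<^sub>R e - x0) + norm (t *\<^sub>R e)"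
        using norm_triangle_ineq4[of "y + t *\<^sub>R e - x0" "t *\<^sub>R e"] by (simp add: algebra_simps)
      moreover have "norm (y - x0) > r + norm e" using that by (simp add: dist_norm norm_minus_commute)
      ultimately show "norm (y + t *\<^sub>R e - x0) \<ge> r" by linarith
    qed
  qed (use der' in auto)
  moreover have "(LINT y|lebesgue. 1 * F (y + t *\<^sub>R e)) = (LINT y|lebesgue. F y)" for t
    using lebesgue_integral_affine[of F 1 "t *\<^sub>R e"] continuous_measurable_lebesgue[OF cont(1)]
    by (simp add: add.commute)
  ultimately have "((\<lambda>t::real. LINT y|lebesgue. F y) has_real_derivative (LINT y|lebesgue. F' y)) (at 0)"
    by simp
  then show ?thesis by (metis DERIV_const DERIV_unique)
qed

text \<open>A correlation instead of a convolution: for fixed x the translate of the kernel is a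
  function of y that can be inserted directly as a test function. The price is a minus sign in each
  derivative with respect to x.\<close>

definition corr :: "('a::euclidean_space \<Rightarrow> real) \<Rightarrow> ('a \<Rightarrow> real) \<Rightarrow> 'a \<Rightarrow> real" where
  "corr q \<kappa> x = (LINT y|lebesgue. q y * \<kappa> (y - x))"

lemma integrable_corr:
  fixes q \<kappa> :: "'a::euclidean_space \<Rightarrow> real"
  assumes "L1_loc q" "continuous_on UNIV \<kappa>" "\<And>z. norm z \<ge> r \<Longrightarrow> \<kappa> z = 0"
  shows "integrable lebesgue (\<lambda>y. q y * \<kappa> (y - x))"
  by (rule integrable_continuous_compact_support[OF assms(1), of _ "cball x r"])
     (auto intro!: continuous_intros continuous_on_compose2[OF assms(2)] assms(3) simp: dist_norm norm_minus_commute)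

text \<open>For kernels of height of order r^-n the volume factor r^n cancels the height, which
  leaves a bound independent of the scale r.\<close>

lemma corr_bound:
  fixes q \<kappa> :: "'a::euclidean_space \<Rightarrow> real"
  assumes "L1_loc q" "continuous_on UNIV \<kappa>" "\<And>z. norm z \<ge> r \<Longrightarrow> \<kappa> z = 0" "r \<ge> 0"
    and C: "\<And>z. \<bar>\<kappa> z\<bar> \<le> C" and M: "AE y in lebesgue. y \<in> cball x r \<longrightarrow> \<bar>q y\<bar> \<le> M"
  shows "\<bar>corr q \<kappa> x\<bar> \<le> M * C * (unit_ball_vol DIM('a) * r ^ DIM('a))"
proof -
  have "C \<ge> 0" using C[of 0] by linarith
  have "\<bar>corr q \<kappa> x\<bar> \<le> (LINT y|lebesgue. \<bar>q y * \<kappa> (y - x)\<bar>)"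
    unfolding corr_def by (rule integral_abs_bound)
  also have "\<dots> \<le> (LINT y|lebesgue. (M * C) * indicator (cball x r) y)"
  proof (rule integral_mono_AE)
    show "integrable lebesgue (\<lambda>y. \<bar>q y * \<kappa> (y - x)\<bar>)"
      using integrable_corr[OF assms(1-3)] by auto
    show "integrable lebesgue (\<lambda>y. (M * C) * indicator (cball x r) y :: real)"
      by (intro integrable_mult_right integrable_real_indicator)
         (auto simp: emeasure_cball assms)
    show "AE y in lebesgue. \<bar>q y * \<kappa> (y - x)\<bar> \<le> M * C * indicator (cball x r) y"
      using M
    proof eventually_elim
      case (elim y)
      show ?case
      proof (cases "y \<in> cball x r")
        case True
        have "\<bar>q y\<bar> * \<bar>\<kappa> (y - x)\<bar> \<le> M * C"
          using elim True C[of "y - x"] \<open>C \<ge> 0\<close> by (intro mult_mono) auto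
        then show ?thesis using True by (simp add: abs_mult)
      next
        case False
        then show ?thesis by (simp add: assms(3) dist_norm norm_minus_commute)
      qed
    qed
  qed
  also have "\<dots> = M * C * (unit_ball_vol DIM('a) * r ^ DIM('a))"
    using assms(4) by (simp add: content_cball)
  finally show ?thesis .
qed

lemma DERIV_corr:
  fixes q \<kappa> \<kappa>' :: "'a::euclidean_space \<Rightarrow> real"
  assumes q: "L1_loc q"
    and der: "\<And>x. ((\<lambda>t. \<kappa> (x + t *\<^sub>R e)) has_real_derivative \<kappa>' x) (at 0)"
    and cont: "continuous_on UNIV \<kappa>" "continuous_on UNIV \<kappa>'"
    and supp: "\<And>z. norm z \<ge> r \<Longrightarrow> \<kappa> z = 0"
  shows "((\<lambda>t. corr q \<kappa> (x + t *\<^sub>R e)) has_real_derivative corr q (\<lambda>z. - \<kappa>' z) x) (at 0)"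
proof -
  \<comment> \<open>The derivative of the kernel at y - (x + t e) is composed with the reflection of
    the parameter, which produces the minus sign.\<close>
  have der': "((\<lambda>t. \<kappa> (y - (x + t *\<^sub>R e))) has_real_derivative - \<kappa>' (y - (x + t *\<^sub>R e))) (at t)" for y t
  proof -
    have "((\<lambda>s. \<kappa> (y - (x + t *\<^sub>R e) + s *\<^sub>R e)) has_real_derivative \<kappa>' (y - (x + t *\<^sub>R e))) (at (t - t))"
      using der by simp
    then have "((\<lambda>s. \<kappa> (y - (x + t *\<^sub>R e) + (t - s) *\<^sub>R e)) has_real_derivative \<kappa>' (y - (x + t *\<^sub>R e)) * (- 1)) (at t)"
      by (rule DERIV_chain2) (auto intro!: derivative_eq_intros)
    then show ?thesis by (simp add: algebra_simps scaleR_diff_left)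
  qed
  have "((\<lambda>t. LINT y|lebesgue. q y * \<kappa> (y - (x + t *\<^sub>R e))) has_real_derivative
          (LINT y|lebesgue. q y * - \<kappa>' (y - (x + 0 *\<^sub>R e)))) (at 0)"
  proof (rule DERIV_integral_kernel[where a="-1" and b=1 and K="cball x (r + norm e)", OF q])
    show "continuous_on ({-1..1} \<times> UNIV) (\<lambda>(t, y). \<kappa> (y - (x + t *\<^sub>R e)))"
      by (auto simp: split_beta intro!: continuous_intros continuous_on_compose2[OF cont(1)])
    show "continuous_on ({-1..1} \<times> UNIV) (\<lambda>(t, y). - \<kappa>' (y - (x + t *\<^sub>R e)))"
      by (auto simp: split_beta intro!: continuous_intros continuous_on_compose2[OF cont(2)])
    show "\<kappa> (y - (x + t *\<^sub>R e)) = 0" if "t \<in> {-1..1}" "y \<notin> cball x (r + norm e)" for t y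
    proof (rule supp)
      have "norm (t *\<^sub>R e) \<le> norm e" using that by (auto intro!: mult_left_le_one_le)
      moreover have "norm (y - x) \<le> norm (y - (x + t *\<^sub>R e)) + norm (t *\<^sub>R e)"
        using norm_triangle_ineq[of "y - (x + t *\<^sub>R e)" "t *\<^sub>R e"] by (simp add: algebra_simps)
      moreover have "norm (y - x) > r + norm e" using that by (simp add: dist_norm norm_minus_commute)
      ultimately show "norm (y - (x + t *\<^sub>R e)) \<ge> r" by linarith
    qed
  qed (use der' in auto)
  then show ?thesis by (simp add: corr_def)
qed

text \<open>The points of a convergent sequence are bounded, so all translated kernels live in one
  ball, and a multiple of |q| on that ball dominates.\<close>

lemma continuous_on_corr:
  fixes q \<kappa> :: "'a::euclidean_space \<Rightarrow> real"
  assumes q: "L1_loc q" and cont: "continuous_on UNIV \<kappa>" and supp: "\<And>z. norm z \<ge> r \<Longrightarrow> \<kappa> z = 0"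
  shows "continuous_on UNIV (corr q \<kappa>)"
  unfolding continuous_on_sequentially
proof (intro ballI allI impI)
  fix X x assume "(\<forall>n. X n \<in> (UNIV::'a set)) \<and> X \<longlonglongrightarrow> x"
  then have X: "X \<longlonglongrightarrow> x" by simp
  have "bounded (range X)" using X by (rule convergent_imp_bounded)
  then obtain B where B: "\<And>n. norm (X n) \<le> B" by (auto simp: bounded_iff)
  obtain M where M: "M \<ge> 0" "\<And>z. \<bar>\<kappa> z\<bar> \<le> M"
    by (rule continuous_compact_support_bounded[OF cont, of "cball 0 r"]) (use supp in auto)
  let ?K = "cball (0::'a) (B + r)"
  have "(\<lambda>n. LINT y|lebesgue. q y * \<kappa> (y - X n)) \<longlonglongrightarrow> (LINT y|lebesgue. q y * \<kappa> (y - x))"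
  proof (rule integral_dominated_convergence)
    have meas: "(\<lambda>y. q y * \<kappa> (y - a)) \<in> borel_measurable lebesgue" for a
      by (intro borel_measurable_integrable integrable_corr[OF q cont supp])
    show "(\<lambda>y. q y * \<kappa> (y - x)) \<in> borel_measurable lebesgue"
       "(\<lambda>y. q y * \<kappa> (y - X n)) \<in> borel_measurable lebesgue" for n
      by (rule meas)+
    have "set_integrable lebesgue ?K q" using q by (simp add: L1_loc_def)
    then show "integrable lebesgue (\<lambda>y. M * \<bar>indicator ?K y * q y\<bar>)"
      by (auto simp: set_integrable_def)
    have "\<bar>\<kappa> (y - X n)\<bar> \<le> M * indicator ?K y" for y n
    proof (cases "y \<in> ?K")
      case False
      then have "norm (y - X n) \<ge> r" using B[of n] norm_triangle_ineq2[of y "X n"] by auto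
      then show ?thesis using supp M by simp
    qed (use M in simp)
    then have "\<bar>q y\<bar> * \<bar>\<kappa> (y - X n)\<bar> \<le> \<bar>q y\<bar> * (M * indicator ?K y)" for y n
      by (intro mult_left_mono) auto
    then show "AE y in lebesgue. norm (q y * \<kappa> (y - X n)) \<le> M * \<bar>indicator ?K y * q y\<bar>" for n
      by (simp add: abs_mult mult_ac)
    have "(\<lambda>n. \<kappa> (y - X n)) \<longlonglongrightarrow> \<kappa> (y - x)" for y
      by (rule continuous_on_tendsto_compose[OF cont]) (auto intro!: tendsto_intros X)
    then show "AE y in lebesgue. (\<lambda>n. q y * \<kappa> (y - X n)) \<longlonglongrightarrow> q y * \<kappa> (y - x)"
      by (intro AE_I2 tendsto_mult_left)
  qed
  then show "(corr q \<kappa> \<circ> X) \<longlonglongrightarrow> corr q \<kappa> x" by (simp add: corr_def o_def)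
qed

section \<open>A radial mollifier\<close>

text \<open>The normalisation makes \<open>- 2 * Phi 1 \<epsilon>\<close> a mollifier of mass \<open>1\<close>. It is the choice of this
  mollifier as a derivative of \<open>Phi 0\<close> in \<open>|z|\<^sup>2\<close> that turns its \<open>\<epsilon>\<close>-derivative into the Laplacian
  of \<open>\<epsilon> * Phi 0 \<epsilon>\<close>.\<close>

definition bump_mass :: "'n::finite itself \<Rightarrow> real" where
  "bump_mass _ = (LINT w::real^'n|lebesgue. - 2 * bump 1 ((norm w)\<^sup>2))"

definition Phi :: "nat \<Rightarrow> real \<Rightarrow> real^'n::finite \<Rightarrow> real" where
  "Phi k \<epsilon> z = bump k ((norm z)\<^sup>2 / \<epsilon>\<^sup>2) /
     (\<epsilon> ^ CARD('n) * bump_mass TYPE('n))"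

text \<open>The integrand is nonnegative, and positive on the open unit ball, which has positive
  volume. Positivity allows the division in \<open>Phi\<close> and preserves signs there.\<close>

lemma bump_mass_pos: "bump_mass TYPE('n::finite) > 0"
proof -
  let ?f = "\<lambda>w::real^'n. - 2 * bump 1 ((norm w)\<^sup>2)"
  have cont: "continuous_on UNIV ?f" by (intro continuous_intros)
  have int: "integrable lebesgue ?f"
    using integrable_continuous_compact_support[OF L1_loc_continuous[OF continuous_on_const[of _ 1]] cont, of "cball 0 1"]
    by (simp add: bump_eq_0 one_le_power)
  have nn: "?f w \<ge> 0" for w using bump_1_nonpos by simp
  have "bump_mass TYPE('n) \<noteq> 0"
    unfolding bump_mass_def
  proof
    assume "(LINT w|lebesgue. ?f w) = 0"
    then have "AE w in lebesgue. ?f w = 0"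
      using integral_nonneg_eq_0_iff_AE[OF int] nn by simp
    then have "AE w in lebesgue. w \<notin> ball (0::real^'n) 1"
    proof eventually_elim
      case (elim w)
      have "norm w ^ 2 < 1" if "norm w < 1"
        using that power_strict_mono[of "norm w" 1 2] by simp
      then show ?case using elim bump_1_neg[of "norm w ^ 2"] by force
    qed
    then have "emeasure lebesgue (ball (0::real^'n) 1) = 0"
      by (subst (asm) AE_iff_measurable[of "ball 0 1"]) auto
    then show False using unit_ball_vol_pos[of "real CARD('n)"] by (simp add: emeasure_ball)
  qed
  moreover have "bump_mass TYPE('n) \<ge> 0"
    unfolding bump_mass_def using nn by (intro Bochner_Integration.integral_nonneg)
  ultimately show ?thesis by linarith
qed

lemma Phi_eq_0:
  assumes "\<epsilon> > 0" "norm z \<ge> \<epsilon>"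
  shows "Phi k \<epsilon> z = 0"
proof -
  have "\<epsilon>\<^sup>2 \<le> (norm z)\<^sup>2" using assms by (intro power_mono) auto
  then have "(norm z)\<^sup>2 / \<epsilon>\<^sup>2 \<ge> 1" using assms by (simp add: field_simps)
  then show ?thesis by (simp add: Phi_def bump_eq_0)
qed

lemma Phi_bounded:
  "\<exists>C\<ge>0. \<forall>\<epsilon>>0. \<forall>z::real^'n::finite. \<bar>Phi k \<epsilon> z\<bar> \<le> C / \<epsilon> ^ CARD('n)"
proof -
  let ?J = "bump_mass TYPE('n)"
  obtain M where M: "\<And>s. s \<ge> 0 \<Longrightarrow> \<bar>bump k s\<bar> \<le> M" using bump_bounded by blast
  have "M \<ge> 0" using M[of 0] by linarith
  have "\<bar>Phi k \<epsilon> z\<bar> \<le> M / ?J / \<epsilon> ^ CARD('n)" if "\<epsilon> > 0" for \<epsilon> and z :: "real^'n"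
  proof -
    have "\<bar>Phi k \<epsilon> z\<bar> = \<bar>bump k ((norm z)\<^sup>2 / \<epsilon>\<^sup>2)\<bar> / (\<epsilon> ^ CARD('n) * ?J)"
      using that bump_mass_pos[where 'n='n] by (simp add: Phi_def abs_mult)
    also have "\<dots> \<le> M / (\<epsilon> ^ CARD('n) * ?J)"
      using that bump_mass_pos[where 'n='n] by (intro divide_right_mono M) auto
    finally show ?thesis by (simp add: mult.commute)
  qed
  moreover have "M / ?J \<ge> 0" using \<open>M \<ge> 0\<close> bump_mass_pos[where 'n='n] by (intro divide_nonneg_pos)
  ultimately show ?thesis by blast
qed

lemma has_derivative_Phi [derivative_intros]:
  fixes x :: "real^'n::finite"
  shows "((\<lambda>y. Phi k \<epsilon> (y - x)) has_derivative
     (\<lambda>h. 2 / \<epsilon>\<^sup>2 * ((y - x) \<bullet> h) * Phi (Suc k) \<epsilon> (y - x))) (at y)"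
proof -
  let ?c = "\<epsilon> ^ CARD('n) * bump_mass TYPE('n)"
  have "((\<lambda>y. 1 / ?c * bump k ((norm (y - x))\<^sup>2 * (1 / \<epsilon>\<^sup>2))) has_derivative
     (\<lambda>h. 1 / ?c * (bump (Suc k) ((norm (y - x))\<^sup>2 * (1 / \<epsilon>\<^sup>2)) * (2 * (1 / \<epsilon>\<^sup>2) * ((y - x) \<bullet> h))))) (at y)"
    by (rule has_derivative_mult_right[OF has_derivative_bump_radial])
  then show ?thesis unfolding Phi_def by (simp add: mult_ac)
qed

lemma C_k_Phi: "C_k m (\<lambda>y::real^'n::finite. Phi k \<epsilon> (y - x))"
proof -
  let ?c = "\<epsilon> ^ CARD('n) * bump_mass TYPE('n)"
  have "C_k m (\<lambda>y::real^'n. 1 / ?c * bump k ((norm (y - x))\<^sup>2 * (1 / \<epsilon>\<^sup>2)))"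
    by (intro C_k_mult C_k_const C_k_bump_radial)
  then show ?thesis unfolding Phi_def by simp
qed

lemma continuous_Phi: "continuous_on UNIV (Phi k \<epsilon> :: real^'n::finite \<Rightarrow> real)"
  using C_k_continuous[OF C_k_Phi[of 0 k \<epsilon> 0]] by simp

lemma continuous_on_Phi_compose [continuous_intros]:
  "continuous_on S g \<Longrightarrow> continuous_on S (\<lambda>x. Phi k \<epsilon> (g x :: real^'n::finite))"
  using continuous_on_compose2[OF continuous_Phi] by blast

lemma continuous_Phi_joint:
  assumes "a > 0"
  shows "continuous_on ({a..b} \<times> UNIV) (\<lambda>(\<epsilon>, y). Phi k \<epsilon> (y - x :: real^'n::finite))"
  unfolding Phi_def split_beta using assms bump_mass_pos[where 'n='n]
  by (intro continuous_intros) auto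

lemma test_function_Phi: "\<epsilon> > 0 \<Longrightarrow> test_function (\<lambda>y::real^'n::finite. c * Phi k \<epsilon> (y - x))"
  by (rule test_functionI[where x=x and r=\<epsilon>])
     (auto intro: C_k_mult C_k_const C_k_Phi, metis Phi_eq_0 dist_norm norm_minus_commute nle_le)

lemma test_function_coord_Phi:
  "\<epsilon> > 0 \<Longrightarrow> test_function (\<lambda>y::real^'n::finite. (y - x) $ j * Phi k \<epsilon> (y - x))"
  by (rule test_functionI[where x=x and r=\<epsilon>])
     (intro C_k_mult C_k_coord C_k_Phi, metis Phi_eq_0 dist_norm mem_cball mult_eq_0_iff norm_minus_commute nle_le)

lemma partial_Phi:
  "partial j (\<lambda>y::real^'n::finite. Phi k \<epsilon> (y - x)) = (\<lambda>y. 2 / \<epsilon>\<^sup>2 * (y - x) $ j * Phi (Suc k) \<epsilon> (y - x))"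
  by (rule ext, subst has_partial[OF has_derivative_Phi]) (simp add: inner_axis)

lemma has_derivative_coord [derivative_intros]:
  "((\<lambda>y::real^'n::finite. (y - x) $ j) has_derivative (\<lambda>h. h $ j)) F"
  by (auto intro!: derivative_eq_intros bounded_linear.has_derivative[OF bounded_linear_vec_nth])

lemma has_derivative_coord_Phi:
  fixes x :: "real^'n::finite"
  shows "((\<lambda>y. (y - x) $ j * Phi k \<epsilon> (y - x)) has_derivative
     (\<lambda>h. (y - x) $ j * (2 / \<epsilon>\<^sup>2 * ((y - x) \<bullet> h) * Phi (Suc k) \<epsilon> (y - x)) + h $ j * Phi k \<epsilon> (y - x))) (at y)"
  by (intro has_derivative_mult has_derivative_coord has_derivative_Phi)

lemma partial_coord_Phi:
  "partial i (\<lambda>y::real^'n::finite. (y - x) $ j * Phi k \<epsilon> (y - x)) =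
   (\<lambda>y. 2 / \<epsilon>\<^sup>2 * (y - x) $ i * (y - x) $ j * Phi (Suc k) \<epsilon> (y - x) + (if i = j then 1 else 0) * Phi k \<epsilon> (y - x))"
  by (rule ext, subst has_partial[OF has_derivative_coord_Phi])
     (simp add: inner_axis del: vector_minus_component, simp add: axis_def)

lemma partial_cmult:
  assumes "f differentiable at y"
  shows "partial j (\<lambda>y. c * f y) y = c * partial j f y"
proof -
  have "(f has_derivative frechet_derivative f (at y)) (at y)"
    using assms frechet_derivative_works by blast
  from has_partial[OF has_derivative_mult_right[OF this]] show ?thesis by (simp add: partial_def)
qed

lemma norm_sq_sum: "(norm (z::real^'n::finite))\<^sup>2 = (\<Sum>j\<in>UNIV. (z $ j)\<^sup>2)"
  unfolding power2_norm_eq_inner inner_vec_def by (simp add: power2_eq_square)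

lemma laplacian_Phi:
  fixes x :: "real^'n::finite"
  shows "laplacian (\<lambda>y. Phi k \<epsilon> (y - x)) y =
     2 * real CARD('n) / \<epsilon>\<^sup>2 * Phi (Suc k) \<epsilon> (y - x) + 4 / \<epsilon>^4 * (norm (y - x))\<^sup>2 * Phi (Suc (Suc k)) \<epsilon> (y - x)"
proof -
  have "partial j (partial j (\<lambda>y. Phi k \<epsilon> (y - x))) y =
      2 / \<epsilon>\<^sup>2 * Phi (Suc k) \<epsilon> (y - x) + 4 / \<epsilon>^4 * (((y - x) $ j)\<^sup>2) * Phi (Suc (Suc k)) \<epsilon> (y - x)" for j
  proof -
    have "partial j (partial j (\<lambda>y. Phi k \<epsilon> (y - x))) y = partial j (\<lambda>y. 2 / \<epsilon>\<^sup>2 * ((y - x) $ j * Phi (Suc k) \<epsilon> (y - x))) y"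
      by (simp add: partial_Phi mult.assoc del: vector_minus_component)
    also have "\<dots> = 2 / \<epsilon>\<^sup>2 * partial j (\<lambda>y. (y - x) $ j * Phi (Suc k) \<epsilon> (y - x)) y"
      by (intro partial_cmult differentiableI[OF has_derivative_coord_Phi])
    also have "\<dots> = 2 / \<epsilon>\<^sup>2 * Phi (Suc k) \<epsilon> (y - x) + 4 / \<epsilon>^4 * (((y - x) $ j)\<^sup>2) * Phi (Suc (Suc k)) \<epsilon> (y - x)"
      unfolding partial_coord_Phi
      by (simp add: algebra_simps power2_eq_square power4_eq_xxxx del: vector_minus_component)
    finally show ?thesis .
  qed
  then show ?thesis
    by (simp add: laplacian_def norm_sq_sum sum.distrib sum_distrib_left sum_distrib_right del: vector_minus_component)
qed

text \<open>A coordinate is harmonic, so the Laplacian of the product is the coordinate times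
  \<open>laplacian_Phi\<close>, plus twice the i-th partial derivative of \<open>Phi k\<close>. That
  cross term accounts for the summand 4 in the first coefficient.\<close>

lemma laplacian_coord_Phi:
  fixes x :: "real^'n::finite"
  shows "laplacian (\<lambda>y. (y - x) $ i * Phi k \<epsilon> (y - x)) y = (y - x) $ i *
     ((4 + 2 * real CARD('n)) / \<epsilon>\<^sup>2 * Phi (Suc k) \<epsilon> (y - x) + 4 / \<epsilon>^4 * (norm (y - x))\<^sup>2 * Phi (Suc (Suc k)) \<epsilon> (y - x))"
proof -
  let ?\<delta> = "\<lambda>j. if j = i then 1 else 0 :: real"
  have "partial j (partial j (\<lambda>y. (y - x) $ i * Phi k \<epsilon> (y - x))) y = (y - x) $ i *
      (2 / \<epsilon>\<^sup>2 * Phi (Suc k) \<epsilon> (y - x) + 4 / \<epsilon>^4 * (((y - x) $ j)\<^sup>2) * Phi (Suc (Suc k)) \<epsilon> (y - x))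
      + ?\<delta> j * (4 / \<epsilon>\<^sup>2 * (y - x) $ i * Phi (Suc k) \<epsilon> (y - x))" for j
  proof -
    let ?z = "y - x"
    have d1: "((\<lambda>y. 2 / \<epsilon>\<^sup>2 * ((y - x) $ j * ((y - x) $ i * Phi (Suc k) \<epsilon> (y - x))) + ?\<delta> j * Phi k \<epsilon> (y - x))
       has_derivative (\<lambda>h. 2 / \<epsilon>\<^sup>2 * (?z $ j * (?z $ i * (2 / \<epsilon>\<^sup>2 * (?z \<bullet> h) * Phi (Suc (Suc k)) \<epsilon> ?z) + h $ i * Phi (Suc k) \<epsilon> ?z)
          + h $ j * (?z $ i * Phi (Suc k) \<epsilon> ?z)) + ?\<delta> j * (2 / \<epsilon>\<^sup>2 * (?z \<bullet> h) * Phi (Suc k) \<epsilon> ?z))) (at y)"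
      by (intro has_derivative_add has_derivative_mult_right has_derivative_mult has_derivative_coord has_derivative_Phi)
    have "partial j (partial j (\<lambda>y. (y - x) $ i * Phi k \<epsilon> (y - x))) y =
       partial j (\<lambda>y. 2 / \<epsilon>\<^sup>2 * ((y - x) $ j * ((y - x) $ i * Phi (Suc k) \<epsilon> (y - x))) + ?\<delta> j * Phi k \<epsilon> (y - x)) y"
      by (simp add: partial_coord_Phi mult.assoc del: vector_minus_component)
    also have "\<dots> = 2 / \<epsilon>\<^sup>2 * (?z $ j * (?z $ i * (2 / \<epsilon>\<^sup>2 * ?z $ j * Phi (Suc (Suc k)) \<epsilon> ?z) + ?\<delta> j * Phi (Suc k) \<epsilon> ?z)
          + ?z $ i * Phi (Suc k) \<epsilon> ?z) + ?\<delta> j * (2 / \<epsilon>\<^sup>2 * ?z $ j * Phi (Suc k) \<epsilon> ?z)"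
      by (subst has_partial[OF d1]) (simp add: inner_axis del: vector_minus_component, simp add: axis_def)
    finally show ?thesis
      by (cases "j = i") (simp_all add: algebra_simps power2_eq_square power4_eq_xxxx del: vector_minus_component)
  qed
  then have "laplacian (\<lambda>y. (y - x) $ i * Phi k \<epsilon> (y - x)) y = (\<Sum>j\<in>UNIV. (y - x) $ i *
      (2 / \<epsilon>\<^sup>2 * Phi (Suc k) \<epsilon> (y - x) + 4 / \<epsilon>^4 * (((y - x) $ j)\<^sup>2) * Phi (Suc (Suc k)) \<epsilon> (y - x)))
      + (\<Sum>j\<in>UNIV. ?\<delta> j * (4 / \<epsilon>\<^sup>2 * (y - x) $ i * Phi (Suc k) \<epsilon> (y - x)))"
    by (simp add: laplacian_def sum.distrib del: vector_minus_component)
  also have "(\<Sum>j\<in>UNIV. ?\<delta> j * (4 / \<epsilon>\<^sup>2 * (y - x) $ i * Phi (Suc k) \<epsilon> (y - x))) = 4 / \<epsilon>\<^sup>2 * (y - x) $ i * Phi (Suc k) \<epsilon> (y - x)"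
    by (subst sum_distrib_right[symmetric]) simp
  also have "(\<Sum>j\<in>UNIV. (y - x) $ i *
      (2 / \<epsilon>\<^sup>2 * Phi (Suc k) \<epsilon> (y - x) + 4 / \<epsilon>^4 * (((y - x) $ j)\<^sup>2) * Phi (Suc (Suc k)) \<epsilon> (y - x))) =
      (y - x) $ i * (2 * CARD('n) / \<epsilon>\<^sup>2 * Phi (Suc k) \<epsilon> (y - x) + 4 / \<epsilon>^4 * (norm (y - x))\<^sup>2 * Phi (Suc (Suc k)) \<epsilon> (y - x))"
    unfolding sum_distrib_left[symmetric] sum.distrib norm_sq_sum
    by (simp add: sum_distrib_left sum_distrib_right sum_divide_distrib mult_ac del: vector_minus_component)
  finally show ?thesis by (simp add: algebra_simps add_divide_distrib del: vector_minus_component)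
qed

text \<open>The normalisation contributes the factor -n/\<epsilon>, and the argument
  |z|^2/\<epsilon>^2 contributes the term with |z|^2. Up to a factor this is the combination in
  \<open>laplacian_Phi\<close> with the index lowered by one.\<close>

lemma DERIV_Phi_scale:
  fixes z :: "real^'n::finite"
  assumes "\<epsilon> > 0"
  shows "((\<lambda>\<epsilon>. Phi k \<epsilon> z) has_real_derivative
    - (CARD('n) / \<epsilon> * Phi k \<epsilon> z + 2 / \<epsilon>^3 * (norm z)\<^sup>2 * Phi (Suc k) \<epsilon> z)) (at \<epsilon>)"
proof -
  let ?J = "bump_mass TYPE('n)"
  have 1: "((\<lambda>\<epsilon>. (norm z)\<^sup>2 / \<epsilon>\<^sup>2) has_real_derivative - 2 / \<epsilon>^3 * (norm z)\<^sup>2) (at \<epsilon>)"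
    using assms by (auto intro!: derivative_eq_intros simp: field_simps power2_eq_square power3_eq_cube)
  have 2: "((\<lambda>\<epsilon>. inverse (\<epsilon> ^ CARD('n))) has_real_derivative - (CARD('n) / \<epsilon> * inverse (\<epsilon> ^ CARD('n)))) (at \<epsilon>)"
  proof -
    \<comment> \<open>The power rule leaves the exponent n - 1; since n >= 1 it can be traded for a
      factor 1/\<epsilon>.\<close>
    have "\<epsilon> ^ CARD('n) = \<epsilon> * \<epsilon> ^ (CARD('n) - Suc 0)"
      by (metis One_nat_def Suc_pred power_Suc zero_less_card_finite)
    then show ?thesis using assms by (auto intro!: derivative_eq_intros simp: field_simps)
  qed
  have "((\<lambda>\<epsilon>. inverse ?J * (bump k ((norm z)\<^sup>2 / \<epsilon>\<^sup>2) * inverse (\<epsilon> ^ CARD('n)))) has_real_derivative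
     inverse ?J * (bump k ((norm z)\<^sup>2 / \<epsilon>\<^sup>2) * - (CARD('n) / \<epsilon> * inverse (\<epsilon> ^ CARD('n))) +
       bump (Suc k) ((norm z)\<^sup>2 / \<epsilon>\<^sup>2) * (- 2 / \<epsilon>^3 * (norm z)\<^sup>2) * inverse (\<epsilon> ^ CARD('n)))) (at \<epsilon>)"
    by (intro DERIV_cmult DERIV_mult' DERIV_bump_chain 1 2)
  moreover have Phi: "Phi m \<epsilon> z = inverse ?J * (bump m ((norm z)\<^sup>2 / \<epsilon>\<^sup>2) * inverse (\<epsilon> ^ CARD('n)))" for m \<epsilon>
    by (simp add: Phi_def divide_inverse mult_ac)
  ultimately show ?thesis unfolding Phi by (simp add: algebra_simps)
qed

lemma Phi_1_nonpos: "\<epsilon> > 0 \<Longrightarrow> Phi 1 \<epsilon> (z::real^'n::finite) \<le> 0"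
  using bump_1_nonpos bump_mass_pos[where 'n='n] by (simp add: Phi_def divide_nonpos_pos)

lemma mollifier_mass:
  assumes "\<epsilon> > 0"
  shows "(LINT y|lebesgue. - 2 * Phi 1 \<epsilon> (y - x :: real^'n::finite)) = 1"
proof -
  let ?J = "bump_mass TYPE('n)"
  have J: "?J > 0" by (rule bump_mass_pos)
  have "(LINT y|lebesgue. - 2 * Phi 1 \<epsilon> (y - x)) = \<bar>\<epsilon>\<bar> ^ DIM(real^'n) * (LINT w|lebesgue. - 2 * Phi 1 \<epsilon> (x + \<epsilon> *\<^sub>R w - x))"
    using assms by (intro lebesgue_integral_affine continuous_measurable_lebesgue) (auto intro!: continuous_intros)
  also have "\<dots> = \<epsilon> ^ CARD('n) * (LINT w::real^'n|lebesgue. (- 2 * bump 1 ((norm w)\<^sup>2)) / (\<epsilon> ^ CARD('n) * ?J))"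
    using assms by (simp add: Phi_def power_mult_distrib)
  also have "\<dots> = \<epsilon> ^ CARD('n) * (?J / (\<epsilon> ^ CARD('n) * ?J))"
    by (simp only: integral_divide_zero bump_mass_def)
  also have "\<dots> = 1"
    using assms J by simp
  finally show ?thesis .
qed

lemma has_derivative_imp_directional:
  assumes "(f has_derivative f') (at x)"
  shows "((\<lambda>t. f (x + t *\<^sub>R e)) has_real_derivative f' e) (at 0)"
proof -
  have 1: "((\<lambda>t::real. x + t *\<^sub>R e) has_derivative (\<lambda>t. t *\<^sub>R e)) (at 0)"
    by (auto intro!: derivative_eq_intros)
  have "((\<lambda>t. f (x + t *\<^sub>R e)) has_derivative (\<lambda>t. f' (t *\<^sub>R e))) (at 0)"
    by (rule has_derivative_compose[OF 1]) (use assms in simp)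
  moreover have "(\<lambda>t. f' (t *\<^sub>R e)) = (*) (f' e)"
    using linear_scale[OF has_derivative_linear[OF assms]] by auto
  ultimately show ?thesis
    by (simp add: has_field_derivative_def)
qed

section \<open>Mollification with its derivatives of first and second order\<close>

definition mol :: "real \<Rightarrow> (real^'n::finite \<Rightarrow> real) \<Rightarrow> real^'n \<Rightarrow> real" where
  "mol \<epsilon> q = corr q (\<lambda>z. - 2 * Phi 1 \<epsilon> z)"

text \<open>\<open>molD j \<epsilon> q\<close> and \<open>molH j k \<epsilon> q\<close> are the first and second partial derivatives of \<open>mol \<epsilon> q\<close>.\<close>

definition molD :: "'n \<Rightarrow> real \<Rightarrow> (real^'n::finite \<Rightarrow> real) \<Rightarrow> real^'n \<Rightarrow> real" where
  "molD j \<epsilon> q = corr q (\<lambda>z. 4 / \<epsilon>\<^sup>2 * (z $ j * Phi 2 \<epsilon> z))"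

definition molH :: "'n \<Rightarrow> 'n \<Rightarrow> real \<Rightarrow> (real^'n::finite \<Rightarrow> real) \<Rightarrow> real^'n \<Rightarrow> real" where
  "molH j k \<epsilon> q = corr q (\<lambda>z. - (4 / \<epsilon>\<^sup>2 *
     (2 / \<epsilon>\<^sup>2 * z $ k * z $ j * Phi 3 \<epsilon> z + (if k = j then 1 else 0) * Phi 2 \<epsilon> z)))"

lemma molH_sym: "molH j k = molH k j"
  unfolding molH_def by (intro ext arg_cong2[where f="\<lambda>q. corr q"]) (auto simp: mult_ac)

context
  fixes \<epsilon> :: real and q :: "real^'n::finite \<Rightarrow> real"
  assumes \<epsilon>: "\<epsilon> > 0" and q: "L1_loc q"
begin

lemma continuous_on_mol: "continuous_on UNIV (mol \<epsilon> q)"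
  unfolding mol_def
  by (rule continuous_on_corr[OF q, of _ \<epsilon>]) (use \<epsilon> in \<open>auto intro!: continuous_intros simp: Phi_eq_0\<close>)

lemma continuous_on_molD: "continuous_on UNIV (molD j \<epsilon> q)"
  unfolding molD_def
  by (rule continuous_on_corr[OF q, of _ \<epsilon>]) (use \<epsilon> in \<open>auto intro!: continuous_intros simp: Phi_eq_0\<close>)

lemma continuous_on_molH: "continuous_on UNIV (molH j k \<epsilon> q)"
  unfolding molH_def
  by (rule continuous_on_corr[OF q, of _ \<epsilon>]) (use \<epsilon> in \<open>auto intro!: continuous_intros simp: Phi_eq_0\<close>)

lemma DERIV_mol: "((\<lambda>t. mol \<epsilon> q (x + t *\<^sub>R axis j 1)) has_real_derivative molD j \<epsilon> q x) (at 0)"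
proof -
  have "((\<lambda>t. corr q (\<lambda>z. - 2 * Phi 1 \<epsilon> z) (x + t *\<^sub>R axis j 1)) has_real_derivative
      corr q (\<lambda>z. - (- 2 * (2 / \<epsilon>\<^sup>2 * z $ j * Phi 2 \<epsilon> z))) x) (at 0)"
  proof (rule DERIV_corr[OF q, where r=\<epsilon>])
    fix x :: "real^'n"
    have "((\<lambda>y. - 2 * Phi 1 \<epsilon> (y - 0)) has_derivative (\<lambda>h. - 2 * (2 / \<epsilon>\<^sup>2 * ((x - 0) \<bullet> h) * Phi (Suc 1) \<epsilon> (x - 0)))) (at x)"
      by (intro has_derivative_mult_right has_derivative_Phi)
    from has_derivative_imp_directional[OF this, of "axis j 1"]
    show "((\<lambda>t. - 2 * Phi 1 \<epsilon> (x + t *\<^sub>R axis j 1)) has_real_derivative - 2 * (2 / \<epsilon>\<^sup>2 * x $ j * Phi 2 \<epsilon> x)) (at 0)"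
      by (simp add: inner_axis eval_nat_numeral)
  qed (use \<epsilon> in \<open>auto intro!: continuous_intros simp: Phi_eq_0\<close>)
  then show ?thesis by (simp add: mol_def molD_def mult_ac)
qed

lemma DERIV_molD: "((\<lambda>t. molD j \<epsilon> q (x + t *\<^sub>R axis k 1)) has_real_derivative molH j k \<epsilon> q x) (at 0)"
  unfolding molD_def molH_def
proof (rule DERIV_corr[OF q, where r=\<epsilon>])
  fix x :: "real^'n"
  have "((\<lambda>y. 4 / \<epsilon>\<^sup>2 * ((y - 0) $ j * Phi 2 \<epsilon> (y - 0))) has_derivative
     (\<lambda>h. 4 / \<epsilon>\<^sup>2 * ((x - 0) $ j * (2 / \<epsilon>\<^sup>2 * ((x - 0) \<bullet> h) * Phi (Suc 2) \<epsilon> (x - 0)) + h $ j * Phi 2 \<epsilon> (x - 0)))) (at x)"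
    by (intro has_derivative_mult_right has_derivative_coord_Phi)
  moreover have ax: "axis k 1 $ j = (if k = j then 1 else 0 :: real)" by (simp add: axis_def)
  ultimately show "((\<lambda>t. 4 / \<epsilon>\<^sup>2 * ((x + t *\<^sub>R axis k 1) $ j * Phi 2 \<epsilon> (x + t *\<^sub>R axis k 1))) has_real_derivative
       4 / \<epsilon>\<^sup>2 * (2 / \<epsilon>\<^sup>2 * x $ k * x $ j * Phi 3 \<epsilon> x + (if k = j then 1 else 0) * Phi 2 \<epsilon> x)) (at 0)"
    using has_derivative_imp_directional[of "\<lambda>y. 4 / \<epsilon>\<^sup>2 * ((y - 0) $ j * Phi 2 \<epsilon> (y - 0))" _ x "axis k 1"]
    by (fastforce simp: inner_axis mult_ac eval_nat_numeral)
qed (use \<epsilon> in \<open>auto intro!: continuous_intros simp: Phi_eq_0\<close>)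

text \<open>The kernel is nonnegative of mass 1 and lives on the ball of radius \<epsilon>, so
  \<open>mol\<close> is an average over that ball. The choice c = q x gives convergence at points of
  continuity, and c = 0 shows that local bounds survive mollification.\<close>

lemma mol_diff_bound:
  assumes "AE y in lebesgue. y \<in> cball x \<epsilon> \<longrightarrow> \<bar>q y - c\<bar> \<le> \<eta>"
  shows "\<bar>mol \<epsilon> q x - c\<bar> \<le> \<eta>"
proof -
  let ?\<rho> = "\<lambda>y. - 2 * Phi 1 \<epsilon> (y - x)"
  have \<rho>: "?\<rho> y \<ge> 0" for y using Phi_1_nonpos[OF \<epsilon>, of "y - x"] by simp
  have int: "integrable lebesgue (\<lambda>y. g y * ?\<rho> y)" if "L1_loc g" for g
    using that by (rule integrable_corr[where r=\<epsilon>]) (use \<epsilon> in \<open>auto intro!: continuous_intros simp: Phi_eq_0\<close>)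
  have const: "L1_loc (\<lambda>y::real^'n. c::real)" for c by (intro L1_loc_continuous continuous_intros)
  have "mol \<epsilon> q x - c = (LINT y|lebesgue. q y * ?\<rho> y) - (LINT y|lebesgue. c * ?\<rho> y)"
    using mollifier_mass[OF \<epsilon>, of x] by (simp add: mol_def corr_def)
  also have "\<dots> = (LINT y|lebesgue. q y * ?\<rho> y - c * ?\<rho> y)"
    by (rule Bochner_Integration.integral_diff[OF int[OF q] int[OF const], symmetric])
  finally have "\<bar>mol \<epsilon> q x - c\<bar> = \<bar>LINT y|lebesgue. q y * ?\<rho> y - c * ?\<rho> y\<bar>" by simp
  also have "\<dots> \<le> (LINT y|lebesgue. \<bar>q y * ?\<rho> y - c * ?\<rho> y\<bar>)" by (rule integral_abs_bound)
  also have "\<dots> \<le> (LINT y|lebesgue. \<eta> * ?\<rho> y)"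
  proof (rule integral_mono_AE)
    show "integrable lebesgue (\<lambda>y. \<bar>q y * ?\<rho> y - c * ?\<rho> y\<bar>)"
      by (intro integrable_abs Bochner_Integration.integrable_diff int q const)
    show "integrable lebesgue (\<lambda>y. \<eta> * ?\<rho> y)" by (rule int[OF const])
    show "AE y in lebesgue. \<bar>q y * ?\<rho> y - c * ?\<rho> y\<bar> \<le> \<eta> * ?\<rho> y"
      using assms
    proof eventually_elim
      case (elim y)
      show ?case
      proof (cases "y \<in> cball x \<epsilon>")
        case True
        have "\<bar>q y * ?\<rho> y - c * ?\<rho> y\<bar> = \<bar>q y - c\<bar> * ?\<rho> y"
          by (simp only: left_diff_distrib[symmetric] abs_mult[of "q y - c"] abs_of_nonneg[OF \<rho>])
        then show ?thesis using elim True \<rho>[of y] by (simp only: mult_right_mono)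
      next
        case False
        then show ?thesis by (simp add: Phi_eq_0[OF \<epsilon>] dist_norm norm_minus_commute)
      qed
    qed
  qed
  also have "\<dots> = \<eta>" using mollifier_mass[OF \<epsilon>, of x] by simp
  finally show ?thesis .
qed

end

lemma mol_tendsto:
  fixes q :: "real^'n::finite \<Rightarrow> real"
  assumes "L1_loc q" "isCont q x" "\<And>n. e n > 0" "e \<longlonglongrightarrow> 0"
  shows "(\<lambda>n. mol (e n) q x) \<longlonglongrightarrow> q x"
proof (rule LIMSEQ_I)
  fix r :: real assume "r > 0"
  then obtain d where d: "d > 0" "\<And>y. dist y x < d \<Longrightarrow> \<bar>q y - q x\<bar> < r / 2"
    using assms(2) unfolding continuous_at_eps_delta dist_real_def by (metis half_gt_zero)
  obtain N where N: "\<And>n. n \<ge> N \<Longrightarrow> \<bar>e n\<bar> < d"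
    using LIMSEQ_D[OF assms(4) d(1)] by auto
  have "norm (mol (e n) q x - q x) < r" if "n \<ge> N" for n
  proof -
    have "\<bar>mol (e n) q x - q x\<bar> \<le> r / 2"
      using N[OF that] by (intro mol_diff_bound assms AE_I2 impI less_imp_le[OF d(2)])
         (auto simp: dist_commute)
    then show ?thesis using \<open>r > 0\<close> by simp
  qed
  then show "\<exists>N. \<forall>n\<ge>N. norm (mol (e n) q x - q x) < r" by blast
qed

section \<open>Mollified solutions of the Poisson equation\<close>

text \<open>The translated kernel is itself a test function. Its derivative in y is the negative of
  its derivative in x, and this sign cancels the one in the definition of the weak
  derivative.\<close>

lemma molD_weak_derivative:
  fixes q g :: "real^'n::finite \<Rightarrow> real"
  assumes "\<And>\<phi>. test_function \<phi> \<Longrightarrow> (LINT y|lebesgue. q y * partial j \<phi> y) = - (LINT y|lebesgue. g y * \<phi> y)" "\<epsilon> > 0"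
  shows "molD j \<epsilon> q x = mol \<epsilon> g x"
proof -
  have "partial j (\<lambda>y. - 2 * Phi 1 \<epsilon> (y - x)) y = - (4 / \<epsilon>\<^sup>2 * ((y - x) $ j * Phi 2 \<epsilon> (y - x)))" for y
    using partial_cmult[OF differentiableI[OF has_derivative_Phi], of j "-2" 1 \<epsilon> x y]
    by (simp add: partial_Phi eval_nat_numeral del: vector_minus_component)
  then show ?thesis
    using assms(1)[OF test_function_Phi[OF assms(2), of "-2" 1 x]] by (simp add: molD_def mol_def corr_def)
qed

context
  fixes q f :: "real^'n::finite \<Rightarrow> real"
  assumes q: "L1_loc q" and f: "L1_loc f"
    and weak: "\<And>\<phi>. test_function \<phi> \<Longrightarrow> (LINT y|lebesgue. q y * laplacian \<phi> y) = (LINT y|lebesgue. f y * \<phi> y)"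
begin

text \<open>The trace of the second-derivative kernels is the Laplacian of the translated mollifier,
  to which the weak equation applies: mollified functions solve the mollified equation
  classically.\<close>

lemma trace_molH:
  assumes \<epsilon>: "\<epsilon> > 0"
  shows "(\<Sum>k\<in>UNIV. molH k k \<epsilon> q x) = mol \<epsilon> f x"
proof -
  let ?\<kappa> = "\<lambda>k z. - (4 / \<epsilon>\<^sup>2 * (2 / \<epsilon>\<^sup>2 * z $ k * z $ k * Phi 3 \<epsilon> z + (if k = k then 1 else 0) * Phi 2 \<epsilon> z))"
  have "(\<Sum>k\<in>UNIV. molH k k \<epsilon> q x) = (\<Sum>k\<in>UNIV. LINT y|lebesgue. q y * ?\<kappa> k (y - x))"
    by (simp only: molH_def corr_def)
  also have "\<dots> = (LINT y|lebesgue. (\<Sum>k\<in>UNIV. q y * ?\<kappa> k (y - x)))"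
    by (rule Bochner_Integration.integral_sum[symmetric], rule integrable_corr[OF q, of _ \<epsilon>])
       (use \<epsilon> in \<open>auto intro!: continuous_intros simp: Phi_eq_0\<close>)
  \<comment> \<open>The factor 1 brings the kernel into the form c * Phi of
    \<open>test_function_Phi\<close>.\<close>
  also have "(\<lambda>y. \<Sum>k\<in>UNIV. q y * ?\<kappa> k (y - x)) = (\<lambda>y. - 2 * (q y * laplacian (\<lambda>y. 1 * Phi 1 \<epsilon> (y - x)) y))"
  proof
    fix y
    show "(\<Sum>k\<in>UNIV. q y * ?\<kappa> k (y - x)) = - 2 * (q y * laplacian (\<lambda>y. 1 * Phi 1 \<epsilon> (y - x)) y)"
      unfolding sum_distrib_left[symmetric] mult_1 laplacian_Phi norm_sq_sum
      by (simp add: sum_negf sum.distrib sum_subtractf sum_distrib_left sum_distrib_right sum_divide_distrib algebra_simps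
        power2_eq_square power4_eq_xxxx eval_nat_numeral del: vector_minus_component)
  qed
  also have "(LINT y|lebesgue. - 2 * (q y * laplacian (\<lambda>y. 1 * Phi 1 \<epsilon> (y - x)) y)) = - 2 * (LINT y|lebesgue. f y * (1 * Phi 1 \<epsilon> (y - x)))"
    by (simp only: integral_mult_right_zero weak[OF test_function_Phi[OF \<epsilon>, of 1 1 x]])
  also have "\<dots> = (LINT y|lebesgue. f y * (- 2 * Phi 1 \<epsilon> (y - x)))"
    by (simp only: integral_mult_right_zero[symmetric] mult.left_commute mult_1)
  finally show ?thesis by (simp add: mol_def corr_def)
qed

text \<open>The \<epsilon>-derivative of the mollifier is \<epsilon> times the Laplacian of
  \<open>Phi 0\<close>, so the weak equation moves the derivative from \<open>q\<close> to the datum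
  \<open>f\<close>.\<close>

lemma DERIV_mol_scale:
  assumes \<epsilon>: "\<epsilon> > 0"
  shows "((\<lambda>\<epsilon>. mol \<epsilon> q x) has_real_derivative \<epsilon> * corr f (Phi 0 \<epsilon>) x) (at \<epsilon>)"
proof -
  let ?k' = "\<lambda>t y. - 2 * - (CARD('n) / t * Phi 1 t (y - x) + 2 / t^3 * (norm (y - x))\<^sup>2 * Phi (Suc 1) t (y - x))"
  have "((\<lambda>t. LINT y|lebesgue. q y * (- 2 * Phi 1 t (y - x))) has_real_derivative
          (LINT y|lebesgue. q y * ?k' \<epsilon> y)) (at \<epsilon>)"
  \<comment> \<open>The parameter interval stays away from 0, where the kernels degenerate, and the
    ball of radius 2\<epsilon> contains the supports for all its parameters.\<close>
  proof (rule DERIV_integral_kernel[where a="\<epsilon>/2" and b="2*\<epsilon>" and K="cball x (2*\<epsilon>)", OF q])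
    show "((\<lambda>t. - 2 * Phi 1 t (y - x)) has_real_derivative ?k' t y) (at t)" if "t \<in> {\<epsilon>/2..2*\<epsilon>}" for t y
      using \<epsilon> that by (intro DERIV_cmult DERIV_Phi_scale) auto
    show "- 2 * Phi 1 t (y - x) = 0" if "t \<in> {\<epsilon>/2..2*\<epsilon>}" "y \<notin> cball x (2*\<epsilon>)" for t y
      using \<epsilon> that Phi_eq_0[of t "y - x" 1] by (simp add: dist_norm norm_minus_commute)
    have P: "continuous_on ({\<epsilon>/2..2*\<epsilon>} \<times> UNIV) (\<lambda>p. Phi k (fst p) (snd p - x))" for k
      using continuous_Phi_joint[of "\<epsilon>/2" "2*\<epsilon>" k x] \<epsilon> by (simp add: split_beta)
    show "continuous_on ({\<epsilon>/2..2*\<epsilon>} \<times> UNIV) (\<lambda>(t, y). - 2 * Phi 1 t (y - x))"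
      "continuous_on ({\<epsilon>/2..2*\<epsilon>} \<times> UNIV) (\<lambda>(t, y). ?k' t y)"
      unfolding split_beta using \<epsilon> by (intro continuous_intros P; auto)+
  qed (use \<epsilon> in auto)
  also have "(\<lambda>y. q y * ?k' \<epsilon> y) = (\<lambda>y. \<epsilon> * (q y * laplacian (\<lambda>y. 1 * Phi 0 \<epsilon> (y - x)) y))"
  proof -
    \<comment> \<open>Matches \<open>DERIV_Phi_scale\<close> with \<open>laplacian_Phi\<close>: a
      and b stand for \<open>Phi 1\<close> and \<open>Phi 2\<close>, s for |z|^2 and c for the
      dimension.\<close>
    have "- 2 * - (c / \<epsilon> * a + 2 / \<epsilon>^3 * s * b) = \<epsilon> * (2 * c / \<epsilon>\<^sup>2 * a + 4 / \<epsilon>^4 * s * b)" for a b c s :: real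
      using \<epsilon> by (simp add: field_simps power2_eq_square power3_eq_cube power4_eq_xxxx)
    then show ?thesis unfolding mult_1 laplacian_Phi One_nat_def by (simp only: mult.left_commute)
  qed
  also have "(LINT y|lebesgue. \<epsilon> * (q y * laplacian (\<lambda>y. 1 * Phi 0 \<epsilon> (y - x)) y)) = \<epsilon> * corr f (Phi 0 \<epsilon>) x"
    using weak[OF test_function_Phi[OF \<epsilon>, of 1 0 x]] by (simp add: corr_def)
  finally show ?thesis by (simp add: mol_def corr_def)
qed

text \<open>The kernel of \<open>molD\<close> is minus a partial derivative of the mollifier. Hence
  its \<epsilon>-derivative is -\<epsilon> times the Laplacian of the j-th partial derivative of
  \<open>Phi 0\<close>; since that partial derivative is 2/\<epsilon>^2 times z_j
  \<open>Phi 1\<close>, the factor -2/\<epsilon> results.\<close>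

lemma DERIV_molD_scale:
  assumes \<epsilon>: "\<epsilon> > 0"
  shows "((\<lambda>\<epsilon>. molD j \<epsilon> q x) has_real_derivative - (2 / \<epsilon>) * corr f (\<lambda>z. z $ j * Phi 1 \<epsilon> z) x) (at \<epsilon>)"
proof -
  let ?k' = "\<lambda>t y. 4 / t\<^sup>2 * ((y - x) $ j * - (CARD('n) / t * Phi 2 t (y - x) + 2 / t^3 * (norm (y - x))\<^sup>2 * Phi (Suc 2) t (y - x)))
      + - 8 / t^3 * ((y - x) $ j * Phi 2 t (y - x))"
  have "((\<lambda>t. LINT y|lebesgue. q y * (4 / t\<^sup>2 * ((y - x) $ j * Phi 2 t (y - x)))) has_real_derivative
          (LINT y|lebesgue. q y * ?k' \<epsilon> y)) (at \<epsilon>)"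
  proof (rule DERIV_integral_kernel[where a="\<epsilon>/2" and b="2*\<epsilon>" and K="cball x (2*\<epsilon>)", OF q])
    show "((\<lambda>t. 4 / t\<^sup>2 * ((y - x) $ j * Phi 2 t (y - x))) has_real_derivative ?k' t y) (at t)" if "t \<in> {\<epsilon>/2..2*\<epsilon>}" for t y
    proof (intro DERIV_mult' DERIV_cmult DERIV_Phi_scale)
      show "((\<lambda>t. 4 / t\<^sup>2) has_real_derivative - 8 / t^3) (at t)"
        using \<epsilon> that by (auto intro!: derivative_eq_intros simp: field_simps power2_eq_square power3_eq_cube)
    qed (use \<epsilon> that in auto)
    show "4 / t\<^sup>2 * ((y - x) $ j * Phi 2 t (y - x)) = 0" if "t \<in> {\<epsilon>/2..2*\<epsilon>}" "y \<notin> cball x (2*\<epsilon>)" for t y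
      using \<epsilon> that Phi_eq_0[of t "y - x" 2] by (simp add: dist_norm norm_minus_commute)
    have P: "continuous_on ({\<epsilon>/2..2*\<epsilon>} \<times> UNIV) (\<lambda>p. Phi k (fst p) (snd p - x))" for k
      using continuous_Phi_joint[of "\<epsilon>/2" "2*\<epsilon>" k x] \<epsilon> by (simp add: split_beta)
    show "continuous_on ({\<epsilon>/2..2*\<epsilon>} \<times> UNIV) (\<lambda>(t, y). 4 / t\<^sup>2 * ((y - x) $ j * Phi 2 t (y - x)))"
      "continuous_on ({\<epsilon>/2..2*\<epsilon>} \<times> UNIV) (\<lambda>(t, y). ?k' t y)"
      unfolding split_beta using \<epsilon> by (intro continuous_intros P; auto)+
  qed (use \<epsilon> in auto)
  also have "(\<lambda>y. q y * ?k' \<epsilon> y) = (\<lambda>y. - (2 / \<epsilon>) * (q y * laplacian (\<lambda>y. (y - x) $ j * Phi 1 \<epsilon> (y - x)) y))"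
  proof -
    have "4 / \<epsilon>\<^sup>2 * (z * - (c / \<epsilon> * a + 2 / \<epsilon>^3 * s * b)) + - 8 / \<epsilon>^3 * (z * a) =
       - (2 / \<epsilon>) * (z * ((4 + 2 * c) / \<epsilon>\<^sup>2 * a + 4 / \<epsilon>^4 * s * b))" for a b c s z :: real
      using \<epsilon> by (simp add: field_simps power2_eq_square power3_eq_cube power4_eq_xxxx)
    then show ?thesis unfolding laplacian_coord_Phi Suc_1 by (simp only: mult.left_commute)
  qed
  also have "(LINT y|lebesgue. - (2 / \<epsilon>) * (q y * laplacian (\<lambda>y. (y - x) $ j * Phi 1 \<epsilon> (y - x)) y)) =
      - (2 / \<epsilon>) * corr f (\<lambda>z. z $ j * Phi 1 \<epsilon> z) x"
    using weak[OF test_function_coord_Phi[OF \<epsilon>, of x j 1]] by (simp add: corr_def)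
  finally show ?thesis by (simp add: molD_def corr_def)
qed

text \<open>Both scale derivatives are bounded by a constant times the supremum of |f| on the unit
  ball around x. The constant is fixed before x and M, so a local bound on f yields Lipschitz
  estimates that are uniform for x in a ball.\<close>

lemma mol_Lipschitz_scale:
  "\<exists>C\<ge>0. \<forall>x M. (AE y in lebesgue. y \<in> cball x 1 \<longrightarrow> \<bar>f y\<bar> \<le> M) \<longrightarrow>
     (\<forall>\<epsilon>\<in>{0<..1}. \<forall>\<delta>\<in>{0<..1}. \<bar>mol \<epsilon> q x - mol \<delta> q x\<bar> \<le> C * \<bar>M\<bar> * \<bar>\<epsilon> - \<delta>\<bar> \<and>
        (\<forall>j. \<bar>molD j \<epsilon> q x - molD j \<delta> q x\<bar> \<le> C * \<bar>M\<bar> * \<bar>\<epsilon> - \<delta>\<bar>))"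
proof -
  let ?v = "unit_ball_vol DIM(real^'n)"
  obtain C0 where C0: "C0 \<ge> 0" "\<And>\<epsilon> z::real^'n. \<epsilon> > 0 \<Longrightarrow> \<bar>Phi 0 \<epsilon> z\<bar> \<le> C0 / \<epsilon> ^ CARD('n)"
    using Phi_bounded[of 0] by blast
  obtain C1 where C1: "C1 \<ge> 0" "\<And>\<epsilon> z::real^'n. \<epsilon> > 0 \<Longrightarrow> \<bar>Phi 1 \<epsilon> z\<bar> \<le> C1 / \<epsilon> ^ CARD('n)"
    using Phi_bounded[of 1] by blast
  define C where "C = (C0 + 2 * C1) * ?v"
  have v: "?v \<ge> 0" by simp
  have "C \<ge> 0" using C0 C1 by (simp add: C_def)
  have b0: "\<bar>\<epsilon> * corr f (Phi 0 \<epsilon>) x\<bar> \<le> C * \<bar>M\<bar>"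
    and b1: "\<bar>- (2 / \<epsilon>) * corr f (\<lambda>z. z $ j * Phi 1 \<epsilon> z) x\<bar> \<le> C * \<bar>M\<bar>"
    if M: "AE y in lebesgue. y \<in> cball x 1 \<longrightarrow> \<bar>f y\<bar> \<le> M" and \<epsilon>: "\<epsilon> \<in> {0<..1}" for x M \<epsilon> j
  proof -
    have \<epsilon>0: "\<epsilon> > 0" "\<epsilon> \<le> 1" using \<epsilon> by auto
    have M': "AE y in lebesgue. y \<in> cball x \<epsilon> \<longrightarrow> \<bar>f y\<bar> \<le> \<bar>M\<bar>"
      using M by eventually_elim (use \<epsilon>0 in auto)
    have "\<bar>corr f (Phi 0 \<epsilon>) x\<bar> \<le> \<bar>M\<bar> * (C0 / \<epsilon> ^ CARD('n)) * (?v * \<epsilon> ^ DIM(real^'n))"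
      using \<epsilon>0 by (intro corr_bound f continuous_Phi M' C0) (auto simp: Phi_eq_0)
    also have "\<dots> = C0 * ?v * \<bar>M\<bar>" using \<epsilon>0 by simp
    finally have "\<bar>\<epsilon>\<bar> * \<bar>corr f (Phi 0 \<epsilon>) x\<bar> \<le> 1 * (C0 * ?v * \<bar>M\<bar>)"
      using \<epsilon>0 by (intro mult_mono) auto
    also have "1 * (C0 * ?v * \<bar>M\<bar>) \<le> C * \<bar>M\<bar>"
      unfolding mult_1 C_def using C1 v by (intro mult_right_mono) auto
    finally show "\<bar>\<epsilon> * corr f (Phi 0 \<epsilon>) x\<bar> \<le> C * \<bar>M\<bar>" by (simp add: abs_mult)
    have "\<bar>z $ j * Phi 1 \<epsilon> z\<bar> \<le> \<epsilon> * (C1 / \<epsilon> ^ CARD('n))" for z :: "real^'n"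
    proof (cases "norm z \<ge> \<epsilon>")
      case False
      then have "\<bar>z $ j\<bar> \<le> \<epsilon>" using component_le_norm_cart[of z j] by simp
      then show ?thesis unfolding abs_mult using C1 \<epsilon>0 by (intro mult_mono) auto
    qed (use \<epsilon>0 C1 in \<open>simp add: Phi_eq_0\<close>)
    then have "\<bar>corr f (\<lambda>z. z $ j * Phi 1 \<epsilon> z) x\<bar> \<le> \<bar>M\<bar> * (\<epsilon> * (C1 / \<epsilon> ^ CARD('n))) * (?v * \<epsilon> ^ DIM(real^'n))"
      using \<epsilon>0 by (intro corr_bound f M') (auto intro!: continuous_intros simp: Phi_eq_0)
    also have "\<dots> = \<epsilon> * (C1 * ?v * \<bar>M\<bar>)" using \<epsilon>0 by simp
    finally have "(2 / \<epsilon>) * \<bar>corr f (\<lambda>z. z $ j * Phi 1 \<epsilon> z) x\<bar> \<le> (2 / \<epsilon>) * (\<epsilon> * (C1 * ?v * \<bar>M\<bar>))"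
      using \<epsilon>0 by (intro mult_left_mono) auto
    also have "\<dots> = (2 * C1 * ?v) * \<bar>M\<bar>" using \<epsilon>0 by simp
    also have "\<dots> \<le> C * \<bar>M\<bar>"
      unfolding C_def using C0 v by (intro mult_right_mono) auto
    finally show "\<bar>- (2 / \<epsilon>) * corr f (\<lambda>z. z $ j * Phi 1 \<epsilon> z) x\<bar> \<le> C * \<bar>M\<bar>"
      using \<epsilon>0 by (simp add: abs_mult)
  qed
  \<comment> \<open>Mean value inequality on (0,1]; boundedness of the derivative up to the excluded
    endpoint 0 is the whole gain.\<close>
  have lip: "\<bar>g \<epsilon> - g \<delta>\<bar> \<le> B * \<bar>\<epsilon> - \<delta>\<bar>"
    if "\<And>t. t \<in> {0<..1} \<Longrightarrow> (g has_real_derivative g' t) (at t)" "\<And>t. t \<in> {0<..1} \<Longrightarrow> \<bar>g' t\<bar> \<le> B"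
      "\<epsilon> \<in> {0<..1}" "\<delta> \<in> {0<..1}" for g g' :: "real \<Rightarrow> real" and B \<epsilon> \<delta>
    using field_differentiable_bound[of "{0<..1}" g g' B \<epsilon> \<delta>] that
    by (auto simp: has_field_derivative_at_within)
  show ?thesis
  proof (intro exI[of _ C] conjI allI impI ballI)
    fix x M and \<epsilon> \<delta> :: real assume M: "AE y in lebesgue. y \<in> cball x 1 \<longrightarrow> \<bar>f y\<bar> \<le> M" and ed: "\<epsilon> \<in> {0<..1}" "\<delta> \<in> {0<..1::real}"
    show "\<bar>mol \<epsilon> q x - mol \<delta> q x\<bar> \<le> C * \<bar>M\<bar> * \<bar>\<epsilon> - \<delta>\<bar>"
      by (rule lip[OF _ b0[OF M] ed]) (use DERIV_mol_scale in auto)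
    show "\<bar>molD j \<epsilon> q x - molD j \<delta> q x\<bar> \<le> C * \<bar>M\<bar> * \<bar>\<epsilon> - \<delta>\<bar>" for j
      by (rule lip[OF _ b1[OF M] ed]) (use DERIV_molD_scale in auto)
  qed (rule \<open>C \<ge> 0\<close>)
qed

end

section \<open>Recovering a locally integrable function from its mollifications\<close>

lemma Phi_minus: "Phi k \<epsilon> (y - x) = Phi k \<epsilon> (x - y :: real^'n::finite)"
  by (simp add: Phi_def norm_minus_commute)

lemma L1_loc_indicator: "S \<in> sets lebesgue \<Longrightarrow> L1_loc (indicator S :: 'a::euclidean_space \<Rightarrow> real)"
  unfolding L1_loc_def set_integrable_def
proof (intro conjI allI impI)
  fix K :: "'a set" assume "compact K" and S: "S \<in> sets lebesgue"
  then have K: "K \<in> lmeasurable" by (rule_tac lmeasurable_compact)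
  have "K \<inter> S \<in> lmeasurable" by (rule fmeasurable_Int_fmeasurable[OF K S])
  then have "integrable lebesgue (indicator (K \<inter> S) :: 'a \<Rightarrow> real)"
    by (intro integrable_real_indicator) (simp_all add: fmeasurable_def del: emeasure_completion)
  then show "integrable lebesgue (\<lambda>x. indicator K x *\<^sub>R indicator S x :: real)"
    by (simp add: indicator_inter_arith[symmetric])
qed simp

text \<open>Mollification is self-adjoint, by Fubini and the evenness of the kernel.\<close>

lemma integral_cbox_mol:
  fixes q :: "real^'n::finite \<Rightarrow> real"
  assumes q: "L1_loc q" and \<epsilon>: "\<epsilon> > 0"
  shows "(LINT x|lebesgue. indicator (cbox a b) x * mol \<epsilon> q x) =
         (LINT y|lebesgue. q y * mol \<epsilon> (indicator (cbox a b)) y)"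
proof -
  let ?I = "indicator (cbox a b) :: real^'n \<Rightarrow> real"
  define \<rho> where "\<rho> = (\<lambda>z::real^'n. - 2 * Phi 1 \<epsilon> z)"
  have \<rho>c: "continuous_on UNIV \<rho>" unfolding \<rho>_def by (intro continuous_intros)
  have \<rho>0: "norm z \<ge> \<epsilon> \<Longrightarrow> \<rho> z = 0" for z using \<epsilon> by (simp add: \<rho>_def Phi_eq_0)
  have \<rho>nn: "\<rho> z \<ge> 0" for z using Phi_1_nonpos[OF \<epsilon>, of z] by (simp add: \<rho>_def)
  have \<rho>m[measurable]: "\<rho> \<in> borel_measurable borel" using \<rho>c by (rule borel_measurable_continuous_onI)
  have mol: "mol \<epsilon> g = corr g \<rho>" for g by (simp add: mol_def \<rho>_def)
  \<comment> \<open>Fubini is applied on the product of two Borel measures, so the Lebesgue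
    measurable \<open>q\<close> is first replaced by a Borel function that agrees with it almost
    everywhere.\<close>
  obtain q' where q'm: "q' \<in> borel_measurable lborel" and qq: "AE x in lborel. q x = q' x"
    using completion_ex_borel_measurable_real[OF L1_loc_measurable[OF q]] by blast
  have [measurable]: "q' \<in> borel_measurable borel" using q'm by simp
  have q'ml: "q' \<in> borel_measurable lebesgue" using q'm by (rule measurable_completion)
  have qq': "AE x in lebesgue. q x = q' x" using qq by (rule AE_completion)
  have q': "L1_loc q'"
    unfolding L1_loc_def
  proof (intro conjI allI impI q'ml)
    fix K :: "(real^'n) set" assume "compact K"
    then have "integrable lebesgue (\<lambda>x. indicator K x *\<^sub>R q x)" "K \<in> sets lebesgue"
      using q lmeasurable_compact by (auto simp: L1_loc_def set_integrable_def fmeasurable_def)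
    then show "set_integrable lebesgue K q'"
      unfolding set_integrable_def
      by (subst integrable_cong_AE[of _ _ "\<lambda>x. indicator K x *\<^sub>R q x"])
         (use qq' q'ml L1_loc_measurable[OF q] in auto)
  qed
  have abs_q': "L1_loc (\<lambda>x. \<bar>q' x\<bar>)"
    unfolding L1_loc_def set_integrable_def
  proof (intro conjI allI impI borel_measurable_abs q'ml)
    fix K :: "(real^'n) set" assume "compact K"
    then have "integrable lebesgue (\<lambda>x. \<bar>indicator K x *\<^sub>R q' x\<bar>)"
      using q' unfolding L1_loc_def set_integrable_def by (intro integrable_abs) blast
    then show "integrable lebesgue (\<lambda>x. indicator K x *\<^sub>R \<bar>q' x\<bar>)" by (simp add: abs_mult)
  qed
  have cm: "corr q \<rho> x = corr q' \<rho> x" for x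
    unfolding corr_def
  proof (rule integral_cong_AE)
    show "(\<lambda>y. q y * \<rho> (y - x)) \<in> borel_measurable lebesgue" "(\<lambda>y. q' y * \<rho> (y - x)) \<in> borel_measurable lebesgue"
      by (intro borel_measurable_integrable integrable_corr q q' \<rho>c \<rho>0; assumption)+
  qed (use qq' in auto)
  have Ic: "continuous_on UNIV (corr ?I \<rho>)"
    by (rule continuous_on_corr[OF _ \<rho>c \<rho>0]) (simp_all add: L1_loc_indicator)
  have [measurable]: "corr q' \<rho> \<in> borel_measurable borel" "corr ?I \<rho> \<in> borel_measurable borel"
    using continuous_on_corr[OF q' \<rho>c \<rho>0] Ic by (auto intro: borel_measurable_continuous_onI)
  have corr_lborel: "corr g \<rho> x = (LINT y|lborel. g y * \<rho> (y - x))" if [measurable]: "g \<in> borel_measurable borel" for g x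
    unfolding corr_def by (rule integral_completion) simp
  let ?f = "\<lambda>x y. ?I x * (q' y * \<rho> (y - x))"
  have int: "integrable (lborel \<Otimes>\<^sub>M lborel) (case_prod ?f)"
  proof (rule lborel_pair.Fubini_integrable)
    show "case_prod ?f \<in> borel_measurable (lborel \<Otimes>\<^sub>M lborel)" by measurable
    have "(\<lambda>x. LINT y|lborel. norm (case_prod ?f (x, y))) = (\<lambda>x. ?I x *\<^sub>R corr (\<lambda>x. \<bar>q' x\<bar>) \<rho> x)"
      using \<rho>nn by (subst corr_lborel) (auto simp: abs_mult)
    moreover have "integrable lborel (\<lambda>x. ?I x *\<^sub>R corr (\<lambda>x. \<bar>q' x\<bar>) \<rho> x)"
      by (intro borel_integrable_compact continuous_on_subset[OF continuous_on_corr[OF abs_q' \<rho>c \<rho>0]]) auto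
    ultimately show "integrable lborel (\<lambda>x. LINT y|lborel. norm (case_prod ?f (x, y)))" by simp
    have "integrable lborel (\<lambda>y. q' y * \<rho> (y - x))" for x
      using integrable_corr[OF q' \<rho>c \<rho>0, where x=x] by (subst (asm) integrable_completion) auto
    then show "AE x in lborel. integrable lborel (\<lambda>y. case_prod ?f (x, y))"
      by (intro AE_I2) (simp add: integrable_mult_right)
  qed
  have "(LINT x|lebesgue. ?I x * mol \<epsilon> q x) = (LINT x|lborel. ?I x * corr q' \<rho> x)"
    unfolding mol cm by (rule integral_completion) simp
  also have "\<dots> = (LINT x|lborel. LINT y|lborel. ?f x y)"
    by (subst corr_lborel) simp_all
  also have "\<dots> = (LINT y|lborel. LINT x|lborel. ?f x y)"
    by (rule lborel_pair.Fubini_integral[OF int, symmetric])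
  also have "\<dots> = (LINT y|lborel. q' y * corr ?I \<rho> y)"
  proof (rule Bochner_Integration.integral_cong[OF refl])
    fix y :: "real^'n"
    \<comment> \<open>Evenness of the kernel enters here.\<close>
    have "?f x y = q' y * (?I x * \<rho> (x - y))" for x
      using Phi_minus[of 1 \<epsilon> y x] by (simp add: \<rho>_def)
    then have "(LINT x|lborel. ?f x y) = (LINT x|lborel. q' y * (?I x * \<rho> (x - y)))"
      by (rule Bochner_Integration.integral_cong[OF refl])
    then show "(LINT x|lborel. ?f x y) = q' y * corr ?I \<rho> y"
      by (subst corr_lborel) simp_all
  qed
  also have "\<dots> = (LINT y|lebesgue. q' y * corr ?I \<rho> y)"
    by (rule integral_completion[symmetric]) simp
  also have "\<dots> = (LINT y|lebesgue. q y * corr ?I \<rho> y)"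
  proof (rule integral_cong_AE)
    have "corr ?I \<rho> \<in> borel_measurable lebesgue" by (rule continuous_measurable_lebesgue[OF Ic])
    then show "(\<lambda>y. q' y * corr ?I \<rho> y) \<in> borel_measurable lebesgue" "(\<lambda>y. q y * corr ?I \<rho> y) \<in> borel_measurable lebesgue"
      using q'ml L1_loc_measurable[OF q] by auto
  qed (use qq' in auto)
  finally show ?thesis by (simp add: mol)
qed

text \<open>Lebesgue differentiation along shrinking cubes: off a null set the averages converge to
  D x, while all of them are 0.\<close>

lemma AE_eq_0_if_cbox_integrals:
  fixes D :: "'a::euclidean_space \<Rightarrow> real"
  assumes D: "L1_loc D" and 0: "\<And>a b. (LINT x|lebesgue. indicator (cbox a b) x * D x) = 0"
  shows "AE x in lebesgue. D x = 0"
proof -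
  have set: "set_integrable lebesgue (cbox a b) D" for a b using D by (simp add: L1_loc_def)
  have int0: "integral (cbox a b) D = 0" for a b
    using set_lebesgue_integral_eq_integral(2)[OF set, of a b] 0[of a b] by (simp add: set_lebesgue_integral_def)
  obtain N where N: "negligible N" "\<And>x e. \<lbrakk>x \<notin> N; 0 < e\<rbrakk> \<Longrightarrow>
      \<exists>d>0. \<forall>h. 0 < h \<and> h < d \<longrightarrow> norm (integral (cbox x (x + h *\<^sub>R One)) D /\<^sub>R h ^ DIM('a) - D x) < e"
    using integrable_ccontinuous_explicit[of D] set_lebesgue_integral_eq_integral(1)[OF set] by blast
  have "D x = 0" if "x \<notin> N" for x
  proof (rule ccontr)
    assume "D x \<noteq> 0"
    then have "\<exists>d>0. \<forall>h::real. 0 < h \<and> h < d \<longrightarrow> \<bar>D x\<bar> < \<bar>D x\<bar>"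
      using N(2)[OF that, of "\<bar>D x\<bar>"] by (simp only: int0) simp
    then show False by (meson dense order_less_irrefl)
  qed
  moreover have "AE x in lebesgue. x \<notin> N"
    using N(1) by (intro AE_not_in) (simp add: negligible_iff_null_sets)
  ultimately show ?thesis by auto
qed

text \<open>By self-adjointness the mollifier can sit on the function or on the indicator of a box.
  In the first form the integrals converge to those of \<open>Q\<close>, by locally bounded
  convergence; in the second to those of \<open>q\<close>, because the mollified indicators converge
  off a null set. Equal box integrals then force equality almost everywhere.\<close>

lemma mol_limit_AE:
  fixes q Q :: "real^'n::finite \<Rightarrow> real"
  assumes q: "L1_loc q" and Q: "continuous_on UNIV Q" and e: "\<And>n. e n \<in> {0<..1}" "e \<longlonglongrightarrow> 0"
    and lim: "\<And>x. (\<lambda>n. mol (e n) q x) \<longlonglongrightarrow> Q x"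
    and bound: "\<And>K. compact K \<Longrightarrow> \<exists>B. \<forall>n. \<forall>x\<in>K. \<bar>mol (e n) q x\<bar> \<le> B"
  shows "AE x in lebesgue. q x = Q x"
proof -
  have e0: "e n > 0" "e n \<le> 1" for n using e(1)[of n] by auto
  have QL: "L1_loc Q" using Q by (rule L1_loc_continuous)
  have int: "integrable lebesgue (\<lambda>x. indicator (cbox a b) x * g x)" if "L1_loc g" for a b and g :: "real^'n \<Rightarrow> real"
    using that compact_cbox[of a b] unfolding L1_loc_def set_integrable_def real_scaleR_def by simp
  have "(LINT x|lebesgue. indicator (cbox a b) x * (q x - Q x)) = 0" for a b
  proof -
    let ?I = "indicator (cbox a b) :: real^'n \<Rightarrow> real"
    have IL: "L1_loc ?I" by (intro L1_loc_indicator) simp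
    have mm: "mol (e n) g \<in> borel_measurable lebesgue" if "L1_loc g" for n g
      using e0(1) that by (intro continuous_measurable_lebesgue continuous_on_mol)
    obtain B where B: "\<And>n x. x \<in> cbox a b \<Longrightarrow> \<bar>mol (e n) q x\<bar> \<le> B"
      using bound[OF compact_cbox] by blast
    have 1: "(\<lambda>n. LINT x|lebesgue. ?I x * mol (e n) q x) \<longlonglongrightarrow> (LINT x|lebesgue. ?I x * Q x)"
    proof (rule integral_dominated_convergence)
      show "(\<lambda>x. ?I x * Q x) \<in> borel_measurable lebesgue"
        by (intro borel_measurable_integrable int QL)
      show "(\<lambda>x. ?I x * mol (e n) q x) \<in> borel_measurable lebesgue" for n
        by (intro borel_measurable_times borel_measurable_indicator mm[OF q]) auto
      show "integrable lebesgue (\<lambda>x. B * ?I x)"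
        using int[OF L1_loc_continuous[OF continuous_on_const[of UNIV "1::real"]], of a b] by simp
      show "AE x in lebesgue. norm (?I x * mol (e n) q x) \<le> B * ?I x" for n
        using B by (auto simp: indicator_def)
    qed (auto intro!: AE_I2 tendsto_mult_left lim)
    obtain r where r: "cbox a b \<subseteq> cball 0 r"
      using bounded_cbox[of a b] unfolding bounded_iff by force
    have 2: "(\<lambda>n. LINT y|lebesgue. q y * mol (e n) ?I y) \<longlonglongrightarrow> (LINT y|lebesgue. q y * ?I y)"
    proof (rule integral_dominated_convergence)
      show "(\<lambda>y. q y * ?I y) \<in> borel_measurable lebesgue"
        using int[OF q, of a b] by (simp add: mult.commute borel_measurable_integrable)
      show "(\<lambda>y. q y * mol (e n) ?I y) \<in> borel_measurable lebesgue" for n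
        using mm[OF IL] L1_loc_measurable[OF q] by (intro borel_measurable_times)
      have "set_integrable lebesgue (cball 0 (r + 1)) q" using q by (simp add: L1_loc_def)
      then show "integrable lebesgue (\<lambda>y. \<bar>indicator (cball 0 (r + 1)) y * q y\<bar>)"
        by (auto simp: set_integrable_def)
      \<comment> \<open>An average of an indicator is at most 1, and since the scales are at most 1
        it vanishes at distance more than 1 from the box.\<close>
      have "\<bar>mol (e n) ?I y\<bar> \<le> indicator (cball 0 (r + 1)) y" for n y
      proof (cases "y \<in> cball 0 (r + 1)")
        case True
        then show ?thesis
          using mol_diff_bound[OF e0(1) IL, where c=0 and \<eta>=1] by (simp add: indicator_def)
      next
        case False
        have "z \<notin> cbox a b" if "z \<in> cball y (e n)" for z
          using False that r e0(2)[of n] norm_triangle_ineq2[of y "y - z"] by (force simp: dist_norm)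
        then have "\<bar>mol (e n) ?I y - 0\<bar> \<le> 0"
          by (intro mol_diff_bound e0 IL AE_I2) auto
        then show ?thesis by simp
      qed
      then have "\<bar>q y\<bar> * \<bar>mol (e n) ?I y\<bar> \<le> \<bar>q y\<bar> * indicator (cball 0 (r + 1)) y" for n y
        by (intro mult_left_mono) auto
      then show "AE y in lebesgue. norm (q y * mol (e n) ?I y) \<le> \<bar>indicator (cball 0 (r + 1)) y * q y\<bar>" for n
        by (simp add: abs_mult mult_ac)
      \<comment> \<open>Off its frontier, a null set by convexity of the box, the indicator is
        continuous.\<close>
      have "AE y in lebesgue. y \<notin> frontier (cbox a b)"
        using negligible_convex_frontier[OF convex_box(1)] by (intro AE_not_in) (simp add: negligible_iff_null_sets)
      then show "AE y in lebesgue. (\<lambda>n. q y * mol (e n) ?I y) \<longlonglongrightarrow> q y * ?I y"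
      proof eventually_elim
        case (elim y)
        then show ?case
          by (intro tendsto_mult_left mol_tendsto IL e0 e) (simp add: isCont_indicator)
      qed
    qed
    have "(LINT x|lebesgue. ?I x * Q x) = (LINT y|lebesgue. q y * ?I y)"
      using LIMSEQ_unique[OF 1] 2 integral_cbox_mol[OF q e0(1)] by simp
    then have "(LINT x|lebesgue. ?I x * q x) - (LINT x|lebesgue. ?I x * Q x) = 0"
      by (simp add: mult.commute)
    then show ?thesis
      using Bochner_Integration.integral_diff[OF int[OF q] int[OF QL], of a b a b]
      by (simp add: right_diff_distrib)
  qed
  moreover have "L1_loc (\<lambda>x. q x - Q x)"
    using q QL unfolding L1_loc_def set_integrable_def
    by (auto simp: right_diff_distrib intro!: borel_measurable_diff)
  ultimately have "AE x in lebesgue. q x - Q x = 0" by (intro AE_eq_0_if_cbox_integrals)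
  then show ?thesis by simp
qed

section \<open>Integrals over balls as functions of the radius\<close>

text \<open>Near the sphere of radius \<open>R\<close> the integrand is close to its \<open>0\<close>-homogeneous extension off that
  sphere, whose integrals over balls are exactly proportional to \<open>r ^ n\<close>.\<close>

lemma DERIV_integral_ball_0:
  fixes g :: "'a::euclidean_space \<Rightarrow> real"
  assumes g: "continuous_on UNIV g" and R: "R > 0"
  shows "\<exists>D. ((\<lambda>r. LINT y|lebesgue. indicator (ball 0 r) y * g y) has_real_derivative D) (at R)"
proof -
  let ?n = "DIM('a)"
  let ?I = "\<lambda>r. indicator (ball 0 r) :: 'a \<Rightarrow> real"
  \<comment> \<open>At the origin R / 0 = 0 gives \<open>G 0 = g 0\<close>, so both the bound by
    \<open>B\<close> and the scaling identity hold there too.\<close>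
  define G where "G = (\<lambda>y::'a. g ((R / norm y) *\<^sub>R y))"
  have gm[measurable]: "g \<in> borel_measurable borel" using g by (rule borel_measurable_continuous_onI)
  have Gm[measurable]: "G \<in> borel_measurable borel" unfolding G_def by measurable
  have GmL: "G \<in> borel_measurable lebesgue" using Gm by (intro measurable_completion) simp
  have gmL: "g \<in> borel_measurable lebesgue" using gm by (intro measurable_completion) simp
  have "bounded (g ` cball 0 R)"
    using g by (meson compact_cball compact_continuous_image compact_imp_bounded continuous_on_subset subset_UNIV)
  then obtain B where "\<forall>z\<in>cball 0 R. \<bar>g z\<bar> \<le> B" by (auto simp: bounded_iff)
  then have B: "\<bar>g z\<bar> \<le> B" if "norm z \<le> R" for z using that by simp
  have GB: "\<bar>G y\<bar> \<le> B" for y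
    unfolding G_def using R by (intro B) (simp add: divide_simps)
  have volm: "integrable lebesgue (?I r)" for r
    by (intro integrable_real_indicator) (use lmeasurable_ball[of 0 r] in \<open>simp_all add: fmeasurable_def\<close>)
  have gint: "integrable lebesgue (\<lambda>y. ?I r y * g y)" for r
  proof (rule Bochner_Integration.integrable_bound)
    have "L1_loc g" using g by (rule L1_loc_continuous)
    then show "integrable lebesgue (\<lambda>y. indicator (cball 0 r) y *\<^sub>R g y)"
      by (simp add: L1_loc_def set_integrable_def)
    show "(\<lambda>y. ?I r y * g y) \<in> borel_measurable lebesgue" using gmL by (intro borel_measurable_times borel_measurable_indicator) auto
  qed (auto simp: indicator_def)
  have Gint: "integrable lebesgue (\<lambda>y. ?I r y * G y)" for r
  proof (rule Bochner_Integration.integrable_bound)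
    show "integrable lebesgue (\<lambda>y. B * ?I r y)" using volm by simp
    show "(\<lambda>y. ?I r y * G y) \<in> borel_measurable lebesgue" using GmL by (intro borel_measurable_times borel_measurable_indicator) auto
  qed (use GB in \<open>auto simp: indicator_def intro: order_trans[OF _ abs_ge_self]\<close>)
  \<comment> \<open>The integral of \<open>G\<close> is an exact multiple of r^n, so it remains to
    show that this remainder has derivative 0 at R.\<close>
  define E where "E r = (LINT y|lebesgue. ?I r y * g y) - (LINT y|lebesgue. ?I r y * G y)" for r
  define v where "v = unit_ball_vol ?n"
  have v0: "v > 0" by (simp add: v_def)
  have vol: "(LINT y|lebesgue. ?I r y) = v * r ^ ?n" if "r > 0" for r
    using that by (simp add: content_ball v_def)
  have J: "(LINT y|lebesgue. ?I r y * G y) = (r / R) ^ ?n * (LINT y|lebesgue. ?I R y * G y)" if r: "r > 0" for r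
  proof -
    have "(LINT y|lebesgue. ?I r y * G y) = \<bar>r / R\<bar> ^ ?n * (LINT y|lebesgue. ?I r (0 + (r / R) *\<^sub>R y) * G (0 + (r / R) *\<^sub>R y))"
      using r R Gint by (intro lebesgue_integral_affine) auto
    also have "(\<lambda>y. ?I r (0 + (r / R) *\<^sub>R y) * G (0 + (r / R) *\<^sub>R y)) = (\<lambda>y. ?I R y * G y)"
      using r R by (auto simp: G_def indicator_def field_simps)
    finally show ?thesis using r R by simp
  qed
  have close: "\<exists>d>0. \<forall>r. \<bar>r - R\<bar> < d \<longrightarrow> r > 0 \<longrightarrow> \<bar>E r - E R\<bar> \<le> \<eta> * \<bar>v * r ^ ?n - v * R ^ ?n\<bar>" if \<eta>: "\<eta> > 0" for \<eta>
  proof -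
    have "uniformly_continuous_on (cball 0 (2 * R)) g"
      using g by (intro compact_uniformly_continuous) (auto intro: continuous_on_subset)
    then obtain d where d: "d > 0" "\<And>y z. norm y \<le> 2 * R \<Longrightarrow> norm z \<le> 2 * R \<Longrightarrow> dist y z < d \<Longrightarrow> \<bar>g y - g z\<bar> < \<eta>"
      using \<eta> unfolding uniformly_continuous_on_def by (metis dist_real_def mem_cball_0 dist_commute)
    have near: "\<bar>g y - G y\<bar> \<le> \<eta>" if y: "\<bar>norm y - R\<bar> < min d R" for y
    proof -
      have "norm y > 0" using y by auto
      then have "y - (R / norm y) *\<^sub>R y = ((norm y - R) / norm y) *\<^sub>R y"
        by (simp add: diff_divide_distrib scaleR_diff_left)
      then have "dist y ((R / norm y) *\<^sub>R y) = \<bar>norm y - R\<bar>"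
        using \<open>norm y > 0\<close> by (simp add: dist_norm)
      moreover have "norm ((R / norm y) *\<^sub>R y) = R" using \<open>norm y > 0\<close> R by simp
      ultimately show ?thesis
        unfolding G_def using y R by (intro less_imp_le d(2)) auto
    qed
    have "\<bar>E r - E R\<bar> \<le> \<eta> * \<bar>v * r ^ ?n - v * R ^ ?n\<bar>" if r: "\<bar>r - R\<bar> < min d R" "r > 0" for r
    proof -
      have "E r - E R = (LINT y|lebesgue. (?I r y * g y - ?I r y * G y) - (?I R y * g y - ?I R y * G y))"
        unfolding E_def using gint Gint by simp
      then have "\<bar>E r - E R\<bar> = \<bar>LINT y|lebesgue. (?I r y - ?I R y) * (g y - G y)\<bar>"
        by (simp add: algebra_simps)
      also have "\<dots> \<le> (LINT y|lebesgue. \<bar>(?I r y - ?I R y) * (g y - G y)\<bar>)" by (rule integral_abs_bound)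
      \<comment> \<open>The sign of r - R treats both possible inclusions of the two balls at
        once.\<close>
      also have "\<dots> \<le> (LINT y|lebesgue. \<eta> * (sgn (r - R) * (?I r y - ?I R y)))"
      proof (rule integral_mono)
        have "integrable lebesgue (\<lambda>y. (?I r y * g y - ?I r y * G y) - (?I R y * g y - ?I R y * G y))"
          using gint Gint by (intro Bochner_Integration.integrable_diff)
        then show "integrable lebesgue (\<lambda>y. \<bar>(?I r y - ?I R y) * (g y - G y)\<bar>)"
          by (intro integrable_abs) (simp add: algebra_simps)
        show "integrable lebesgue (\<lambda>y. \<eta> * (sgn (r - R) * (?I r y - ?I R y)))"
          by (intro integrable_mult_right Bochner_Integration.integrable_diff volm)
        fix y :: 'a
        have "\<bar>?I r y - ?I R y\<bar> = sgn (r - R) * (?I r y - ?I R y)"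
          by (auto simp: indicator_def sgn_real_def)
        moreover have "\<bar>?I r y - ?I R y\<bar> * \<bar>g y - G y\<bar> \<le> \<bar>?I r y - ?I R y\<bar> * \<eta>"
        proof (cases "?I r y = ?I R y")
          case False
          then have "\<bar>norm y - R\<bar> \<le> \<bar>r - R\<bar>" by (cases "norm y < r"; cases "norm y < R") (auto simp: indicator_def)
          then show ?thesis using r by (intro mult_left_mono near) auto
        qed simp
        ultimately show "\<bar>(?I r y - ?I R y) * (g y - G y)\<bar> \<le> \<eta> * (sgn (r - R) * (?I r y - ?I R y))"
          by (simp add: abs_mult mult.commute)
      qed
      also have "\<dots> = \<eta> * (sgn (r - R) * (v * r ^ ?n - v * R ^ ?n))"
        using volm vol[OF r(2)] vol[OF R] by simp
      also have "\<dots> = \<eta> * \<bar>v * r ^ ?n - v * R ^ ?n\<bar>"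
      proof -
        have "r ^ ?n \<le> R ^ ?n" if "r \<le> R" using that r by (intro power_mono) auto
        moreover have "R ^ ?n \<le> r ^ ?n" if "R \<le> r" using that R by (intro power_mono) auto
        ultimately have "sgn (r - R) * (v * r ^ ?n - v * R ^ ?n) = \<bar>v * r ^ ?n - v * R ^ ?n\<bar>"
          using v0 by (cases r R rule: linorder_cases) (auto simp: sgn_real_def)
        then show ?thesis by simp
      qed
      finally show ?thesis .
    qed
    then show ?thesis using d R by (intro exI[of _ "min d R"]) auto
  qed
  have "(E has_real_derivative 0) (at R)"
    unfolding has_field_derivative_iff
  proof (rule LIM_I)
    fix \<epsilon> :: real assume \<epsilon>: "\<epsilon> > 0"
    define h' where "h' = v * (?n * R ^ (?n - 1))"
    have "((\<lambda>r. v * r ^ ?n) has_real_derivative h') (at R)"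
      unfolding h'_def by (auto intro!: derivative_eq_intros)
    then have "((\<lambda>r. (v * r ^ ?n - v * R ^ ?n) / (r - R)) \<longlongrightarrow> h') (at R)"
      by (simp add: has_field_derivative_iff)
    then obtain s where s: "s > 0" "\<And>r. r \<noteq> R \<Longrightarrow> \<bar>r - R\<bar> < s \<Longrightarrow> \<bar>(v * r ^ ?n - v * R ^ ?n) / (r - R) - h'\<bar> < 1"
      using LIM_D[of _ h' R 1] by force
    \<comment> \<open>Near R the difference quotients of the volume are at most |h'| + 1 in absolute
      value; the summand 2 makes the final estimate strict.\<close>
    define \<eta> where "\<eta> = \<epsilon> / (\<bar>h'\<bar> + 2)"
    have "\<eta> > 0" using \<epsilon> by (simp add: \<eta>_def add_nonneg_pos)
    from close[OF this] obtain d where d: "d > 0" "\<And>r. \<bar>r - R\<bar> < d \<Longrightarrow> r > 0 \<Longrightarrow> \<bar>E r - E R\<bar> \<le> \<eta> * \<bar>v * r ^ ?n - v * R ^ ?n\<bar>"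
      by blast
    show "\<exists>s>0. \<forall>r. r \<noteq> R \<and> norm (r - R) < s \<longrightarrow> norm ((E r - E R) / (r - R) - 0) < \<epsilon>"
    proof (intro exI[of _ "min s (min d R)"] conjI allI impI)
      fix r assume "r \<noteq> R \<and> norm (r - R) < min s (min d R)"
      then have r: "r \<noteq> R" "\<bar>r - R\<bar> < s" "\<bar>r - R\<bar> < d" "r > 0" by auto
      have "\<bar>(E r - E R) / (r - R)\<bar> \<le> \<eta> * \<bar>(v * r ^ ?n - v * R ^ ?n) / (r - R)\<bar>"
        using d(2)[OF r(3,4)] r(1) by (simp add: abs_divide divide_right_mono)
      also have "\<dots> \<le> \<eta> * (\<bar>h'\<bar> + 1)"
        using s(2)[OF r(1,2)] \<open>\<eta> > 0\<close> by (intro mult_left_mono) linarith+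
      also have "\<dots> < \<epsilon>"
        using \<epsilon> by (simp add: \<eta>_def field_simps add_nonneg_pos)
      finally show "norm ((E r - E R) / (r - R) - 0) < \<epsilon>" by simp
    qed (use s d R in auto)
  qed
  moreover have "((\<lambda>r. (r / R) ^ ?n * (LINT y|lebesgue. ?I R y * G y)) has_real_derivative
      of_nat ?n * (1 / R * (R / R) ^ (?n - Suc 0)) * (LINT y|lebesgue. ?I R y * G y)) (at R)"
    by (intro DERIV_cmult_right DERIV_power) (use R in \<open>auto intro!: derivative_eq_intros\<close>)
  ultimately have "((\<lambda>r. E r + (r / R) ^ ?n * (LINT y|lebesgue. ?I R y * G y)) has_real_derivative
      0 + of_nat ?n * (1 / R * (R / R) ^ (?n - Suc 0)) * (LINT y|lebesgue. ?I R y * G y)) (at R)"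
    by (rule DERIV_add)
  then have "((\<lambda>r. LINT y|lebesgue. ?I r y * g y) has_real_derivative
      0 + of_nat ?n * (1 / R * (R / R) ^ (?n - Suc 0)) * (LINT y|lebesgue. ?I R y * G y)) (at R)"
  proof (rule has_field_derivative_transform_within_open[where S="{0<..}"])
    show "E r + (r / R) ^ ?n * (LINT y|lebesgue. ?I R y * G y) = (LINT y|lebesgue. ?I r y * g y)" if "r \<in> {0<..}" for r
      using that by (simp add: J[symmetric, of r] E_def)
  qed (use R in auto)
  then show ?thesis by blast
qed

lemma DERIV_integral_ball:
  fixes g :: "'a::euclidean_space \<Rightarrow> real"
  assumes g: "continuous_on UNIV g" and R: "R > 0"
  shows "\<exists>D. ((\<lambda>r. LINT y:ball x0 r|lebesgue. g y) has_real_derivative D) (at R)"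
proof -
  have "(LINT y:ball x0 r|lebesgue. g y) = (LINT y|lebesgue. indicator (ball 0 r) y * g (x0 + y))" for r
  proof -
    have "(\<lambda>y. indicator (ball x0 r) y * g y) \<in> borel_measurable lebesgue"
      by (intro borel_measurable_times borel_measurable_indicator continuous_measurable_lebesgue[OF g]) auto
    then have "(LINT y|lebesgue. indicator (ball x0 r) y * g y) =
       (LINT y|lebesgue. indicator (ball x0 r) (x0 + y) * g (x0 + y))"
      using lebesgue_integral_affine[of "\<lambda>y. indicator (ball x0 r) y * g y" 1 x0] by simp
    moreover have "indicator (ball x0 r) (x0 + y) = (indicator (ball 0 r) y :: real)" for y
      by (simp add: indicator_def dist_norm)
    ultimately show ?thesis by (simp add: set_lebesgue_integral_def)
  qed
  moreover have "continuous_on UNIV (\<lambda>y. g (x0 + y))"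
    by (intro continuous_on_compose2[OF g] continuous_intros) auto
  ultimately show ?thesis using DERIV_integral_ball_0[OF _ R] by simp
qed

section \<open>The Pohozaev identity\<close>

lemma DERIV_potential_compose:
  fixes W :: "real^'m::finite \<Rightarrow> real"
  assumes W: "\<And>p. (W has_derivative (\<lambda>h. DW p \<bullet> h)) (at p)"
    and v: "\<And>i. ((\<lambda>t. v i t) has_real_derivative v' i) (at s)"
  shows "((\<lambda>t. W (\<chi> i. v i t)) has_real_derivative (\<Sum>i\<in>UNIV. DW (\<chi> i. v i s) $ i * v' i)) (at s)"
proof -
  have "((\<lambda>t. \<chi> i. v i t) has_derivative (\<lambda>h. \<chi> i. v' i * h)) (at s)"
  proof (subst has_derivative_componentwise_within, intro ballI)
    fix b :: "real^'m" assume "b \<in> Basis"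
    then obtain i where b: "b = axis i 1" by (auto simp: Basis_vec_def)
    show "((\<lambda>t. (\<chi> i. v i t) \<bullet> b) has_derivative (\<lambda>h. (\<chi> i. v' i * h) \<bullet> b)) (at s)"
      using v[of i] by (simp add: b inner_axis has_field_derivative_def)
  qed
  from has_derivative_compose[OF this W]
  have "((\<lambda>t. W (\<chi> i. v i t)) has_derivative (\<lambda>h. DW (\<chi> i. v i s) \<bullet> (\<chi> i. v' i * h))) (at s)" .
  moreover have "(\<lambda>h. DW (\<chi> i. v i s) \<bullet> (\<chi> i. v' i * h)) = (*) (\<Sum>i\<in>UNIV. DW (\<chi> i. v i s) $ i * v' i)"
    by (auto simp: inner_vec_def sum_distrib_right mult.assoc)
  ultimately show ?thesis by (simp add: has_field_derivative_def)
qed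

lemma integrable_continuous_supported:
  fixes k :: "'a::euclidean_space \<Rightarrow> real"
  assumes "continuous_on UNIV k" "\<And>y. norm (y - x0) \<ge> r \<Longrightarrow> k y = 0"
  shows "integrable lebesgue k"
proof -
  have "integrable lebesgue (\<lambda>y. 1 * k y)"
    by (rule integrable_continuous_compact_support[where K="cball x0 r"])
       (auto intro!: L1_loc_continuous continuous_intros assms simp: dist_norm norm_minus_commute)
  then show ?thesis by simp
qed

text \<open>A function of a matrix and a vector, so that one expression serves the mollified fields
  and their limits.\<close>

definition energy_density :: "(real^'m::finite \<Rightarrow> real) \<Rightarrow> real^'n::finite^'m \<Rightarrow> real^'m \<Rightarrow> real" where
  "energy_density W P p = (\<Sum>i\<in>UNIV. \<Sum>j\<in>UNIV. (P $ i $ j)\<^sup>2) / 2 + W p"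

text \<open>The sum over \<open>k\<close> of the vanishing integrals of \<open>\<partial>\<^sub>k F\<^sub>k\<close>, where \<open>F\<^sub>k\<close> is the contraction of the
  stress-energy tensor with the vector field \<open>\<phi>(|x - x0|\<^sup>2) (x - x0)\<close>.\<close>

lemma pohozaev_identity:
  fixes v :: "'m::finite \<Rightarrow> real^'n::finite \<Rightarrow> real" and B :: "'m \<Rightarrow> 'n \<Rightarrow> real^'n \<Rightarrow> real"
    and S :: "'m \<Rightarrow> 'n \<Rightarrow> 'n \<Rightarrow> real^'n \<Rightarrow> real" and W :: "real^'m \<Rightarrow> real" and x0 :: "real^'n"
  assumes dv: "\<And>i j x. ((\<lambda>t. v i (x + t *\<^sub>R axis j 1)) has_real_derivative B i j x) (at 0)"
    and dB: "\<And>i j k x. ((\<lambda>t. B i j (x + t *\<^sub>R axis k 1)) has_real_derivative S i j k x) (at 0)"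
    and sym: "\<And>i j k x. S i j k x = S i k j x"
    and cont: "\<And>i. continuous_on UNIV (v i)" "\<And>i j. continuous_on UNIV (B i j)" "\<And>i j k. continuous_on UNIV (S i j k)"
    and W: "\<And>p. (W has_derivative (\<lambda>h. DW p \<bullet> h)) (at p)" and DW: "continuous_on UNIV DW"
    and \<phi>: "\<And>s. (\<phi> has_real_derivative \<phi>' s) (at s)" and \<phi>': "continuous_on UNIV \<phi>'"
    and \<phi>0: "\<And>s. s \<ge> b \<Longrightarrow> \<phi> s = 0" and \<phi>'0: "\<And>s. s \<ge> b \<Longrightarrow> \<phi>' s = 0" and b: "b \<ge> 0"
  defines "e \<equiv> \<lambda>x. energy_density W (\<chi> i j. B i j x) (\<chi> i. v i x)"
  shows "(LINT x|lebesgue. \<phi> ((norm (x - x0))\<^sup>2) * ((real CARD('n) - 2) * e x + 2 * W (\<chi> i. v i x))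
      + 2 * \<phi>' ((norm (x - x0))\<^sup>2) * ((norm (x - x0))\<^sup>2 * e x - (\<Sum>i\<in>UNIV. (\<Sum>j\<in>UNIV. (x - x0) $ j * B i j x)\<^sup>2)))
    = (LINT x|lebesgue. \<phi> ((norm (x - x0))\<^sup>2) *
      (\<Sum>i\<in>UNIV. (\<Sum>j\<in>UNIV. (x - x0) $ j * B i j x) * ((\<Sum>k\<in>UNIV. S i k k x) - DW (\<chi> i. v i x) $ i)))"
proof -
  define P where "P i x = (\<Sum>j\<in>UNIV. (x - x0) $ j * B i j x)" for i x
  define s where "s x = (norm (x - x0))\<^sup>2" for x
  define F where "F k x = \<phi> (s x) * ((\<Sum>i\<in>UNIV. B i k x * P i x) - e x * (x - x0) $ k)" for k x
  define V where "V x = (\<chi> i. v i x)" for x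
  \<comment> \<open>The isolated terms \<open>B i k x\<close> and \<open>e x\<close> come from the
    k-th derivative of the k-th coordinate, inside \<open>P i\<close> and in the last factor of
    \<open>F\<close>.\<close>
  define F' where "F' k x = \<phi> (s x) * ((\<Sum>i\<in>UNIV. B i k x * (B i k x + (\<Sum>j\<in>UNIV. (x - x0) $ j * S i j k x)) + S i k k x * P i x)
      - (e x + ((\<Sum>i\<in>UNIV. \<Sum>j\<in>UNIV. B i j x * S i j k x) + (\<Sum>i\<in>UNIV. DW (V x) $ i * B i k x)) * (x - x0) $ k))
      + \<phi>' (s x) * (2 * (x - x0) $ k) * ((\<Sum>i\<in>UNIV. B i k x * P i x) - e x * (x - x0) $ k)" for k x
  have c\<phi>: "continuous_on UNIV \<phi>" using \<phi> by (meson DERIV_isCont continuous_at_imp_continuous_on)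
  have cW: "continuous_on UNIV W" using W by (meson has_derivative_continuous continuous_at_imp_continuous_on)
  have cs: "continuous_on UNIV s" unfolding s_def by (intro continuous_intros)
  have cV: "continuous_on UNIV V" unfolding V_def by (intro continuous_intros cont)
  have c\<phi>s: "continuous_on UNIV (\<lambda>x. \<phi> (s x))" "continuous_on UNIV (\<lambda>x. \<phi>' (s x))"
    by (auto intro: continuous_on_compose2[OF c\<phi> cs] continuous_on_compose2[OF \<phi>' cs])
  have ce: "continuous_on UNIV e"
    unfolding e_def energy_density_def V_def[symmetric]
    by (auto intro!: continuous_intros cont continuous_on_compose2[OF cW cV])
  have cP: "continuous_on UNIV (P i)" for i unfolding P_def by (intro continuous_intros cont)
  have cDW: "continuous_on UNIV (\<lambda>x. DW (V x) $ i)" for i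
    by (intro continuous_intros continuous_on_compose2[OF DW cV]) auto
  have cF: "continuous_on UNIV (F k)" for k unfolding F_def by (intro continuous_intros c\<phi>s cont cP ce)
  have cF': "continuous_on UNIV (F' k)" for k unfolding F'_def by (intro continuous_intros c\<phi>s cont cP ce cDW)
  have far: "s x \<ge> b" if "norm (x - x0) \<ge> sqrt b" for x
    using that b by (metis s_def real_sqrt_le_iff real_sqrt_abs abs_norm_cancel)
  have dcoord: "((\<lambda>t. (x + t *\<^sub>R axis k 1 - x0) $ j) has_real_derivative (if j = k then 1 else 0)) (at 0)" for x j k
    by (auto intro!: derivative_eq_intros simp: axis_def)
  have ds: "((\<lambda>t. s (x + t *\<^sub>R axis k 1)) has_real_derivative 2 * (x - x0) $ k) (at 0)" for x k
  proof -
    have "((\<lambda>x. (norm (x - x0))\<^sup>2) has_derivative (\<lambda>h. 2 * ((x - x0) \<bullet> h))) (at x)"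
      unfolding power2_norm_eq_inner by (auto intro!: derivative_eq_intros simp: inner_commute)
    from has_derivative_imp_directional[OF this, of "axis k 1"] show ?thesis by (simp add: s_def inner_axis)
  qed
  have dF: "((\<lambda>t. F k (x + t *\<^sub>R axis k 1)) has_real_derivative F' k x) (at 0)" for k x
  proof -
    let ?x = "\<lambda>t::real. x + t *\<^sub>R axis k 1"
    have dphi: "((\<lambda>t. \<phi> (s (?x t))) has_real_derivative \<phi>' (s x) * (2 * (x - x0) $ k)) (at 0)"
      by (rule DERIV_chain2[OF _ ds]) (use \<phi> in simp)
    have dP: "((\<lambda>t. P i (?x t)) has_real_derivative (\<Sum>j\<in>UNIV. (x - x0) $ j * S i j k x + (if j = k then 1 else 0) * B i j x)) (at 0)" for i
    proof -
      have "((\<lambda>t. \<Sum>j\<in>UNIV. (?x t - x0) $ j * B i j (?x t)) has_real_derivative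
         (\<Sum>j\<in>UNIV. (?x 0 - x0) $ j * S i j k x + (if j = k then 1 else 0) * B i j (?x 0))) (at 0)"
        by (intro DERIV_sum DERIV_mult' dcoord dB)
      then show ?thesis by (simp add: P_def[abs_def])
    qed
    have P': "(\<Sum>j\<in>UNIV. (x - x0) $ j * S i j k x + (if j = k then 1 else 0) * B i j x) = B i k x + (\<Sum>j\<in>UNIV. (x - x0) $ j * S i j k x)" for i
      by (simp add: sum.distrib if_distrib[of "\<lambda>a. a * _"] cong: if_cong)
    have de: "((\<lambda>t. e (?x t)) has_real_derivative
        (\<Sum>i\<in>UNIV. \<Sum>j\<in>UNIV. B i j x * S i j k x) + (\<Sum>i\<in>UNIV. DW (V x) $ i * B i k x)) (at 0)"
    proof -
      have "((\<lambda>t. (\<Sum>i\<in>UNIV. \<Sum>j\<in>UNIV. (B i j (?x t))\<^sup>2) / 2 + W (\<chi> i. v i (?x t))) has_real_derivative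
         (\<Sum>i\<in>UNIV. \<Sum>j\<in>UNIV. 2 * B i j (?x 0) * S i j k x) / 2 + (\<Sum>i\<in>UNIV. DW (\<chi> i. v i (?x 0)) $ i * B i k x)) (at 0)"
      proof (intro DERIV_add DERIV_cdivide DERIV_sum DERIV_potential_compose W dv)
        show "((\<lambda>t. (B i j (?x t))\<^sup>2) has_real_derivative 2 * B i j (?x 0) * S i j k x) (at 0)" for i j
          by (rule derivative_eq_intros dB refl | simp)+
      qed
      then show ?thesis
        by (simp add: e_def energy_density_def V_def sum_distrib_left[symmetric] mult.assoc)
    qed
    have "((\<lambda>t. F k (?x t)) has_real_derivative
       \<phi> (s (?x 0)) * ((\<Sum>i\<in>UNIV. B i k (?x 0) * (B i k x + (\<Sum>j\<in>UNIV. (x - x0) $ j * S i j k x)) + S i k k x * P i (?x 0))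
         - (e (?x 0) * (if k = k then 1 else 0) + ((\<Sum>i\<in>UNIV. \<Sum>j\<in>UNIV. B i j x * S i j k x) + (\<Sum>i\<in>UNIV. DW (V x) $ i * B i k x)) * (?x 0 - x0) $ k))
       + \<phi>' (s x) * (2 * (x - x0) $ k) * ((\<Sum>i\<in>UNIV. B i k (?x 0) * P i (?x 0)) - e (?x 0) * (?x 0 - x0) $ k)) (at 0)"
      unfolding F_def by (intro DERIV_mult' DERIV_diff DERIV_sum dphi dP[unfolded P'] de dB dcoord)
    then show ?thesis by (simp add: F'_def)
  qed
  have intF': "integrable lebesgue (F' k)" for k
    by (rule integrable_continuous_supported[OF cF', where ?x0.0=x0 and r="sqrt b"]) (simp add: F'_def \<phi>0 \<phi>'0 far)
  have "(LINT x|lebesgue. F' k x) = 0" for k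
    by (rule integral_partial_eq_0[OF dF cF cF', where ?x0.0=x0 and r="sqrt b"]) (simp add: F_def \<phi>0 far)
  then have zero: "(LINT x|lebesgue. (\<Sum>k\<in>UNIV. F' k x)) = 0"
    by (simp add: Bochner_Integration.integral_sum intF')
  let ?R = "\<lambda>x. \<phi> (s x) * (\<Sum>i\<in>UNIV. P i x * ((\<Sum>k\<in>UNIV. S i k k x) - DW (V x) $ i))"
  let ?L = "\<lambda>x. \<phi> (s x) * ((real CARD('n) - 2) * e x + 2 * W (V x)) + 2 * \<phi>' (s x) * (s x * e x - (\<Sum>i\<in>UNIV. (P i x)\<^sup>2))"
  have intR: "integrable lebesgue ?R"
    by (rule integrable_continuous_supported[where ?x0.0=x0 and r="sqrt b"])
       (auto intro!: continuous_intros c\<phi>s cont cP cDW simp: \<phi>0 far)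
  have alg: "?L x = ?R x - (\<Sum>k\<in>UNIV. F' k x)" for x
  proof -
    let ?y = "\<lambda>k. (x - x0) $ k"
    have a1: "(\<Sum>k\<in>UNIV. ?y k * (\<Sum>i\<in>UNIV. B i k x * P i x)) = (\<Sum>i\<in>UNIV. (P i x)\<^sup>2)"
    proof -
      have "(\<Sum>k\<in>UNIV. ?y k * (\<Sum>i\<in>UNIV. B i k x * P i x)) = (\<Sum>k\<in>UNIV. \<Sum>i\<in>UNIV. ?y k * B i k x * P i x)"
        by (simp add: sum_distrib_left mult.assoc)
      also have "\<dots> = (\<Sum>i\<in>UNIV. \<Sum>k\<in>UNIV. ?y k * B i k x * P i x)" by (rule sum.swap)
      also have "\<dots> = (\<Sum>i\<in>UNIV. P i x * P i x)"
        by (simp only: sum_distrib_right[symmetric]) (simp only: P_def)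
      finally show ?thesis by (simp add: power2_eq_square)
    qed
    have a2: "(\<Sum>k\<in>UNIV. ?y k * ?y k) = s x"
      unfolding s_def norm_sq_sum by (simp only: power2_eq_square)
    \<comment> \<open>Set against n e, the contribution of the divergence of y, this produces the
      coefficient n - 2 and the extra 2 W.\<close>
    have a3: "(\<Sum>k\<in>UNIV. \<Sum>i\<in>UNIV. B i k x * B i k x) = 2 * e x - 2 * W (V x)"
      by (subst sum.swap) (simp add: e_def energy_density_def V_def power2_eq_square)
    \<comment> \<open>By symmetry of the second derivatives these terms cancel those from the
      gradient of |grad v|^2 / 2, so second derivatives survive only through the Laplacian.\<close>
    have a4: "(\<Sum>k\<in>UNIV. \<Sum>i\<in>UNIV. B i k x * (\<Sum>j\<in>UNIV. ?y j * S i j k x)) =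
        (\<Sum>k\<in>UNIV. (\<Sum>i\<in>UNIV. \<Sum>j\<in>UNIV. B i j x * S i j k x) * ?y k)"
    proof -
      have "(\<Sum>k\<in>UNIV. \<Sum>i\<in>UNIV. B i k x * (\<Sum>j\<in>UNIV. ?y j * S i j k x)) =
          (\<Sum>k\<in>UNIV. \<Sum>i\<in>UNIV. \<Sum>j\<in>UNIV. B i k x * (?y j * S i j k x))"
        by (simp only: sum_distrib_left)
      also have "\<dots> = (\<Sum>i\<in>UNIV. \<Sum>k\<in>UNIV. \<Sum>j\<in>UNIV. B i k x * (?y j * S i j k x))" by (rule sum.swap)
      also have "\<dots> = (\<Sum>i\<in>UNIV. \<Sum>j\<in>UNIV. \<Sum>k\<in>UNIV. B i k x * (?y j * S i j k x))"
        by (intro sum.cong refl sum.swap)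
      also have "\<dots> = (\<Sum>j\<in>UNIV. \<Sum>i\<in>UNIV. \<Sum>k\<in>UNIV. B i k x * (?y j * S i j k x))" by (rule sum.swap)
      also have "\<dots> = (\<Sum>j\<in>UNIV. \<Sum>i\<in>UNIV. \<Sum>k\<in>UNIV. B i k x * S i k j x * ?y j)"
        by (intro sum.cong refl) (simp add: sym mult_ac)
      finally show ?thesis by (simp only: sum_distrib_right)
    qed
    have a5: "(\<Sum>k\<in>UNIV. \<Sum>i\<in>UNIV. S i k k x * P i x) = (\<Sum>i\<in>UNIV. P i x * (\<Sum>k\<in>UNIV. S i k k x))"
      by (subst sum.swap) (simp add: sum_distrib_left mult.commute)
    have a6: "(\<Sum>k\<in>UNIV. (\<Sum>i\<in>UNIV. DW (V x) $ i * B i k x) * ?y k) = (\<Sum>i\<in>UNIV. P i x * DW (V x) $ i)"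
      unfolding sum_distrib_right by (subst sum.swap) (simp add: P_def sum_distrib_right sum_distrib_left mult_ac)
    have "(\<Sum>k\<in>UNIV. F' k x) = \<phi> (s x) * (((\<Sum>k\<in>UNIV. \<Sum>i\<in>UNIV. B i k x * B i k x)
         + (\<Sum>k\<in>UNIV. \<Sum>i\<in>UNIV. B i k x * (\<Sum>j\<in>UNIV. ?y j * S i j k x)) + (\<Sum>k\<in>UNIV. \<Sum>i\<in>UNIV. S i k k x * P i x))
         - (real CARD('n) * e x + ((\<Sum>k\<in>UNIV. (\<Sum>i\<in>UNIV. \<Sum>j\<in>UNIV. B i j x * S i j k x) * ?y k)
             + (\<Sum>k\<in>UNIV. (\<Sum>i\<in>UNIV. DW (V x) $ i * B i k x) * ?y k))))
         + 2 * \<phi>' (s x) * ((\<Sum>k\<in>UNIV. ?y k * (\<Sum>i\<in>UNIV. B i k x * P i x)) - e x * (\<Sum>k\<in>UNIV. ?y k * ?y k))"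
      (is "_ = ?rhs")
    proof -
      have "(\<Sum>k\<in>UNIV. F' k x) = (\<Sum>k\<in>UNIV. \<phi> (s x) * (((\<Sum>i\<in>UNIV. B i k x * B i k x)
         + (\<Sum>i\<in>UNIV. B i k x * (\<Sum>j\<in>UNIV. ?y j * S i j k x)) + (\<Sum>i\<in>UNIV. S i k k x * P i x))
         - (e x + ((\<Sum>i\<in>UNIV. \<Sum>j\<in>UNIV. B i j x * S i j k x) * ?y k + (\<Sum>i\<in>UNIV. DW (V x) $ i * B i k x) * ?y k)))
         + 2 * \<phi>' (s x) * (?y k * (\<Sum>i\<in>UNIV. B i k x * P i x) - e x * (?y k * ?y k)))"
        unfolding F'_def by (intro sum.cong refl) (simp only: sum.distrib distrib_left distrib_right right_diff_distrib mult_ac)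
      also have "\<dots> = ?rhs"
        by (simp only: sum.distrib sum_subtractf sum_distrib_left[symmetric] sum_constant)
      finally show ?thesis .
    qed
    then show ?thesis
      unfolding a1 a2 a3 a4 a5 a6 right_diff_distrib sum_subtractf by (simp add: algebra_simps)
  qed
  have "(LINT x|lebesgue. ?L x) = (LINT x|lebesgue. ?R x) - (LINT x|lebesgue. (\<Sum>k\<in>UNIV. F' k x))"
    unfolding alg using intR intF' by (intro Bochner_Integration.integral_diff Bochner_Integration.integrable_sum)
  with zero show ?thesis by (simp add: s_def P_def V_def)
qed

section \<open>Regularity of bounded weak solutions\<close>

text \<open>A Lipschitz bound in the scale, uniform on balls, makes the family uniformly Cauchy
  there as the scale tends to 0, so the limit inherits continuity.\<close>

lemma Lipschitz_family_limit:
  fixes h :: "real \<Rightarrow> 'a::euclidean_space \<Rightarrow> real"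
  assumes cont: "\<And>\<epsilon>. \<epsilon> > 0 \<Longrightarrow> continuous_on UNIV (h \<epsilon>)"
    and lip: "\<And>r. \<exists>L\<ge>0. \<forall>x\<in>cball 0 r. \<forall>\<epsilon>\<in>{0<..1}. \<forall>\<delta>\<in>{0<..1}. \<bar>h \<epsilon> x - h \<delta> x\<bar> \<le> L * \<bar>\<epsilon> - \<delta>\<bar>"
    and e: "\<And>n. e n \<in> {0<..1}" "e \<longlonglongrightarrow> 0"
  obtains H where "continuous_on UNIV H" "\<And>x. (\<lambda>n. h (e n) x) \<longlonglongrightarrow> H x"
    "\<And>K. compact K \<Longrightarrow> \<exists>B. \<forall>n. \<forall>x\<in>K. \<bar>h (e n) x\<bar> \<le> B"
proof -
  have e0: "e n > 0" "e n \<le> 1" for n using e(1)[of n] by auto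
  have unif: "uniformly_convergent_on (cball 0 r) (\<lambda>n x. h (e n) x)" for r
  proof -
    obtain L where L: "L \<ge> 0" "\<And>x \<epsilon> \<delta>. x \<in> cball 0 r \<Longrightarrow> \<epsilon> \<in> {0<..1} \<Longrightarrow> \<delta> \<in> {0<..1} \<Longrightarrow> \<bar>h \<epsilon> x - h \<delta> x\<bar> \<le> L * \<bar>\<epsilon> - \<delta>\<bar>"
      using lip[of r] by blast
    have "uniformly_Cauchy_on (cball 0 r) (\<lambda>n x. h (e n) x)"
    proof (rule uniformly_Cauchy_onI)
      fix \<eta> :: real assume \<eta>: "\<eta> > 0"
      have "Cauchy e" using e(2) by (rule LIMSEQ_imp_Cauchy)
      \<comment> \<open>\<open>L + 1\<close> keeps the divisor positive when
        \<open>L = 0\<close>.\<close>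
      then obtain M where M: "\<And>m n. m \<ge> M \<Longrightarrow> n \<ge> M \<Longrightarrow> \<bar>e m - e n\<bar> < \<eta> / (L + 1)"
        using \<eta> L(1) unfolding Cauchy_def dist_real_def by (meson divide_pos_pos add_nonneg_pos zero_less_one)
      have "dist (h (e m) x) (h (e n) x) < \<eta>" if "x \<in> cball 0 r" "m \<ge> M" "n \<ge> M" for x m n
      proof -
        have "\<bar>h (e m) x - h (e n) x\<bar> \<le> L * \<bar>e m - e n\<bar>" by (intro L that e)
        also have "\<dots> \<le> (L + 1) * \<bar>e m - e n\<bar>" by (simp add: mult_right_mono)
        also have "\<dots> < \<eta>" using M[OF that(2,3)] L(1) by (simp add: field_simps)
        finally show ?thesis by (simp add: dist_real_def)
      qed
      then show "\<exists>M. \<forall>x\<in>cball 0 r. \<forall>m\<ge>M. \<forall>n\<ge>M. dist (h (e m) x) (h (e n) x) < \<eta>" by blast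
    qed
    then show ?thesis by (rule Cauchy_uniformly_convergent)
  qed
  define H where "H x = lim (\<lambda>n. h (e n) x)" for x
  have UL: "uniform_limit (cball 0 r) (\<lambda>n x. h (e n) x) H sequentially" for r
    using unif[of r] unfolding uniformly_convergent_uniform_limit_iff H_def .
  have Hc: "continuous_on (cball 0 r) H" for r
    by (rule uniform_limit_theorem[OF _ UL])
       (auto intro!: always_eventually continuous_on_subset[OF cont] e0)
  have "continuous_on (ball 0 r) H" for r
    using continuous_on_subset[OF Hc ball_subset_cball] .
  then have "isCont H x" for x
    by (metis centre_in_ball continuous_on_eq_continuous_at dist_0_norm gt_ex mem_ball open_ball)
  moreover have "(\<lambda>n. h (e n) x) \<longlonglongrightarrow> H x" for x
    by (rule tendsto_uniform_limitI[OF UL[of "norm x"]]) simp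
  moreover have "\<exists>B. \<forall>n. \<forall>x\<in>K. \<bar>h (e n) x\<bar> \<le> B" if K: "compact K" for K
  proof -
    obtain r where r: "K \<subseteq> cball 0 r"
      using compact_imp_bounded[OF K] unfolding bounded_iff by force
    obtain L where L: "L \<ge> 0" "\<And>x \<epsilon> \<delta>. x \<in> cball 0 r \<Longrightarrow> \<epsilon> \<in> {0<..1} \<Longrightarrow> \<delta> \<in> {0<..1} \<Longrightarrow> \<bar>h \<epsilon> x - h \<delta> x\<bar> \<le> L * \<bar>\<epsilon> - \<delta>\<bar>"
      using lip[of r] by blast
    \<comment> \<open>Scale 1 is the reference: it is continuous and hence bounded on
      \<open>K\<close>, and every other scale in (0,1] differs from it by at most
      \<open>L\<close>.\<close>
    have "bounded (h 1 ` K)"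
      using K cont[of 1] by (intro compact_imp_bounded compact_continuous_image) (auto intro: continuous_on_subset)
    then obtain B where B: "\<forall>x\<in>K. \<bar>h 1 x\<bar> \<le> B" by (auto simp: bounded_iff)
    have "\<bar>h (e n) x\<bar> \<le> B + L" if "x \<in> K" for n x
    proof -
      have "\<bar>h (e n) x - h 1 x\<bar> \<le> L * \<bar>e n - 1\<bar>" using r that by (intro L e) auto
      also have "\<dots> \<le> L * 1" using e0[of n] L(1) by (intro mult_left_mono) auto
      finally show ?thesis using B that by force
    qed
    then show ?thesis by blast
  qed
  ultimately show thesis using that[of H] by (simp add: continuous_at_imp_continuous_on)
qed

lemma L1_loc_bounded:
  fixes f :: "'a::euclidean_space \<Rightarrow> real"
  assumes "f \<in> borel_measurable lebesgue"
    and "\<And>K. compact K \<Longrightarrow> \<exists>M. AE x in lebesgue. x \<in> K \<longrightarrow> \<bar>f x\<bar> \<le> M"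
  shows "L1_loc f"
  unfolding L1_loc_def set_integrable_def
proof (intro conjI allI impI assms(1))
  fix K :: "'a set" assume K: "compact K"
  then obtain M where M: "AE x in lebesgue. x \<in> K \<longrightarrow> \<bar>f x\<bar> \<le> M" using assms(2) by blast
  have Km: "K \<in> lmeasurable" using K by (rule lmeasurable_compact)
  show "integrable lebesgue (\<lambda>x. indicator K x *\<^sub>R f x)"
  proof (rule Bochner_Integration.integrable_bound)
    show "integrable lebesgue (\<lambda>x. M * indicator K x)"
      using Km by (intro integrable_mult_right integrable_real_indicator) (simp_all add: fmeasurable_def del: emeasure_completion)
    show "(\<lambda>x. indicator K x *\<^sub>R f x) \<in> borel_measurable lebesgue"
      using Km assms(1) by (intro borel_measurable_scaleR borel_measurable_indicator) (auto simp: fmeasurable_def)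
    show "AE x in lebesgue. norm (indicator K x *\<^sub>R f x) \<le> norm (M * indicator K x)"
      using M by eventually_elim (auto simp: indicator_def)
  qed
qed

lemma L1_loc_component:
  fixes f :: "'a::euclidean_space \<Rightarrow> ('b::euclidean_space)^'m::finite"
  assumes "L1_loc f"
  shows "L1_loc (\<lambda>x. f x $ i)"
proof -
  have "(\<lambda>x. f x $ i) \<in> borel_measurable lebesgue"
    using L1_loc_def[of f] assms by (auto intro!: borel_measurable_continuous_on[of "\<lambda>v. v $ i"] continuous_intros)
  moreover have "set_integrable lebesgue K (\<lambda>x. f x $ i)" if "compact K" for K
  proof -
    have "integrable lebesgue (\<lambda>x. indicator K x *\<^sub>R f x)"
      using assms that by (simp add: L1_loc_def set_integrable_def)
    from integrable_bounded_linear[OF bounded_linear_vec_nth this, of i]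
    show ?thesis by (simp add: set_integrable_def)
  qed
  ultimately show ?thesis by (simp add: L1_loc_def)
qed

text \<open>On the ball supporting the integrand the field values stay in a compact set, where
  \<Psi> is bounded; pointwise convergence of the fields then suffices by dominated
  convergence.\<close>

lemma integral_parametrized_tendsto:
  fixes \<Psi> :: "'a::euclidean_space \<Rightarrow> 'b::euclidean_space \<Rightarrow> real"
  assumes \<Psi>: "continuous_on UNIV (\<lambda>(x, p). \<Psi> x p)" and supp: "\<And>x p. norm (x - x0) \<ge> r \<Longrightarrow> \<Psi> x p = 0"
    and V: "\<And>n. continuous_on UNIV (V n)" "\<And>x. (\<lambda>n. V n x) \<longlonglongrightarrow> V' x" "continuous_on UNIV V'"
    and B: "\<And>n x. x \<in> cball x0 r \<Longrightarrow> norm (V n x) \<le> B"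
  shows "(\<lambda>n. LINT x|lebesgue. \<Psi> x (V n x)) \<longlonglongrightarrow> (LINT x|lebesgue. \<Psi> x (V' x))"
proof -
  have "bounded ((\<lambda>(x, p). \<Psi> x p) ` (cball x0 r \<times> cball 0 B))"
    by (intro compact_imp_bounded compact_continuous_image continuous_on_subset[OF \<Psi>] compact_Times) auto
  then obtain C where C: "\<And>x p. x \<in> cball x0 r \<Longrightarrow> norm p \<le> B \<Longrightarrow> \<bar>\<Psi> x p\<bar> \<le> C"
    unfolding bounded_iff by force
  have cont: "continuous_on UNIV (\<lambda>x. \<Psi> x (g x))" if "continuous_on UNIV g" for g
    using continuous_on_compose2[OF \<Psi>, of UNIV "\<lambda>x. (x, g x)"] that
    by (auto simp: continuous_on_Pair continuous_on_id)
  show ?thesis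
  proof (rule integral_dominated_convergence)
    show "(\<lambda>x. \<Psi> x (V' x)) \<in> borel_measurable lebesgue" "(\<lambda>x. \<Psi> x (V n x)) \<in> borel_measurable lebesgue" for n
      by (intro continuous_measurable_lebesgue cont V)+
    show "integrable lebesgue (\<lambda>x. C * indicator (cball x0 r) x)"
      using lmeasurable_cball[of x0 r]
      by (intro integrable_mult_right integrable_real_indicator) (simp_all add: fmeasurable_def del: emeasure_completion)
    have "\<bar>\<Psi> x (V n x)\<bar> \<le> C * indicator (cball x0 r) x" for n x
    proof (cases "x \<in> cball x0 r")
      case True
      then show ?thesis using C[OF True B[OF True]] by simp
    next
      case False
      then show ?thesis using supp[of x] by (simp add: dist_norm norm_minus_commute)
    qed
    then show "AE x in lebesgue. norm (\<Psi> x (V n x)) \<le> C * indicator (cball x0 r) x" for n by simp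
    have "(\<lambda>n. \<Psi> x (V n x)) \<longlonglongrightarrow> \<Psi> x (V' x)" for x
      using continuous_on_tendsto_compose[OF \<Psi>, of "\<lambda>n. (x, V n x)" "(x, V' x)"] V(2)[of x]
      by (simp add: tendsto_Pair)
    then show "AE x in lebesgue. (\<lambda>n. \<Psi> x (V n x)) \<longlonglongrightarrow> \<Psi> x (V' x)" by simp
  qed
qed

lemma norm_vec_le:
  fixes x :: "'a::real_normed_vector^'m::finite"
  assumes "\<And>i. norm (x $ i) \<le> b"
  shows "norm x \<le> real CARD('m) * b"
proof -
  have "norm x \<le> (\<Sum>i\<in>UNIV. norm (x $ i))" unfolding norm_vec_def by (rule L2_set_le_sum) simp
  also have "\<dots> \<le> (\<Sum>i\<in>(UNIV::'m set). b)" by (intro sum_mono assms)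
  finally show ?thesis by simp
qed

text \<open>The mollified components have Laplacian \<open>mol (f i)\<close>, so the right side of
  \<open>pohozaev_identity\<close> contains the defect between \<open>mol (f i)\<close> and the
  gradient of W at the mollified field. Both tend to the gradient of W at the continuous
  representative, so only the left side survives in the limit.\<close>

lemma pohozaev_weak_solution:
  fixes W :: "real^'m::finite \<Rightarrow> real" and u :: "real^'n::finite \<Rightarrow> real^'m"
  assumes W: "\<And>p. (W has_derivative (\<lambda>h. gradient W p \<bullet> h)) (at p)" and DW: "continuous_on UNIV (gradient W)"
    and G: "has_weak_gradient u G" and bdd: "Linf_loc u" and sol: "weak_solution W u"
  obtains U D where "continuous_on UNIV U" "continuous_on UNIV D"
    "AE x in lebesgue. u x = U x" "AE x in lebesgue. G x = D x"
    "\<And>\<phi> \<phi>' b x0. \<lbrakk>\<And>s. (\<phi> has_real_derivative \<phi>' s) (at s); continuous_on UNIV \<phi>';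
        \<And>s. s \<ge> b \<Longrightarrow> \<phi> s = 0; \<And>s. s \<ge> b \<Longrightarrow> \<phi>' s = 0; b \<ge> 0\<rbrakk> \<Longrightarrow>
      (LINT x|lebesgue. \<phi> ((norm (x - x0))\<^sup>2) * ((real CARD('n) - 2) * energy_density W (D x) (U x) + 2 * W (U x))
        + 2 * \<phi>' ((norm (x - x0))\<^sup>2) * ((norm (x - x0))\<^sup>2 * energy_density W (D x) (U x)
            - (\<Sum>i\<in>UNIV. (\<Sum>j\<in>UNIV. (x - x0) $ j * D x $ i $ j)\<^sup>2))) = 0"
proof -
  define q where "q i x = u x $ i" for i x
  define f where "f i x = gradient W (u x) $ i" for i x
  define g where "g i j x = G x $ i $ j" for i j x
  define e where "e n = inverse (real (Suc n))" for n
  have e: "e n \<in> {0<..1}" for n by (simp add: e_def field_simps)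
  have e0: "e n > 0" "e n \<le> 1" for n using e[of n] by auto
  have elim: "e \<longlonglongrightarrow> 0" unfolding e_def by (rule LIMSEQ_inverse_real_of_nat)
  have q: "L1_loc (q i)" and g: "L1_loc (g i j)" for i j
    using G unfolding has_weak_gradient_def q_def[abs_def] g_def[abs_def] by (auto intro!: L1_loc_component)
  have um: "u \<in> borel_measurable lebesgue" using bdd by (simp add: Linf_loc_def)
  have fm: "f i \<in> borel_measurable lebesgue" for i
    unfolding f_def
    by (rule borel_measurable_continuous_on[OF _ um]) (intro continuous_intros DW)
  \<comment> \<open>Almost everywhere on \<open>K\<close> the values of \<open>u\<close> lie in a
    closed ball, on which the continuous gradient of W is bounded.\<close>
  have fb: "\<exists>M\<ge>0. \<forall>i. AE x in lebesgue. x \<in> K \<longrightarrow> \<bar>f i x\<bar> \<le> M" if "compact K" for K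
  proof -
    have "\<exists>M. AE x in lebesgue. x \<in> K \<longrightarrow> norm (u x) \<le> M"
      using bdd that by (simp add: Linf_loc_def)
    then obtain M where M: "AE x in lebesgue. x \<in> K \<longrightarrow> norm (u x) \<le> M" ..
    have "bounded (gradient W ` cball 0 M)"
      using DW by (intro compact_imp_bounded compact_continuous_image) (auto intro: continuous_on_subset)
    then obtain C where C: "\<forall>p\<in>cball 0 M. norm (gradient W p) \<le> C" unfolding bounded_iff by auto
    have "AE x in lebesgue. x \<in> K \<longrightarrow> \<bar>f i x\<bar> \<le> \<bar>C\<bar>" for i
      using M
    proof eventually_elim
      case (elim x)
      have "norm (u x) \<le> M \<Longrightarrow> \<bar>f i x\<bar> \<le> C"
        using C component_le_norm_cart[of "gradient W (u x)" i] by (force simp: f_def)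
      with elim show ?case by linarith
    qed
    then show ?thesis by (intro exI[of _ "\<bar>C\<bar>"]) simp
  qed
  have f: "L1_loc (f i)" for i using fb by (intro L1_loc_bounded[OF fm]) blast
  have weak: "(LINT y|lebesgue. q i y * laplacian \<phi> y) = (LINT y|lebesgue. f i y * \<phi> y)" if "test_function \<phi>" for \<phi> i
    using sol that by (simp add: weak_solution_def q_def f_def)
  have lip: "\<exists>L\<ge>0. \<forall>x\<in>cball 0 r. \<forall>\<epsilon>\<in>{0<..1}. \<forall>\<delta>\<in>{0<..1}. \<bar>mol \<epsilon> (q i) x - mol \<delta> (q i) x\<bar> \<le> L * \<bar>\<epsilon> - \<delta>\<bar> \<and>
      (\<forall>j. \<bar>molD j \<epsilon> (q i) x - molD j \<delta> (q i) x\<bar> \<le> L * \<bar>\<epsilon> - \<delta>\<bar>)" for r i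
  proof -
    \<comment> \<open>The radius grows by 1 because kernels of scale at most 1 see
      \<open>f i\<close> in the unit ball around x.\<close>
    obtain M where M: "M \<ge> 0" "AE x in lebesgue. x \<in> cball 0 (r + 1) \<longrightarrow> \<bar>f i x\<bar> \<le> M"
      using fb[OF compact_cball] by blast
    have M': "AE y in lebesgue. y \<in> cball x 1 \<longrightarrow> \<bar>f i y\<bar> \<le> M" if "x \<in> cball 0 r" for x
      using M(2)
    proof eventually_elim
      case (elim y)
      have "norm y \<le> r + 1" if "norm (x - y) \<le> 1"
        using that \<open>x \<in> cball 0 r\<close> norm_triangle_ineq2[of y x] by (simp add: norm_minus_commute)
      with elim show ?case by (simp add: dist_norm)
    qed
    obtain C where C: "C \<ge> 0" "\<forall>x M. (AE y in lebesgue. y \<in> cball x 1 \<longrightarrow> \<bar>f i y\<bar> \<le> M) \<longrightarrow>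
     (\<forall>\<epsilon>\<in>{0<..1}. \<forall>\<delta>\<in>{0<..1}. \<bar>mol \<epsilon> (q i) x - mol \<delta> (q i) x\<bar> \<le> C * \<bar>M\<bar> * \<bar>\<epsilon> - \<delta>\<bar> \<and>
        (\<forall>j. \<bar>molD j \<epsilon> (q i) x - molD j \<delta> (q i) x\<bar> \<le> C * \<bar>M\<bar> * \<bar>\<epsilon> - \<delta>\<bar>))"
      using mol_Lipschitz_scale[OF q f weak, of i] by blast
    show ?thesis using C M' by (intro exI[of _ "C * \<bar>M\<bar>"]) (simp only: mult_nonneg_nonneg abs_ge_zero, blast)
  qed
  \<comment> \<open>Bundles the three conclusions of \<open>Lipschitz_family_limit\<close> into one
    predicate, from which \<open>choice\<close> can select limits for all indices.\<close>
  define loc_unif_limit where "loc_unif_limit h H \<longleftrightarrow> continuous_on UNIV H \<and> (\<forall>x. (\<lambda>n. h (e n) x) \<longlonglongrightarrow> H x) \<and>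
      (\<forall>K. compact K \<longrightarrow> (\<exists>B. \<forall>n. \<forall>x\<in>K. \<bar>h (e n) x\<bar> \<le> B))"
    for h :: "real \<Rightarrow> real^'n \<Rightarrow> real" and H
  have "\<exists>H. loc_unif_limit (\<lambda>\<epsilon>. mol \<epsilon> (q i)) H" for i
    unfolding loc_unif_limit_def
  proof (rule Lipschitz_family_limit[where h="\<lambda>\<epsilon>. mol \<epsilon> (q i)" and e=e])
    show "continuous_on UNIV (mol \<epsilon> (q i))" if "\<epsilon> > 0" for \<epsilon> using that q by (rule continuous_on_mol)
    show "\<exists>L\<ge>0. \<forall>x\<in>cball 0 r. \<forall>\<epsilon>\<in>{0<..1}. \<forall>\<delta>\<in>{0<..1}. \<bar>mol \<epsilon> (q i) x - mol \<delta> (q i) x\<bar> \<le> L * \<bar>\<epsilon> - \<delta>\<bar>" for r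
      using lip[of r i] by meson
  qed (use e elim in auto)
  then have "\<forall>i. \<exists>H. loc_unif_limit (\<lambda>\<epsilon>. mol \<epsilon> (q i)) H" by blast
  from choice[OF this] obtain U where "\<And>i. loc_unif_limit (\<lambda>\<epsilon>. mol \<epsilon> (q i)) (U i)" by blast
  then have U: "\<And>i. continuous_on UNIV (U i)" "\<And>i x. (\<lambda>n. mol (e n) (q i) x) \<longlonglongrightarrow> U i x"
    "\<And>i K. compact K \<Longrightarrow> \<exists>B. \<forall>n. \<forall>x\<in>K. \<bar>mol (e n) (q i) x\<bar> \<le> B"
    by (simp_all add: loc_unif_limit_def)
  have "\<exists>H. loc_unif_limit (\<lambda>\<epsilon>. molD j \<epsilon> (q i)) H" for i j
    unfolding loc_unif_limit_def
  proof (rule Lipschitz_family_limit[where h="\<lambda>\<epsilon>. molD j \<epsilon> (q i)" and e=e])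
    show "continuous_on UNIV (molD j \<epsilon> (q i))" if "\<epsilon> > 0" for \<epsilon> using that q by (rule continuous_on_molD)
    show "\<exists>L\<ge>0. \<forall>x\<in>cball 0 r. \<forall>\<epsilon>\<in>{0<..1}. \<forall>\<delta>\<in>{0<..1}. \<bar>molD j \<epsilon> (q i) x - molD j \<delta> (q i) x\<bar> \<le> L * \<bar>\<epsilon> - \<delta>\<bar>" for r
      using lip[of r i] by meson
  qed (use e elim in auto)
  then have "\<forall>i. \<exists>H. \<forall>j. loc_unif_limit (\<lambda>\<epsilon>. molD j \<epsilon> (q i)) (H j)" by (intro allI choice)
  from choice[OF this] obtain D where "\<And>i j. loc_unif_limit (\<lambda>\<epsilon>. molD j \<epsilon> (q i)) (D i j)" by blast
  then have D: "\<And>i j. continuous_on UNIV (D i j)" "\<And>i j x. (\<lambda>n. molD j (e n) (q i) x) \<longlonglongrightarrow> D i j x"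
    "\<And>i j K. compact K \<Longrightarrow> \<exists>B. \<forall>n. \<forall>x\<in>K. \<bar>molD j (e n) (q i) x\<bar> \<le> B"
    by (simp_all add: loc_unif_limit_def)
  \<comment> \<open>Derivatives of the mollifications are mollifications of the weak gradient, so
    their limits can be identified with it almost everywhere.\<close>
  have molD: "molD j (e n) (q i) = mol (e n) (g i j)" for i j n
    by (rule ext, rule molD_weak_derivative[OF _ e0(1)])
       (use G in \<open>simp add: has_weak_gradient_def q_def g_def\<close>)
  have qU: "AE x in lebesgue. q i x = U i x" for i
    by (rule mol_limit_AE[OF q U(1) e elim U(2) U(3)])
  have gD: "AE x in lebesgue. g i j x = D i j x" for i j
    by (rule mol_limit_AE[OF g D(1) e elim D(2)[unfolded molD] D(3)[unfolded molD]])
  define U' where "U' x = (\<chi> i. U i x)" for x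
  define D' where "D' x = (\<chi> i j. D i j x)" for x
  have cU: "continuous_on UNIV U'" and cD: "continuous_on UNIV D'"
    unfolding U'_def D'_def by (intro continuous_intros U D)+
  have "AE x in lebesgue. \<forall>i. q i x = U i x" using qU by (simp add: AE_all_countable)
  then have uU: "AE x in lebesgue. u x = U' x"
    by eventually_elim (simp add: U'_def q_def vec_eq_iff)
  have "AE x in lebesgue. \<forall>i j. g i j x = D i j x" using gD by (simp add: AE_all_countable)
  then have GD: "AE x in lebesgue. G x = D' x"
    by eventually_elim (simp add: D'_def g_def vec_eq_iff)
  \<comment> \<open>The continuous representative of \<open>f i\<close>: mollification does not
    distinguish the two, and for the continuous one it converges at every point.\<close>
  define F where "F i x = gradient W (U' x) $ i" for i x
  have cW: "continuous_on UNIV W" using W by (meson has_derivative_continuous continuous_at_imp_continuous_on)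
  have cF: "continuous_on UNIV (F i)" for i
    unfolding F_def by (intro continuous_intros continuous_on_compose2[OF DW cU]) auto
  have molF: "mol (e n) (f i) x = mol (e n) (F i) x" for i n x
    unfolding mol_def corr_def
  proof (rule integral_cong_AE)
    have "(\<lambda>y. - 2 * Phi 1 (e n) (y - x)) \<in> borel_measurable lebesgue"
      by (intro continuous_measurable_lebesgue continuous_intros)
    then show "(\<lambda>y. f i y * (- 2 * Phi 1 (e n) (y - x))) \<in> borel_measurable lebesgue"
      "(\<lambda>y. F i y * (- 2 * Phi 1 (e n) (y - x))) \<in> borel_measurable lebesgue"
      using fm continuous_measurable_lebesgue[OF cF] by (auto intro: borel_measurable_times)
    show "AE y in lebesgue. f i y * (- 2 * Phi 1 (e n) (y - x)) = F i y * (- 2 * Phi 1 (e n) (y - x))"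
      using uU by eventually_elim (simp add: f_def F_def)
  qed
  have Flim: "(\<lambda>n. mol (e n) (f i) x) \<longlonglongrightarrow> F i x" for i x
    unfolding molF using cF continuous_on_eq_continuous_at[of UNIV "F i"]
    by (intro mol_tendsto L1_loc_continuous cF e0 elim) auto
  have Fbd: "\<exists>B. \<forall>n. \<forall>x\<in>cball x0 r. \<bar>mol (e n) (f i) x\<bar> \<le> B" for i x0 r
  proof -
    obtain M where M: "AE x in lebesgue. x \<in> cball x0 (r + 1) \<longrightarrow> \<bar>f i x\<bar> \<le> M"
      using fb[OF compact_cball] by blast
    have "\<bar>mol (e n) (f i) x - 0\<bar> \<le> M" if "x \<in> cball x0 r" for n x
    proof (rule mol_diff_bound[OF e0(1) f])
      show "AE y in lebesgue. y \<in> cball x (e n) \<longrightarrow> \<bar>f i y - 0\<bar> \<le> M"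
        using M
      proof eventually_elim
        case (elim y)
        show ?case using elim that e0(2)[of n] dist_triangle[of x0 y x] by auto
      qed
    qed
    then show ?thesis by (intro exI[of _ M]) simp
  qed
  show thesis
  proof (rule that[OF cU cD uU GD])
    fix \<phi> \<phi>' :: "real \<Rightarrow> real" and b :: real and x0 :: "real^'n"
    assume \<phi>: "\<And>s. (\<phi> has_real_derivative \<phi>' s) (at s)" and \<phi>': "continuous_on UNIV \<phi>'"
      and \<phi>0: "\<And>s. s \<ge> b \<Longrightarrow> \<phi> s = 0" and \<phi>'0: "\<And>s. s \<ge> b \<Longrightarrow> \<phi>' s = 0" and b: "b \<ge> 0"
    have c\<phi>: "continuous_on UNIV \<phi>" using \<phi> by (meson DERIV_isCont continuous_at_imp_continuous_on)
    \<comment> \<open>The mollified datum is carried as a third component: it is the Laplacian of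
      the first one, and its limit is known independently.\<close>
    define V where "V n x = ((\<chi> i. mol (e n) (q i) x), ((\<chi> i j. molD j (e n) (q i) x), (\<chi> i. mol (e n) (f i) x)))" for n x
    define V' where "V' x = (U' x, (D' x, (\<chi> i. F i x)))" for x
    define \<Psi>L where "\<Psi>L x p = \<phi> ((norm (x - x0))\<^sup>2) * ((real CARD('n) - 2) * energy_density W (fst (snd p)) (fst p) + 2 * W (fst p))
        + 2 * \<phi>' ((norm (x - x0))\<^sup>2) * ((norm (x - x0))\<^sup>2 * energy_density W (fst (snd p)) (fst p)
            - (\<Sum>i\<in>UNIV. (\<Sum>j\<in>UNIV. (x - x0) $ j * fst (snd p) $ i $ j)\<^sup>2))"
      for x :: "real^'n" and p :: "(real^'m) \<times> (real^'n^'m) \<times> (real^'m)"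
    define \<Psi>R where "\<Psi>R x p = \<phi> ((norm (x - x0))\<^sup>2) *
      (\<Sum>i\<in>UNIV. (\<Sum>j\<in>UNIV. (x - x0) $ j * fst (snd p) $ i $ j) * (snd (snd p) $ i - gradient W (fst p) $ i))"
      for x :: "real^'n" and p :: "(real^'m) \<times> (real^'n^'m) \<times> (real^'m)"
    have far: "(norm (x - x0))\<^sup>2 \<ge> b" if "norm (x - x0) \<ge> sqrt b" for x
      using that b by (metis real_sqrt_le_iff real_sqrt_abs abs_norm_cancel)
    have cV: "continuous_on UNIV (V n)" for n
      unfolding V_def by (intro continuous_intros continuous_on_mol continuous_on_molD e0 q f)
    have cV': "continuous_on UNIV V'"
      unfolding V'_def by (intro continuous_intros cU cD cF)
    have limV: "(\<lambda>n. V n x) \<longlonglongrightarrow> V' x" for x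
      unfolding V_def V'_def U'_def D'_def by (intro tendsto_intros U D Flim)
    obtain BV where BV: "\<And>n x. x \<in> cball x0 (sqrt b) \<Longrightarrow> norm (V n x) \<le> BV"
    proof -
      obtain B1 where B1: "\<And>i n x. x \<in> cball x0 (sqrt b) \<Longrightarrow> \<bar>mol (e n) (q i) x\<bar> \<le> B1 i"
        using U(3)[OF compact_cball] by metis
      have "\<forall>i. \<exists>B. \<forall>j. \<forall>n. \<forall>x\<in>cball x0 (sqrt b). \<bar>molD j (e n) (q i) x\<bar> \<le> B j"
        using D(3)[OF compact_cball] by (intro allI choice)
      from choice[OF this] obtain B2 where B2: "\<And>i j n x. x \<in> cball x0 (sqrt b) \<Longrightarrow> \<bar>molD j (e n) (q i) x\<bar> \<le> B2 i j"
        by blast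
      obtain B3 where B3: "\<And>i n x. x \<in> cball x0 (sqrt b) \<Longrightarrow> \<bar>mol (e n) (f i) x\<bar> \<le> B3 i"
        using Fbd by metis
      have m1: "a i \<le> Max (range a)" for a :: "'m \<Rightarrow> real" and i by simp
      have m2: "a i j \<le> Max (range (case_prod a))" for a :: "'m \<Rightarrow> 'n \<Rightarrow> real" and i j
        by (rule Max_ge) (auto intro: range_eqI[of _ _ "(i, j)"])
      have "norm (V n x) \<le> real CARD('m) * Max (range B1) + (real CARD('m) * (real CARD('n) * Max (range (case_prod B2)))
          + real CARD('m) * Max (range B3))" if x: "x \<in> cball x0 (sqrt b)" for n x
      proof -
        have "norm (\<chi> i. mol (e n) (q i) x) \<le> real CARD('m) * Max (range B1)"
          by (intro norm_vec_le) (simp add: order_trans[OF B1[OF x] m1[of B1]])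
        moreover have "norm (\<chi> i j. molD j (e n) (q i) x) \<le> real CARD('m) * (real CARD('n) * Max (range (case_prod B2)))"
          by (intro norm_vec_le) (simp add: order_trans[OF B2[OF x] m2[of B2]])
        moreover have "norm (\<chi> i. mol (e n) (f i) x) \<le> real CARD('m) * Max (range B3)"
          by (intro norm_vec_le) (simp add: order_trans[OF B3[OF x] m1[of B3]])
        ultimately show ?thesis
          unfolding V_def by (intro order_trans[OF norm_Pair_le] add_mono)
      qed
      then show thesis by (rule that)
    qed
    have cG: "continuous_on UNIV (\<lambda>z. h ((norm (fst z - x0))\<^sup>2))" if "continuous_on UNIV h"
      for h :: "real \<Rightarrow> real" and z :: "(real^'n) \<times> ((real^'m) \<times> (real^'n^'m) \<times> (real^'m))"
      by (rule continuous_on_compose2[OF that]) (auto intro!: continuous_intros)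
    have cWz: "continuous_on UNIV (\<lambda>z::(real^'n) \<times> ((real^'m) \<times> (real^'n^'m) \<times> (real^'m)). W (fst (snd z)))"
      and cDWz: "continuous_on UNIV (\<lambda>z::(real^'n) \<times> ((real^'m) \<times> (real^'n^'m) \<times> (real^'m)). gradient W (fst (snd z)))"
      by (rule continuous_on_compose2[OF cW] continuous_on_compose2[OF DW]; auto intro!: continuous_intros)+
    have LL: "(\<lambda>n. LINT x|lebesgue. \<Psi>L x (V n x)) \<longlonglongrightarrow> (LINT x|lebesgue. \<Psi>L x (V' x))"
    proof (rule integral_parametrized_tendsto[where r="sqrt b" and ?x0.0=x0, OF _ _ cV limV cV' BV])
      show "continuous_on UNIV (\<lambda>(x, p). \<Psi>L x p)"
        unfolding \<Psi>L_def energy_density_def split_beta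
        by (intro continuous_intros cG[OF c\<phi>] cG[OF \<phi>'] cWz) simp_all
    qed (simp_all add: \<Psi>L_def \<phi>0 \<phi>'0 far)
    have RR: "(\<lambda>n. LINT x|lebesgue. \<Psi>R x (V n x)) \<longlonglongrightarrow> (LINT x|lebesgue. \<Psi>R x (V' x))"
    proof (rule integral_parametrized_tendsto[where r="sqrt b" and ?x0.0=x0, OF _ _ cV limV cV' BV])
      show "continuous_on UNIV (\<lambda>(x, p). \<Psi>R x p)"
        unfolding \<Psi>R_def split_beta
        by (intro continuous_intros cG[OF c\<phi>] cDWz)
    qed (simp_all add: \<Psi>R_def \<phi>0 far)
    have "(LINT x|lebesgue. \<Psi>L x (V n x)) = (LINT x|lebesgue. \<Psi>R x (V n x))" for n
    proof -
      have S: "(\<Sum>k\<in>UNIV. molH k k (e n) (q i) x) = mol (e n) (f i) x" for i x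
        by (rule trace_molH[OF q f weak e0(1)])
      show ?thesis
        using pohozaev_identity[where v="\<lambda>i. mol (e n) (q i)" and B="\<lambda>i j. molD j (e n) (q i)" and S="\<lambda>i j k. molH j k (e n) (q i)"
            and W=W and DW="gradient W" and \<phi>=\<phi> and \<phi>'=\<phi>' and b=b and ?x0.0=x0,
            OF DERIV_mol[OF e0(1) q] DERIV_molD[OF e0(1) q] _ continuous_on_mol[OF e0(1) q] continuous_on_molD[OF e0(1) q]
              continuous_on_molH[OF e0(1) q] W DW \<phi> \<phi>' \<phi>0 \<phi>'0 b]
        by (simp add: \<Psi>L_def \<Psi>R_def V_def S fun_cong[OF fun_cong[OF molH_sym]])
    qed
    with LL RR have "(LINT x|lebesgue. \<Psi>L x (V' x)) = (LINT x|lebesgue. \<Psi>R x (V' x))"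
      by (simp add: LIMSEQ_unique)
    \<comment> \<open>The third component of the limit is the gradient of W at the first one, so the
      integrand vanishes identically.\<close>
    also have "\<dots> = 0" by (simp add: \<Psi>R_def V'_def F_def)
    finally show "(LINT x|lebesgue. \<phi> ((norm (x - x0))\<^sup>2) * ((real CARD('n) - 2) * energy_density W (D' x) (U' x) + 2 * W (U' x))
        + 2 * \<phi>' ((norm (x - x0))\<^sup>2) * ((norm (x - x0))\<^sup>2 * energy_density W (D' x) (U' x)
            - (\<Sum>i\<in>UNIV. (\<Sum>j\<in>UNIV. (x - x0) $ j * D' x $ i $ j)\<^sup>2))) = 0"
      by (simp add: \<Psi>L_def V'_def)
  qed
qed

section \<open>Monotonicity\<close>

lemma DERIV_max_0_square: "((\<lambda>s. (max 0 s)\<^sup>2 / 2) has_real_derivative max 0 s) (at s)"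
proof -
  consider "s < 0" | "s = 0" | "s > 0" by linarith
  then show ?thesis
  proof cases
    case 1
    have "((\<lambda>s. 0 :: real) has_real_derivative 0) (at s)" by simp
    then have "((\<lambda>s. (max 0 s)\<^sup>2 / 2) has_real_derivative 0) (at s)"
      by (rule has_field_derivative_transform_within_open[where S="{..<0}"]) (use 1 in auto)
    then show ?thesis using 1 by simp
  next
    case 3
    have "((\<lambda>s. s\<^sup>2 / 2) has_real_derivative s) (at s)" by (auto intro!: derivative_eq_intros)
    then have "((\<lambda>s. (max 0 s)\<^sup>2 / 2) has_real_derivative s) (at s)"
      by (rule has_field_derivative_transform_within_open[where S="{0<..}"]) (use 3 in auto)
    then show ?thesis using 3 by simp
  next
    case 2
    have "((\<lambda>h::real. (max 0 h)\<^sup>2 / 2 / h) \<longlongrightarrow> 0) (at 0)"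
    proof (rule Lim_null_comparison)
      have "\<bar>(max 0 h)\<^sup>2 / 2 / h\<bar> \<le> \<bar>h\<bar>" for h :: real
        by (cases "h > 0") (auto simp: power2_eq_square)
      then show "\<forall>\<^sub>F h in at 0. norm ((max 0 h)\<^sup>2 / 2 / h) \<le> \<bar>h::real\<bar>" by simp
      show "((\<lambda>h::real. \<bar>h\<bar>) \<longlongrightarrow> 0) (at 0)" by (rule tendsto_rabs_zero) simp
    qed
    then show ?thesis using 2 by (simp add: DERIV_def)
  qed
qed

text \<open>A \<open>C\<^sup>1\<close> cutoff whose slope nowhere exceeds \<open>1 / (b - a - d)\<close>: the difference of two shifted
  copies of the ramp \<open>r\<close>, which is a \<open>C\<^sup>1\<close> smoothing of \<open>t \<mapsto> max 0 t\<close>.\<close>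

lemma C1_cutoff:
  fixes a b d :: real
  assumes d: "0 < d" "d < b - a"
  obtains \<phi> \<phi>' where "\<And>s. (\<phi> has_real_derivative \<phi>' s) (at s)" "continuous_on UNIV \<phi>'"
    "\<And>s. s \<le> a \<Longrightarrow> \<phi> s = 1" "\<And>s. s \<le> a \<Longrightarrow> \<phi>' s = 0" "\<And>s. s \<ge> b \<Longrightarrow> \<phi> s = 0" "\<And>s. s \<ge> b \<Longrightarrow> \<phi>' s = 0"
    "\<And>s. \<phi> s \<ge> 0" "\<And>s. \<phi>' s \<le> 0" "\<And>s. - \<phi>' s \<le> 1 / (b - a - d)"
proof -
  define r where "r t = ((max 0 t)\<^sup>2 / 2 - (max 0 (t - d))\<^sup>2 / 2) / d" for t :: real
  define c where "c t = (max 0 t - max 0 (t - d)) / d" for t :: real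
  \<comment> \<open>To the right of its smoothed corner the ramp is t - d/2. The two offsets cancel
    in the difference, which leaves exactly b - a - d for s <= a; this fixes the divisor.\<close>
  define \<phi> where "\<phi> s = (r (b - s) - r (a + d - s)) / (b - a - d)" for s
  define \<phi>' where "\<phi>' s = - (c (b - s) - c (a + d - s)) / (b - a - d)" for s
  have dr: "(r has_real_derivative c t) (at t)" for t
  proof -
    have "((\<lambda>t. (max 0 (t - d))\<^sup>2 / 2) has_real_derivative max 0 (t - d) * 1) (at t)"
      by (rule DERIV_chain2[OF DERIV_max_0_square]) (auto intro!: derivative_eq_intros)
    then show ?thesis
      unfolding r_def[abs_def] c_def by (intro DERIV_cdivide DERIV_diff DERIV_max_0_square) simp
  qed
  have d\<phi>: "(\<phi> has_real_derivative \<phi>' s) (at s)" for s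
  proof -
    have "((\<lambda>s. r (z - s)) has_real_derivative c (z - s) * - 1) (at s)" for z
      by (rule DERIV_chain2[OF dr]) (auto intro!: derivative_eq_intros)
    then have "(\<phi> has_real_derivative (c (b - s) * - 1 - c (a + d - s) * - 1) / (b - a - d)) (at s)"
      unfolding \<phi>_def[abs_def] by (intro DERIV_cdivide DERIV_diff)
    then show ?thesis by (simp add: \<phi>'_def)
  qed
  have cc: "continuous_on UNIV \<phi>'" unfolding \<phi>'_def c_def using d by (intro continuous_intros) auto
  have c01: "0 \<le> c t" "c t \<le> 1" for t using d by (auto simp: c_def max_def)
  have cmono: "c s \<le> c t" if "s \<le> t" for s t using d that by (auto simp: c_def max_def divide_right_mono)
  have r0: "r t = 0" "c t = 0" if "t \<le> 0" for t using that d by (auto simp: r_def c_def max_def)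
  have r1: "r t = t - d / 2" "c t = 1" if "t \<ge> d" for t
    using that d by (auto simp: r_def c_def max_def field_simps power2_eq_square)
  have neg: "\<phi>' s \<le> 0" for s
    using cmono[of "a + d - s" "b - s"] d unfolding \<phi>'_def by (intro divide_nonpos_pos) auto
  have zero: "\<phi> s = 0" if "s \<ge> b" for s using that d by (simp add: \<phi>_def r0)
  have nn: "\<phi> s \<ge> 0" for s
  proof (cases "s \<le> b")
    case True
    have "\<phi> b \<le> \<phi> s" using True by (rule DERIV_nonpos_imp_nonincreasing) (use d\<phi> neg in blast)
    then show ?thesis by (simp add: zero)
  qed (simp add: zero)
  have "- \<phi>' s \<le> 1 / (b - a - d)" for s
  proof -
    have "c (b - s) - c (a + d - s) \<le> 1" using c01(1)[of "a + d - s"] c01(2)[of "b - s"] by linarith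
    then have "(c (b - s) - c (a + d - s)) / (b - a - d) \<le> 1 / (b - a - d)" using d by (intro divide_right_mono) auto
    then show ?thesis unfolding \<phi>'_def by (simp only: minus_divide_left minus_minus)
  qed
  moreover have "\<phi> s = 1" "\<phi>' s = 0" if "s \<le> a" for s
    using that d by (simp_all add: \<phi>_def \<phi>'_def r1)
  moreover have "\<phi>' s = 0" if "s \<ge> b" for s using that d by (simp add: \<phi>'_def r0)
  ultimately show thesis using that d\<phi> cc zero nn neg by blast
qed

lemma frobenius_norm_sq: "(norm (A :: real^'n::finite^'m::finite))\<^sup>2 = (\<Sum>i\<in>UNIV. \<Sum>j\<in>UNIV. (A $ i $ j)\<^sup>2)"
  unfolding power2_norm_eq_inner inner_vec_def by (simp add: power2_eq_square)

lemma integrable_indicator_ball_mult: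
  fixes g :: "'a::euclidean_space \<Rightarrow> real"
  assumes "continuous_on UNIV g"
  shows "integrable lebesgue (\<lambda>x. indicator (ball x0 r) x * g x)"
proof (rule Bochner_Integration.integrable_bound)
  show "integrable lebesgue (\<lambda>y. indicator (cball x0 r) y *\<^sub>R g y)"
    using L1_loc_continuous[OF assms] by (simp add: L1_loc_def set_integrable_def)
  show "(\<lambda>y. indicator (ball x0 r) y * g y) \<in> borel_measurable lebesgue"
    by (intro borel_measurable_times borel_measurable_indicator continuous_measurable_lebesgue assms) auto
qed (auto simp: indicator_def)

theorem theorem2p1:
  fixes W :: "real^'n::finite \<Rightarrow> real"
    and u :: "real^'n \<Rightarrow> real^'n"
    and x0 :: "real^'n"
  assumes "C_k 2 W"
    and "\<And>p. W p \<ge> 0"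
    and "W12_loc u"
    and "Linf_loc u"
    and "weak_solution W u"
  shows "\<forall>R>0. \<exists>D\<ge>0.
    ((\<lambda>r. r powi (- (int CARD('n) - 2)) * energy W u (ball x0 r)) has_real_derivative D) (at R)"
proof (intro allI impI)
  fix R :: real assume R: "R > 0"
  have C2: "C_k (Suc (Suc 0)) W" using assms(1) by (simp add: eval_nat_numeral)
  have W: "(W has_derivative (\<lambda>h. gradient W p \<bullet> h)) (at p)" for p
  proof -
    have d: "(W has_derivative frechet_derivative W (at p)) (at p)" by (rule C_k_deriv[OF C2])
    have "frechet_derivative W (at p) h = gradient W p \<bullet> h" for h
    proof -
      have "frechet_derivative W (at p) h = frechet_derivative W (at p) (\<Sum>i\<in>UNIV. h $ i *\<^sub>R axis i 1)"
        using basis_expansion[of h] by (simp add: scalar_mult_eq_scaleR)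
      also have "\<dots> = (\<Sum>i\<in>UNIV. h $ i * frechet_derivative W (at p) (axis i 1))"
        using has_derivative_linear[OF d] by (simp add: linear_sum linear_scale)
      finally show ?thesis by (simp add: gradient_def partial_def inner_vec_def mult.commute)
    qed
    then have "frechet_derivative W (at p) = (\<lambda>h. gradient W p \<bullet> h)" by blast
    with d show ?thesis by simp
  qed
  have DW: "continuous_on UNIV (gradient W)"
  proof -
    have "C_k (Suc 0) (partial j W)" for j using C2 by simp
    then have "continuous_on UNIV (partial j W)" for j by (rule C_k_continuous)
    then show ?thesis unfolding gradient_def by (intro continuous_intros)
  qed
  have cW: "continuous_on UNIV W" using C_k_continuous[OF C2] .
  \<comment> \<open>Existence makes the chosen \<open>weak_gradient u\<close> a genuine weak
    gradient.\<close>
  have "\<exists>G. has_weak_gradient u G" using assms(3) by (auto simp: W12_loc_def)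
  then have G: "has_weak_gradient u (weak_gradient u)"
    unfolding weak_gradient_def by (rule someI_ex)
  show "\<exists>D\<ge>0. ((\<lambda>r. r powi (- (int CARD('n) - 2)) * energy W u (ball x0 r)) has_real_derivative D) (at R)"
  proof (rule pohozaev_weak_solution[OF W DW G assms(4,5)])
    fix U :: "real^'n \<Rightarrow> real^'n" and D :: "real^'n \<Rightarrow> real^'n^'n"
    assume cU: "continuous_on UNIV U" and cD: "continuous_on UNIV D"
      and uU: "AE x in lebesgue. u x = U x" and GD: "AE x in lebesgue. weak_gradient u x = D x"
      and poh: "\<And>\<phi> \<phi>' b x0. \<lbrakk>\<And>s. (\<phi> has_real_derivative \<phi>' s) (at s); continuous_on UNIV \<phi>';
          \<And>s. s \<ge> b \<Longrightarrow> \<phi> s = 0; \<And>s. s \<ge> b \<Longrightarrow> \<phi>' s = 0; b \<ge> 0\<rbrakk> \<Longrightarrow>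
        (LINT x|lebesgue. \<phi> ((norm (x - x0))\<^sup>2) * ((real CARD('n) - 2) * energy_density W (D x) (U x) + 2 * W (U x))
          + 2 * \<phi>' ((norm (x - x0))\<^sup>2) * ((norm (x - x0))\<^sup>2 * energy_density W (D x) (U x)
              - (\<Sum>i\<in>UNIV. (\<Sum>j\<in>UNIV. (x - x0) $ j * D x $ i $ j)\<^sup>2))) = 0"
    define e where "e x = energy_density W (D x) (U x)" for x
    define n where "n = real CARD('n)"
    have ce: "continuous_on UNIV e"
      unfolding e_def energy_density_def
      by (intro continuous_intros cD continuous_on_compose2[OF cW cU]) auto
    have e0: "e x \<ge> 0" for x
      unfolding e_def energy_density_def by (intro add_nonneg_nonneg divide_nonneg_pos sum_nonneg assms(2)) auto
    define E where "E r = (LINT x|lebesgue. indicator (ball x0 r) x * e x)" for r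
    have int: "integrable lebesgue (\<lambda>x. indicator (ball x0 r) x * e x)" for r
      by (rule integrable_indicator_ball_mult[OF ce])
    \<comment> \<open>The energy sees \<open>u\<close> and its weak gradient only up to null sets,
      so their continuous representatives may replace them.\<close>
    have energy: "energy W u (ball x0 r) = E r" for r
      unfolding energy_def set_lebesgue_integral_def E_def
    proof (rule integral_cong_AE)
      have ae: "AE x in lebesgue. 1 / 2 * (norm (weak_gradient u x))\<^sup>2 + W (u x) = e x"
        using uU GD by eventually_elim (simp add: e_def energy_density_def frobenius_norm_sq)
      then show "AE x in lebesgue. indicator (ball x0 r) x *\<^sub>R (1 / 2 * (norm (weak_gradient u x))\<^sup>2 + W (u x)) = indicator (ball x0 r) x * e x"
        by eventually_elim simp
      have "weak_gradient u \<in> borel_measurable lebesgue" "u \<in> borel_measurable lebesgue"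
        using G by (auto simp: has_weak_gradient_def L1_loc_def)
      then have "(\<lambda>x. 1 / 2 * (norm (weak_gradient u x))\<^sup>2 + W (u x)) \<in> borel_measurable lebesgue"
        using borel_measurable_continuous_on[OF cW] by (intro borel_measurable_add) measurable
      then show "(\<lambda>x. indicator (ball x0 r) x *\<^sub>R (1 / 2 * (norm (weak_gradient u x))\<^sup>2 + W (u x))) \<in> borel_measurable lebesgue"
        by (intro borel_measurable_scaleR borel_measurable_indicator) auto
      show "(\<lambda>x. indicator (ball x0 r) x * e x) \<in> borel_measurable lebesgue"
        using int by (rule borel_measurable_integrable)
    qed
    have E0: "E r \<ge> 0" for r
      unfolding E_def using e0 by (intro Bochner_Integration.integral_nonneg) (simp add: indicator_def)
    obtain E' where E': "(E has_real_derivative E') (at R)"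
      using DERIV_integral_ball[OF ce R, of x0] unfolding E_def[abs_def] set_lebesgue_integral_def by auto
    have growth: "(n - 2) * (r + R) * E R \<le> 2 * r\<^sup>2 * ((E r - E R) / (r - R))" if n2: "n \<ge> 2" and r: "r > R" for r
    proof -
      define a where "a = R\<^sup>2"
      define b where "b = r\<^sup>2"
      have ab: "0 < a" "a < b" using R r by (auto simp: a_def b_def power_strict_mono)
      have inb: "x \<in> ball x0 R \<longleftrightarrow> (norm (x - x0))\<^sup>2 < a" "x \<in> ball x0 r \<longleftrightarrow> (norm (x - x0))\<^sup>2 < b" for x
        using R r by (simp_all add: a_def b_def dist_norm norm_minus_commute power_mono_iff flip: not_le)
      have ineq: "(n - 2) * E R * (b - a - d) \<le> 2 * b * (E r - E R)" if d: "0 < d" "d < b - a" for d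
      proof -
        obtain \<phi> \<phi>' where \<phi>: "\<And>s. (\<phi> has_real_derivative \<phi>' s) (at s)" "continuous_on UNIV \<phi>'"
          "\<And>s. s \<le> a \<Longrightarrow> \<phi> s = 1" "\<And>s. s \<le> a \<Longrightarrow> \<phi>' s = 0" "\<And>s. s \<ge> b \<Longrightarrow> \<phi> s = 0" "\<And>s. s \<ge> b \<Longrightarrow> \<phi>' s = 0"
          "\<And>s. \<phi> s \<ge> 0" "\<And>s. \<phi>' s \<le> 0" "\<And>s. - \<phi>' s \<le> 1 / (b - a - d)"
          using C1_cutoff[OF d] by blast
        \<comment> \<open>The bound for -2 s \<phi>' on the shell, where s < b and the slope of the
          cutoff is at most 1 / (b - a - d).\<close>
        define k where "k = 2 * b / (b - a - d)"
        define s where "s x = (norm (x - x0))\<^sup>2" for x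
        define Q where "Q x = (\<Sum>i\<in>UNIV. (\<Sum>j\<in>UNIV. (x - x0) $ j * D x $ i $ j)\<^sup>2)" for x
        define L where "L x = \<phi> (s x) * ((n - 2) * e x + 2 * W (U x)) + 2 * \<phi>' (s x) * (s x * e x - Q x)" for x
        have c\<phi>: "continuous_on UNIV \<phi>" using \<phi>(1) by (meson DERIV_isCont continuous_at_imp_continuous_on)
        have cs: "continuous_on UNIV s" unfolding s_def by (intro continuous_intros)
        have cL: "continuous_on UNIV L"
          unfolding L_def Q_def
          by (intro continuous_intros ce cs cD continuous_on_compose2[OF cW cU] continuous_on_compose2[OF c\<phi> cs]
              continuous_on_compose2[OF \<phi>(2) cs]) auto
        have intL: "integrable lebesgue L"
        proof (rule integrable_continuous_supported[OF cL])
          show "L x = 0" if "norm (x - x0) \<ge> r" for x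
          proof -
            have "s x \<ge> b" using that R r unfolding s_def b_def by (intro power_mono) auto
            then show ?thesis by (simp add: L_def \<phi>)
          qed
        qed
        have "(LINT x|lebesgue. L x) = 0"
          using poh[OF \<phi>(1,2,5,6), where ?x0.0=x0] ab by (simp add: L_def e_def n_def s_def Q_def)
        moreover have "(LINT x|lebesgue. (n - 2) * (indicator (ball x0 R) x * e x)
            - k * (indicator (ball x0 r) x * e x - indicator (ball x0 R) x * e x)) \<le> (LINT x|lebesgue. L x)"
        proof (rule integral_mono[OF _ intL])
          show "integrable lebesgue (\<lambda>x. (n - 2) * (indicator (ball x0 R) x * e x)
            - k * (indicator (ball x0 r) x * e x - indicator (ball x0 R) x * e x))"
            by (intro Bochner_Integration.integrable_diff integrable_mult_right int)
          fix x
          have Q0: "Q x \<ge> 0" unfolding Q_def by (intro sum_nonneg) simp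
          consider "s x < a" | "a \<le> s x" "s x < b" | "s x \<ge> b" by linarith
          then show "(n - 2) * (indicator (ball x0 R) x * e x)
            - k * (indicator (ball x0 r) x * e x - indicator (ball x0 R) x * e x) \<le> L x"
          proof cases
            case 1
            then have "x \<in> ball x0 R" "x \<in> ball x0 r" using inb[of x] ab by (auto simp: s_def)
            then show ?thesis using 1 assms(2)[of "U x"] by (simp add: L_def \<phi>)
          next
            case 2
            then have "x \<notin> ball x0 R" "x \<in> ball x0 r" using inb[of x] by (auto simp: s_def)
            then have lhs: "(n - 2) * (indicator (ball x0 R) x * e x)
            - k * (indicator (ball x0 r) x * e x - indicator (ball x0 R) x * e x) = - k * e x" by simp
            have "(- \<phi>' (s x)) * s x \<le> 1 / (b - a - d) * b"
              using 2 \<phi>(8,9)[of "s x"] d ab by (intro mult_mono) auto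
            then have "2 * ((- \<phi>' (s x)) * s x) * e x \<le> k * e x"
              using e0[of x] by (intro mult_right_mono) (simp_all add: k_def)
            moreover have "\<phi>' (s x) * Q x \<le> 0" using \<phi>(8) Q0 by (simp add: mult_nonpos_nonneg)
            moreover have "\<phi> (s x) * ((n - 2) * e x + 2 * W (U x)) \<ge> 0"
              using \<phi>(7) n2 e0 assms(2) by (intro mult_nonneg_nonneg add_nonneg_nonneg) auto
            ultimately show ?thesis unfolding lhs L_def by (simp add: algebra_simps)
          next
            case 3
            then have "x \<notin> ball x0 R" "x \<notin> ball x0 r" using inb[of x] ab by (auto simp: s_def)
            then show ?thesis using 3 by (simp add: L_def \<phi>)
          qed
        qed
        moreover have "(LINT x|lebesgue. (n - 2) * (indicator (ball x0 R) x * e x)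
            - k * (indicator (ball x0 r) x * e x - indicator (ball x0 R) x * e x)) = (n - 2) * E R - k * (E r - E R)"
          unfolding E_def using int
          by (simp add: Bochner_Integration.integral_diff)
        ultimately have "(n - 2) * E R \<le> k * (E r - E R)" by simp
        then have "(n - 2) * E R * (b - a - d) \<le> k * (E r - E R) * (b - a - d)"
          using d by (intro mult_right_mono) auto
        then show ?thesis using d by (simp add: k_def)
      qed
      \<comment> \<open>The slope 1 / (b - a) is out of reach for a C^1 cutoff that is flat at both
        ends, so it is recovered by letting the smoothing width tend to 0.\<close>
      have "(n - 2) * E R * (b - a - 0) \<le> 2 * b * (E r - E R)"
      proof (rule tendsto_upperbound)
        show "((\<lambda>d. (n - 2) * E R * (b - a - d)) \<longlongrightarrow> (n - 2) * E R * (b - a - 0)) (at_right 0)"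
          by (intro tendsto_intros)
        show "\<forall>\<^sub>F d in at_right 0. (n - 2) * E R * (b - a - d) \<le> 2 * b * (E r - E R)"
          using ab ineq by (auto simp: eventually_at_right_field intro!: exI[of _ "b - a"])
      qed simp
      moreover have "b - a - 0 = (r + R) * (r - R)" by (simp add: a_def b_def algebra_simps power2_eq_square)
      ultimately have "((n - 2) * (r + R) * E R) * (r - R) \<le> 2 * b * (E r - E R)"
        by (simp add: mult_ac)
      then show ?thesis using r by (simp add: b_def pos_le_divide_eq)
    qed
    have main: "(n - 2) * E R \<le> R * E'"
    proof (cases "n \<ge> 2")
      case True
      \<comment> \<open>The two-sided derivative is already known to exist, so the quotients from
        the right, which \<open>growth\<close> controls, determine it.\<close>
      have q: "((\<lambda>r. (E r - E R) / (r - R)) \<longlongrightarrow> E') (at_right R)"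
        using E' unfolding has_field_derivative_iff by (rule tendsto_within_subset) simp
      have "(n - 2) * (R + R) * E R \<le> 2 * R\<^sup>2 * E'"
      proof (rule tendsto_le)
        show "((\<lambda>r. 2 * r\<^sup>2 * ((E r - E R) / (r - R))) \<longlongrightarrow> 2 * R\<^sup>2 * E') (at_right R)"
          by (intro tendsto_intros q)
        show "((\<lambda>r. (n - 2) * (r + R) * E R) \<longlongrightarrow> (n - 2) * (R + R) * E R) (at_right R)"
          by (intro tendsto_intros)
        show "\<forall>\<^sub>F r in at_right R. (n - 2) * (r + R) * E R \<le> 2 * r\<^sup>2 * ((E r - E R) / (r - R))"
          using growth[OF True] by (auto simp: eventually_at_right_field intro!: exI[of _ "R + 1"])
      qed simp
      then have "(2 * R) * ((n - 2) * E R) \<le> (2 * R) * (R * E')" by (simp add: algebra_simps power2_eq_square)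
      then show ?thesis using R by simp
    next
      case False
      \<comment> \<open>For n = 1 the left side is at most 0 because the energy is nonnegative, and
        the right side is at least 0 because the energy grows with the ball.\<close>
      have "E r \<le> E r'" if "r \<le> r'" for r r'
        unfolding E_def using that e0 by (intro integral_mono int) (auto simp: indicator_def)
      then have "E' \<ge> 0"
        using E' mono_on_imp_deriv_nonneg[of UNIV E E' R] by (simp add: mono_on_def)
      then show ?thesis using False E0[of R] R
        by (meson less_imp_le mult_nonneg_nonneg mult_nonpos_nonneg diff_le_0_iff_le linear order_trans)
    qed
    define k where "k = - (int CARD('n) - 2)"
    have k: "of_int k = - (n - 2)" by (simp add: k_def n_def)
    have "((\<lambda>r. r powi k * E r) has_real_derivative (R powi k * E' + (of_int k * R powi (k - 1)) * E R)) (at R)"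
      using R by (intro DERIV_mult' E') (auto intro!: derivative_eq_intros)
    moreover have "R powi k * E' + (of_int k * R powi (k - 1)) * E R \<ge> 0"
    proof -
      \<comment> \<open>Extracting R^(k-1) from both terms of the product rule leaves exactly the
        difference that \<open>main\<close> controls.\<close>
      have "R powi k = R powi (k - 1) * R" using R power_int_add_1[of R "k - 1"] by simp
      then have "R powi k * E' + (of_int k * R powi (k - 1)) * E R = R powi (k - 1) * (R * E' - (n - 2) * E R)"
        unfolding k by (simp add: algebra_simps)
      moreover have "R powi (k - 1) \<ge> 0" using R by (simp add: zero_le_power_int)
      ultimately show ?thesis using main by simp
    qed
    ultimately show "\<exists>D\<ge>0. ((\<lambda>r. r powi (- (int CARD('n) - 2)) * energy W u (ball x0 r)) has_real_derivative D) (at R)"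
      unfolding energy k_def[symmetric] by blast
  qed
qed

end
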